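(* Let $\eta$ satisfy $(\eta)$ and $V$ satisfy $(V)$ (as stated in the context). Fix $\rho_o\in(L^1\cap L^\infty\cap BV)(\mathbb R^n;\mathbb R^m)$, $x_o\in\mathbb R^n$ and $r>0$, and let $\rho(t)=\mathcal G_t\rho_o$ be the solution to $\partial_t \rho_i + \nabla\cdot(\rho_i V_i(\nabla\rho*\eta))=0$, $i\in\{1,\dots,m\}$, with initial datum $\rho_o$ at time $0$. If $\operatorname{spt}\rho_o\subseteq B(x_o,r)$, then for all $t\in\mathbb R$ $$\operatorname{spt}\rho(t)\subseteq B\big(x_o,\,r+W|t|\big)\qquad\text{where}\qquad W=L_V\,\|\nabla\eta\|_{L^\infty(\mathbb R^n;\mathbb R^n)}\,\|\rho_o\|_{L^1(\mathbb R^n;\mathbb R^m)}.$$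
   Context: $n,m\ge1$ are integers and $\mathbb R_+=[0,+\infty[$. All spaces $\mathbb R^n$, $\mathbb R^{n\times m}$ carry the Euclidean norm. $B(x,r)$ is the open ball in $\mathbb R^n$ centered at $x$ with radius $r$. $\|\rho\|_{L^1}=\int_{\mathbb R^n}\|\rho(x)\|\,dx$, $\|\rho\|_{L^\infty}=\operatorname{ess\,sup}\|\rho\|$, $\|u\|_{W^{1,\infty}}=\|u\|_{L^\infty}+\|Du\|_{L^\infty}$. $BV$ is the set of $L^1_{loc}$ functions whose distributional derivative is a Radon measure with finite total variation. $\nabla$ is the differential operator in the space variable $x$; $DV$ is the total derivative of $V$. The support $\operatorname{spt}\rho$ of an $L^1$ function is the complement of the union of all open sets on which $\rho=0$ a.e. Assumption $(\eta)$: $\eta\in (C^3\cap W^{3,1}\cap W^{3,\infty})(\mathbb R^n;\mathbb R)$. Assumption $(V)$: $V\in C^2(\mathbb R^{n\times m};\mathbb R^{n\times m})$, $V(0)=0$ and $\|DV\|_{W^{1,\infty}(\mathbb R^{n\times m};\mathbb R^{(n\times m)^2})}\le L_V$ for an $L_V\in\mathbb R_+$. Write $V=[V_1\cdots V_m]$ with columns $V_i\in\mathbb R^n$. For $\rho=(\rho_1,\dots,\rho_m)$, $\nabla\rho*\eta$ is the $n\times m$ matrix with entries $(\nabla\rho*\eta)_{ji}=\partial_{x_j}(\rho_i*\eta)$, where $(\rho_i(t)*\eta)(x)=\int_{\mathbb R^n}\rho_i(t,\xi)\,\eta(x-\xi)\,d\xi$. Solution: for a non trivial real interval $I$, $\rho\in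 C^0(I;L^1(\mathbb R^n;\mathbb R^m))$ is a solution to the system on $I$ if, setting $v_i(t,x)=V_i\big((\nabla\rho*\eta)(t,x)\big)$, each $\rho_i$ is a solution on $I$ of the linear equation $\partial_t\rho_i+\nabla\cdot(\rho_i\,v_i(t,x))=0$, meaning the Lagrangian one: with datum $\rho_{o,i}$ at time $0\in I$, $$\rho_i(t,x)=\rho_{o,i}\big(X_i(0;t,x)\big)\exp\Big(-\int_0^t(\nabla\cdot v_i)\big(\tau,X_i(\tau;t,x)\big)\,d\tau\Big),$$ where $t\mapsto X_i(t;t_o,x_o)$ solves $\dot x=v_i(t,x)$, $x(t_o)=x_o$ (it coincides with the distributional and with the Kružkov entropy solution). Under $(\eta)$ and $(V)$, for every $\rho_o\in(L^1\cap L^\infty\cap BV)(\mathbb R^n;\mathbb R^m)$ there is a unique global solution on $\mathbb R$ with datum $\rho_o$ at time $0$; it is denoted $t\mapsto\mathcal G_t\rho_o$. *)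

theory Defs
  imports "HOL-Analysis.Analysis" "HOL-Probability.Essential_Supremum"
begin

section \<open>Classical derivatives\<close>

text \<open>Directional derivative along \<open>b\<close>; for \<open>b\<close> a basis vector, the partial derivative.
  It is meaningful where \<open>partial_diff\<close> holds.\<close>

definition partial :: "'a::real_normed_vector \<Rightarrow> ('a \<Rightarrow> 'b::real_normed_vector) \<Rightarrow> 'a \<Rightarrow> 'b" where
  "partial b f x = vector_derivative (\<lambda>s. f (x + s *\<^sub>R b)) (at (0::real))"

definition partial_diff :: "'a::real_normed_vector \<Rightarrow> ('a \<Rightarrow> 'b::real_normed_vector) \<Rightarrow> 'a \<Rightarrow> bool" where
  "partial_diff b f x \<longleftrightarrow> (\<lambda>s. f (x + s *\<^sub>R b)) differentiable (at (0::real))"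

text \<open>Iterated partial derivatives along a list of basis vectors, and the class \<open>C\<^sup>k\<close> on the
  whole space: all partial derivatives of order at most \<open>k\<close> exist and are continuous.\<close>

primrec partials :: "'a::real_normed_vector list \<Rightarrow> ('a \<Rightarrow> 'b::real_normed_vector) \<Rightarrow> 'a \<Rightarrow> 'b" where
  "partials [] f = f"
| "partials (b # bs) f = partial b (partials bs f)"

primrec C_k :: "nat \<Rightarrow> ('a::euclidean_space \<Rightarrow> 'b::real_normed_vector) \<Rightarrow> bool" where
  "C_k 0 f \<longleftrightarrow> continuous_on UNIV f"
| "C_k (Suc k) f \<longleftrightarrow> continuous_on UNIV f \<and>
     (\<forall>b\<in>Basis. (\<forall>x. partial_diff b f x) \<and> C_k k (partial b f))"

definition gradient :: "(real^'n \<Rightarrow> real) \<Rightarrow> real^'n \<Rightarrow> real^'n" where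
  "gradient f x = (\<chi> j. partial (axis j 1) f x)"

definition divergence :: "(real^'n \<Rightarrow> real^'n) \<Rightarrow> real^'n \<Rightarrow> real" where
  "divergence w x = (\<Sum>j\<in>UNIV. partial (axis j 1) (\<lambda>y. w y $ j) x)"

text \<open>Total derivative of a map on \<open>n \<times> m\<close> matrices, as the array of its partial derivatives.
  For \<open>V\<close> with values in \<open>n \<times> m\<close> matrices, \<open>total_deriv V A\<close> lives in
  \<open>real^'m^'n^'m^'n\<close>, whose norm is the Euclidean one.\<close>

definition total_deriv ::
  "(real^'m^'n \<Rightarrow> 'b::real_normed_vector) \<Rightarrow> real^'m^'n \<Rightarrow> 'b^'m^'n" where
  "total_deriv F A = (\<chi> j i. partial (axis j (axis i 1)) F A)"


section \<open>Function spaces\<close>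

text \<open>Elements of Lebesgue spaces are represented by functions, identified almost everywhere
  with respect to \<open>lebesgue\<close>.\<close>

definition in_L1 :: "('a::euclidean_space \<Rightarrow> 'b::euclidean_space) \<Rightarrow> bool" where
  "in_L1 f \<longleftrightarrow> integrable lebesgue f"

definition in_Linf :: "('a::euclidean_space \<Rightarrow> 'b::euclidean_space) \<Rightarrow> bool" where
  "in_Linf f \<longleftrightarrow> f \<in> borel_measurable lebesgue \<and> (\<exists>C. AE x in lebesgue. norm (f x) \<le> C)"

definition in_L1_loc :: "('a::euclidean_space \<Rightarrow> 'b::euclidean_space) \<Rightarrow> bool" where
  "in_L1_loc f \<longleftrightarrow> (\<forall>K. compact K \<longrightarrow> set_integrable lebesgue K f)"

definition L1_norm :: "('a::euclidean_space \<Rightarrow> 'b::euclidean_space) \<Rightarrow> real" where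
  "L1_norm f = (LINT x|lebesgue. norm (f x))"

definition Linf_norm :: "('a::euclidean_space \<Rightarrow> 'b::real_normed_vector) \<Rightarrow> ereal" where
  "Linf_norm f = esssup lebesgue (\<lambda>x. ereal (norm (f x)))"

text \<open>\<open>D u\<close> is the classical derivative; this is used for \<open>u = D V\<close> of class \<open>C\<^sup>1\<close> only.\<close>

definition W1inf_norm :: "(real^'m^'n \<Rightarrow> 'b::real_normed_vector) \<Rightarrow> ereal" where
  "W1inf_norm u = Linf_norm u + Linf_norm (total_deriv u)"

definition test_fun :: "('a::euclidean_space \<Rightarrow> real) \<Rightarrow> bool" where
  "test_fun \<phi> \<longleftrightarrow> (\<forall>k. C_k k \<phi>) \<and> compact (closure {x. \<phi> x \<noteq> 0})"

text \<open>\<open>g\<close> is the weak derivative of \<open>f\<close> along the list \<open>bs\<close> of basis vectors.\<close>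

definition weak_deriv ::
  "'a::euclidean_space list \<Rightarrow> ('a \<Rightarrow> real) \<Rightarrow> ('a \<Rightarrow> real) \<Rightarrow> bool" where
  "weak_deriv bs f g \<longleftrightarrow> in_L1_loc f \<and> in_L1_loc g \<and>
     (\<forall>\<phi>. test_fun \<phi> \<longrightarrow>
        (LINT x|lebesgue. f x * partials bs \<phi> x) =
        (-1) ^ length bs * (LINT x|lebesgue. g x * \<phi> x))"

text \<open>The Sobolev space \<open>W\<^sup>k\<^sup>,\<^sup>p\<close>, with the predicate \<open>Lp\<close> in place of the exponent.\<close>

definition in_sobolev ::
  "nat \<Rightarrow> (('a \<Rightarrow> real) \<Rightarrow> bool) \<Rightarrow> ('a::euclidean_space \<Rightarrow> real) \<Rightarrow> bool" where
  "in_sobolev k Lp f \<longleftrightarrow>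
     (\<forall>bs. set bs \<subseteq> Basis \<and> length bs \<le> k \<longrightarrow> (\<exists>g. Lp g \<and> weak_deriv bs f g))"

text \<open>Each entry of the distributional derivative is a finite signed Borel measure, given
  (Hahn-Jordan) as a difference of two finite measures \<open>\<mu>\<close> and \<open>\<nu>\<close>; finite Borel measures on
  Euclidean spaces are Radon.\<close>

definition in_BV :: "('a::euclidean_space \<Rightarrow> 'b::euclidean_space) \<Rightarrow> bool" where
  "in_BV f \<longleftrightarrow> in_L1_loc f \<and>
     (\<forall>b\<in>Basis. \<forall>c\<in>Basis. \<exists>\<mu> \<nu>.
        finite_measure \<mu> \<and> finite_measure \<nu> \<and> sets \<mu> = sets borel \<and> sets \<nu> = sets borel \<and>
        (\<forall>\<phi>. test_fun \<phi> \<longrightarrow>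
           (LINT x|lebesgue. (f x \<bullet> c) * partial b \<phi> x) =
           - ((LINT x|\<mu>. \<phi> x) - (LINT x|\<nu>. \<phi> x))))"

text \<open>The support of (the almost everywhere class of) a function.\<close>

definition spt :: "('a::euclidean_space \<Rightarrow> 'b::euclidean_space) \<Rightarrow> 'a set" where
  "spt f = - \<Union>{U. open U \<and> (AE x in lebesgue. x \<in> U \<longrightarrow> f x = 0)}"


section \<open>The system\<close>

definition assumption_eta :: "(real^'n \<Rightarrow> real) \<Rightarrow> bool" where
  "assumption_eta \<eta> \<longleftrightarrow> C_k 3 \<eta> \<and> in_sobolev 3 in_L1 \<eta> \<and> in_sobolev 3 in_Linf \<eta>"

definition assumption_V :: "real \<Rightarrow> (real^'m^'n \<Rightarrow> real^'m^'n) \<Rightarrow> bool" where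
  "assumption_V L V \<longleftrightarrow> 0 \<le> L \<and> C_k 2 V \<and> V 0 = 0 \<and> W1inf_norm (total_deriv V) \<le> ereal L"

definition convol :: "('a::euclidean_space \<Rightarrow> real) \<Rightarrow> ('a \<Rightarrow> real) \<Rightarrow> 'a \<Rightarrow> real" where
  "convol f g x = (LINT \<xi>|lebesgue. f \<xi> * g (x - \<xi>))"

text \<open>The \<open>n \<times> m\<close> matrix \<open>\<nabla>\<rho> * \<eta>\<close>, for \<open>\<rho>\<close> at a fixed time.\<close>

definition grad_conv :: "(real^'n \<Rightarrow> real^'m) \<Rightarrow> (real^'n \<Rightarrow> real) \<Rightarrow> real^'n \<Rightarrow> real^'m^'n" where
  "grad_conv \<rho> \<eta> x = (\<chi> j i. partial (axis j 1) (convol (\<lambda>\<xi>. \<rho> \<xi> $ i) \<eta>) x)"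

text \<open>\<open>X t t\<^sub>o x\<^sub>o\<close> is the position at time \<open>t\<close> of the solution of \<open>x' = v t x\<close> on \<open>I\<close> that is
  at \<open>x\<^sub>o\<close> at time \<open>t\<^sub>o\<close>.\<close>

definition characteristics ::
  "real set \<Rightarrow> (real \<Rightarrow> real^'n \<Rightarrow> real^'n) \<Rightarrow> (real \<Rightarrow> real \<Rightarrow> real^'n \<Rightarrow> real^'n) \<Rightarrow> bool" where
  "characteristics I v X \<longleftrightarrow>
     (\<forall>to\<in>I. \<forall>xo. X to to xo = xo \<and>
        (\<forall>t\<in>I. ((\<lambda>s. X s to xo) has_vector_derivative v t (X t to xo)) (at t within I)))"

text \<open>Lagrangian solution on \<open>I\<close> of \<open>\<partial>\<^sub>t u + \<nabla> \<cdot> (u v) = 0\<close> with datum \<open>uo\<close> at time \<open>0\<close>.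
  The interval integral is oriented, so that times \<open>t < 0\<close> are covered.\<close>

definition lagrangian_solution ::
  "real set \<Rightarrow> (real \<Rightarrow> real^'n \<Rightarrow> real^'n) \<Rightarrow> (real^'n \<Rightarrow> real) \<Rightarrow> (real \<Rightarrow> real^'n \<Rightarrow> real) \<Rightarrow> bool" where
  "lagrangian_solution I v uo u \<longleftrightarrow>
     (\<exists>X. characteristics I v X \<and>
        (\<forall>t\<in>I. AE x in lebesgue.
           u t x = uo (X 0 t x) *
             exp (- (LBINT \<tau>=ereal 0..ereal t. divergence (v \<tau>) (X \<tau> t x)))))"

definition continuous_L1 :: "real set \<Rightarrow> (real \<Rightarrow> real^'n \<Rightarrow> real^'m) \<Rightarrow> bool" where
  "continuous_L1 I \<rho> \<longleftrightarrow> (\<forall>t\<in>I. in_L1 (\<rho> t)) \<and>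
     (\<forall>t\<in>I. ((\<lambda>s. L1_norm (\<lambda>x. \<rho> s x - \<rho> t x)) \<longlongrightarrow> 0) (at t within I))"

definition system_solution ::
  "real set \<Rightarrow> (real^'n \<Rightarrow> real) \<Rightarrow> (real^'m^'n \<Rightarrow> real^'m^'n) \<Rightarrow> (real^'n \<Rightarrow> real^'m) \<Rightarrow>
   (real \<Rightarrow> real^'n \<Rightarrow> real^'m) \<Rightarrow> bool" where
  "system_solution I \<eta> V \<rho>o \<rho> \<longleftrightarrow>
     is_interval I \<and> (\<exists>a\<in>I. \<exists>b\<in>I. a < b) \<and> 0 \<in> I \<and> continuous_L1 I \<rho> \<and>
     (\<forall>i. lagrangian_solution I (\<lambda>t x. column i (V (grad_conv (\<rho> t) \<eta> x)))
            (\<lambda>x. \<rho>o x $ i) (\<lambda>t x. \<rho> t x $ i))"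

end

theory Submission
  imports Defs
begin

text \<open>
The value of \<open>\<rho>\<^sub>i(t)\<close> at \<open>x\<close> is the value of the datum at the foot of the characteristic of the
velocity \<open>v\<^sub>i\<close> through \<open>(t, x)\<close>, times a positive factor. The support therefore spreads at most with
the speed \<open>sup \<bar>v\<^sub>i\<bar>\<close>, and everything rests on the bound of this speed by \<open>W\<close> at all times.

Since \<open>V 0 = 0\<close> and the Euclidean norm of \<open>DV\<close> is at most \<open>L\<close>, the velocity is at most \<open>L\<close> times the
Euclidean norm of the matrix \<open>\<nabla>\<rho> * \<eta>\<close> (\<open>assumption_V_Lipschitz\<close>). Its \<open>i\<close>-th column is bounded by
\<open>\<parallel>\<nabla>\<eta>\<parallel>\<^sub>\<infinity> \<parallel>\<rho>\<^sub>i(t)\<parallel>\<^sub>1\<close> (\<open>norm_column_grad_conv_le\<close>). The equation for each component is conservative,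
so that \<open>\<parallel>\<rho>\<^sub>i(t)\<parallel>\<^sub>1\<close> does not exceed its value for the datum (\<open>component_L1_norm_le\<close>), and the Euclidean
norm of the vector of these values is at most the \<open>L\<^sup>1\<close> norm of the vector-valued datum
(\<open>L2_set_component_L1_norms_le\<close>). The product of these bounds is \<open>W\<close> (\<open>norm_velocity_le\<close>).

The main work is the bound of \<open>\<parallel>\<rho>\<^sub>i(t)\<parallel>\<^sub>1\<close>. A Lagrangian solution is only given by its formula, and the
usual argument changes variables by the flow, whose Jacobian is the exponential factor of the
formula. The proof below does not differentiate the flow. For a Lipschitz datum with bounded support,
one short time step is compared with the explicit Euler step \<open>x \<mapsto> x - h v(s, x)\<close>. This map is injective
and has an explicit derivative, so that the change of variables formula applies to it; its
Jacobian is \<open>1 - h div v + o(h)\<close>, which is also the expansion of the exponential factor. Thus the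
mass grows by at most \<open>o(h)\<close> in a step (\<open>transported_one_step\<close>), and adding up the steps the mass
does not increase (\<open>integral_transported_le\<close>), in either direction of time. Approximation of open
sets by Lipschitz functions and outer regularity of Lebesgue measure extend this to integrable data
and show that flows pull back null sets to null sets (\<open>pushforward_le\<close>, \<open>AE_compose_X0\<close>).

For the comparison with Euler steps to be uniform, \<open>v\<close> and its divergence have to be bounded and
Lipschitz in space. This follows from the boundedness of the derivatives of \<open>\<eta>\<close> up to the third order,
which is extracted from the Sobolev assumption by integration by parts
(\<open>sobolev_Linf_imp_C_k_bounded\<close>), and from the rule for derivatives of a convolution
(\<open>partial_convol\<close>).
\<close>

section \<open>Functions with continuous partial derivatives\<close>

lemma partial_has_vector_derivative:
  assumes "\<And>x. partial_diff b f x"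
  shows "((\<lambda>s. f (y + s *\<^sub>R b)) has_vector_derivative partial b f (y + s *\<^sub>R b)) (at s)"
proof -
  have "((\<lambda>h. f ((y + s *\<^sub>R b) + h *\<^sub>R b)) has_vector_derivative partial b f (y + s *\<^sub>R b)) (at 0)"
    using assms[of "y + s *\<^sub>R b"]
    unfolding partial_diff_def partial_def by (simp add: vector_derivative_works)
  then have "((\<lambda>h. f ((y + s *\<^sub>R b) + h *\<^sub>R b)) has_vector_derivative partial b f (y + s *\<^sub>R b)) (at (s + (- s)))"
    by simp
  moreover have "((\<lambda>\<sigma>. \<sigma> + (- s)) has_vector_derivative 1) (at s)"
    by (auto intro!: derivative_eq_intros)
  ultimately have "(((\<lambda>h. f ((y + s *\<^sub>R b) + h *\<^sub>R b)) \<circ> (\<lambda>\<sigma>. \<sigma> + (- s))) has_vector_derivative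
      1 *\<^sub>R partial b f (y + s *\<^sub>R b)) (at s)"
    by (intro vector_diff_chain_at) auto
  then show ?thesis
    by (simp add: o_def algebra_simps)
qed

lemma has_derivative_imp_partial:
  assumes "(f has_derivative D) (at x)"
  shows "partial_diff b f x" "partial b f x = D b"
proof -
  have "((\<lambda>s. f (x + s *\<^sub>R b)) has_derivative (\<lambda>s. D (s *\<^sub>R b))) (at 0)"
    by (rule has_derivative_compose[of "\<lambda>s. x + s *\<^sub>R b" _ "0::real" UNIV f D])
      (auto intro!: derivative_eq_intros simp: assms)
  then have "((\<lambda>s. f (x + s *\<^sub>R b)) has_vector_derivative D b) (at 0)"
    using assms by (simp add: has_vector_derivative_def linear_simps(5) has_derivative_bounded_linear)
  then show "partial_diff b f x" "partial b f x = D b"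
    unfolding partial_diff_def partial_def
    by (auto intro: vector_derivative_at differentiableI_vector)
qed

lemma C_k_SucD: "C_k (Suc k) f \<Longrightarrow> C_k k f"
  by (induction k arbitrary: f) auto

lemma C_k_continuous: "C_k k f \<Longrightarrow> continuous_on UNIV f"
  by (cases k) auto

lemma C_k_mono: "C_k l f \<Longrightarrow> k \<le> l \<Longrightarrow> C_k k f"
  by (induction l) (auto simp del: C_k.simps simp: le_Suc_eq intro: C_k_SucD)

lemma sum_inner_Basis_norm_le:
  fixes h :: "'a::euclidean_space"
  assumes "B \<subseteq> Basis"
  shows "norm (\<Sum>b\<in>B. (h \<bullet> b) *\<^sub>R b) \<le> real (card B) * norm h"
proof -
  have "norm (\<Sum>b\<in>B. (h \<bullet> b) *\<^sub>R b) \<le> (\<Sum>b\<in>B. norm ((h \<bullet> b) *\<^sub>R b))"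
    by (rule norm_sum)
  also have "\<dots> \<le> (\<Sum>b\<in>B. norm h)"
    using assms by (intro sum_mono) (auto simp: Basis_le_norm)
  finally show ?thesis by simp
qed

text \<open>Change the coordinates of the argument one at a time. Each change is controlled by the mean
  value inequality for one partial derivative, which stays close to its value at \<open>x\<close> by
  continuity; the errors add up over the coordinates.\<close>

lemma has_derivative_of_continuous_partials:
  fixes f :: "'a::euclidean_space \<Rightarrow> 'b::real_normed_vector"
  assumes diff: "\<And>b x. b \<in> Basis \<Longrightarrow> partial_diff b f x"
    and cont: "\<And>b. b \<in> Basis \<Longrightarrow> continuous_on UNIV (partial b f)"
  shows "(f has_derivative (\<lambda>h. \<Sum>b\<in>Basis. (h \<bullet> b) *\<^sub>R partial b f x)) (at x)"
proof -
  define c where "c = real DIM('a)"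
  have c: "c \<ge> 1" using DIM_positive[where 'a='a] unfolding c_def by linarith
  let ?err = "\<lambda>B h. norm (f (x + (\<Sum>b\<in>B. (h \<bullet> b) *\<^sub>R b)) - f x - (\<Sum>b\<in>B. (h \<bullet> b) *\<^sub>R partial b f x))"
  have main: "\<exists>\<delta>>0. \<forall>h. norm h < \<delta> \<longrightarrow>
     ?err B h
       \<le> real (card B) * e * norm h" if "B \<subseteq> Basis" "e > 0" for B e
  proof -
    have "finite B" using that(1) finite_Basis by (rule finite_subset)
    then show ?thesis using that(1)
    proof induction
      case empty
      show ?case by (intro exI[of _ 1]) auto
    next
      case (insert b B)
      then obtain \<delta> where \<delta>: "\<delta> > 0" and IH: "\<And>h. norm h < \<delta> \<Longrightarrow>
          ?err B h
            \<le> real (card B) * e * norm h"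
        by auto
      have b: "b \<in> Basis" using insert by auto
      have "isCont (partial b f) x"
        using cont[OF b] by (simp add: continuous_on_eq_continuous_at)
      then obtain \<delta>' where \<delta>': "\<delta>' > 0" and
        close: "\<And>y. dist y x < \<delta>' \<Longrightarrow> dist (partial b f y) (partial b f x) < e / 3"
        using \<open>e > 0\<close> unfolding continuous_at_eps_delta by (metis divide_pos_pos zero_less_numeral)
      show ?case
      \<comment> \<open>The intermediate point lies within \<open>c * norm h\<close> of \<open>x\<close>, and the move along
        \<open>b\<close> adds at most \<open>norm h\<close>, which is not larger.\<close>
      proof (intro exI[of _ "min \<delta> (\<delta>' / (2 * c))"] conjI allI impI)
        show "0 < min \<delta> (\<delta>' / (2 * c))" using \<delta> \<delta>' c by auto
        fix h :: 'a assume h: "norm h < min \<delta> (\<delta>' / (2 * c))"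
        define y where "y = x + (\<Sum>b\<in>B. (h \<bullet> b) *\<^sub>R b)"
        have cardB: "real (card B) \<le> c"
          using insert.prems unfolding c_def by (simp add: card_mono)
        have hc: "2 * (c * norm h) < \<delta>'" using h c by (simp add: field_simps)
        have ny: "norm (y - x) \<le> c * norm h"
          using sum_inner_Basis_norm_le[of B h] insert.prems cardB unfolding y_def
          using mult_right_mono[OF cardB norm_ge_zero[of h]] by simp
        have hb: "\<bar>h \<bullet> b\<bar> \<le> norm h" using b by (rule Basis_le_norm)
        have hb2: "norm h \<le> c * norm h"
          using mult_right_mono[OF c norm_ge_zero[of h]] by simp
        have seg: "dist (y + s *\<^sub>R b) x < \<delta>'" if "s \<in> closed_segment 0 (h \<bullet> b)" for s
        proof -
          have "\<bar>s\<bar> \<le> \<bar>h \<bullet> b\<bar>"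
            using that by (auto simp: closed_segment_eq_real_ivl split: if_splits)
          then have "norm (s *\<^sub>R b) \<le> norm h" using hb b by simp
          moreover have "dist (y + s *\<^sub>R b) x \<le> norm (y - x) + norm (s *\<^sub>R b)"
            using norm_triangle_ineq[of "y - x" "s *\<^sub>R b"] unfolding dist_norm by (simp add: algebra_simps)
          ultimately show ?thesis using ny hb2 hc by linarith
        qed
        have "norm (f (y + (h \<bullet> b) *\<^sub>R b) - f (y + 0 *\<^sub>R b) - (h \<bullet> b - 0) *\<^sub>R partial b f (y + 0 *\<^sub>R b))
            \<le> norm (h \<bullet> b - 0) * (2 * e / 3)"
        proof (rule vector_differentiable_bound_linearization[where S = "closed_segment 0 (h \<bullet> b)" and a = 0
              and b = "h \<bullet> b" and ?x0.0 = 0 and f = "\<lambda>s. f (y + s *\<^sub>R b)"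
              and f' = "\<lambda>s. partial b f (y + s *\<^sub>R b)"])
          fix s assume s: "s \<in> closed_segment 0 (h \<bullet> b)"
          show "((\<lambda>s. f (y + s *\<^sub>R b)) has_vector_derivative partial b f (y + s *\<^sub>R b))
              (at s within closed_segment 0 (h \<bullet> b))"
            by (rule has_vector_derivative_at_within[OF partial_has_vector_derivative[OF diff[OF b]]])
          show "norm (partial b f (y + s *\<^sub>R b) - partial b f (y + 0 *\<^sub>R b)) \<le> 2 * e / 3"
            using close[OF seg[OF s]] close[OF seg[of 0]]
              dist_triangle2[of "partial b f (y + s *\<^sub>R b)" "partial b f (y + 0 *\<^sub>R b)" "partial b f x"]
            unfolding dist_norm[symmetric] by simp
        qed auto
        then have "norm (f (y + (h \<bullet> b) *\<^sub>R b) - f y - (h \<bullet> b) *\<^sub>R partial b f y) \<le> \<bar>h \<bullet> b\<bar> * (2 * e / 3)"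
          by simp
        moreover have "norm ((h \<bullet> b) *\<^sub>R partial b f y - (h \<bullet> b) *\<^sub>R partial b f x) \<le> \<bar>h \<bullet> b\<bar> * (e / 3)"
        proof -
          have "norm (partial b f y - partial b f x) \<le> e / 3"
            using close[OF seg[of 0]] by (simp add: dist_norm)
          then show ?thesis
            unfolding scaleR_diff_right[symmetric] norm_scaleR by (intro mult_left_mono) auto
        qed
        ultimately have "norm (f (y + (h \<bullet> b) *\<^sub>R b) - f y - (h \<bullet> b) *\<^sub>R partial b f x) \<le> \<bar>h \<bullet> b\<bar> * (2 * e / 3) + \<bar>h \<bullet> b\<bar> * (e / 3)"
          using norm_triangle_mono by fastforce
        also have "\<dots> = \<bar>h \<bullet> b\<bar> * e" by (simp add: field_simps)
        also have "\<dots> \<le> e * norm h" using hb \<open>e > 0\<close> by (simp add: mult_left_mono mult.commute)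
        finally have step: "norm (f (y + (h \<bullet> b) *\<^sub>R b) - f y - (h \<bullet> b) *\<^sub>R partial b f x) \<le> e * norm h" .
        have old: "norm (f y - f x - (\<Sum>b\<in>B. (h \<bullet> b) *\<^sub>R partial b f x)) \<le> real (card B) * e * norm h"
          unfolding y_def using h by (intro IH) simp
        have eq1: "x + (\<Sum>b\<in>insert b B. (h \<bullet> b) *\<^sub>R b) = y + (h \<bullet> b) *\<^sub>R b"
          using insert.hyps by (simp add: y_def)
        have eq2: "real (card (insert b B)) * e * norm h = e * norm h + real (card B) * e * norm h"
          using insert.hyps by (simp add: algebra_simps)
        show "norm (f (x + (\<Sum>b\<in>insert b B. (h \<bullet> b) *\<^sub>R b)) - f x
             - (\<Sum>b\<in>insert b B. (h \<bullet> b) *\<^sub>R partial b f x)) \<le> real (card (insert b B)) * e * norm h"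
          unfolding eq1 eq2 using norm_triangle_mono[OF step old] insert.hyps by (simp add: algebra_simps)
      qed
    qed
  qed
  have lin: "bounded_linear (\<lambda>h. \<Sum>b\<in>Basis. (h \<bullet> b) *\<^sub>R partial b f x)"
    by (intro bounded_linear_sum bounded_linear_scaleR_const bounded_linear_inner_left)
  show ?thesis
    unfolding has_derivative_at_alt
  proof (intro conjI allI impI lin)
    fix e :: real assume "e > 0"
    obtain \<delta> where "\<delta> > 0" and \<delta>: "\<And>h. norm h < \<delta> \<Longrightarrow>
       ?err Basis h
         \<le> c * (e / c) * norm h"
      using main[of Basis "e / c"] \<open>e > 0\<close> c unfolding c_def by auto
    have "norm (f y - f x - (\<Sum>b\<in>Basis. ((y - x) \<bullet> b) *\<^sub>R partial b f x)) \<le> e * norm (y - x)"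
      if "norm (y - x) < \<delta>" for y
      using \<delta>[OF that] c by (simp add: euclidean_representation)
    then show "\<exists>d>0. \<forall>y. norm (y - x) < d \<longrightarrow>
        norm (f y - f x - (\<Sum>b\<in>Basis. ((y - x) \<bullet> b) *\<^sub>R partial b f x)) \<le> e * norm (y - x)"
      using \<open>\<delta> > 0\<close> by blast
  qed
qed

lemma C_k_has_derivative:
  fixes f :: "'a::euclidean_space \<Rightarrow> 'b::real_normed_vector"
  assumes "C_k (Suc k) f"
  shows "(f has_derivative (\<lambda>h. \<Sum>b\<in>Basis. (h \<bullet> b) *\<^sub>R partial b f x)) (at x)"
  using assms by (intro has_derivative_of_continuous_partials) (auto intro: C_k_continuous)

text \<open>The set where \<open>f\<close> exceeds \<open>c\<close> is open and null, hence empty.\<close>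

lemma continuous_AE_le_imp_le:
  fixes f :: "'a::euclidean_space \<Rightarrow> real"
  assumes cont: "continuous_on UNIV f" and AE: "AE x in lebesgue. f x \<le> c"
  shows "f x \<le> c"
proof (rule ccontr)
  assume "\<not> f x \<le> c"
  then have "x \<in> {x. c < f x}" by simp
  then have ne: "{x. c < f x} \<noteq> {}" by blast
  have op: "open {x. c < f x}"
    using cont by (intro open_Collect_less) auto
  have "{x. c < f x} \<in> null_sets lebesgue"
  proof -
    have "{x \<in> space lebesgue. \<not> f x \<le> c} \<in> sets lebesgue"
      using op by (simp add: not_le)
    then show ?thesis using AE by (simp add: AE_iff_null not_le)
  qed
  then have "negligible {x. c < f x}" by (simp add: negligible_iff_null_sets)
  then show False using open_not_negligible[OF op ne] by simp
qed

lemma partials_bounded_imp_Lipschitz: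
  fixes f :: "'a::euclidean_space \<Rightarrow> 'b::real_normed_vector"
  assumes f: "C_k (Suc k) f" and bd: "\<And>b x. b \<in> Basis \<Longrightarrow> norm (partial b f x) \<le> C"
  shows "norm (f x - f y) \<le> real DIM('a) * C * norm (x - y)"
proof (rule differentiable_bound[where S = UNIV and f' = "\<lambda>x h. \<Sum>b\<in>Basis. (h \<bullet> b) *\<^sub>R partial b f x"])
  fix x
  show "(f has_derivative (\<lambda>h. \<Sum>b\<in>Basis. (h \<bullet> b) *\<^sub>R partial b f x)) (at x within UNIV)"
    using C_k_has_derivative[OF f] by simp
  show "onorm (\<lambda>h. \<Sum>b\<in>Basis. (h \<bullet> b) *\<^sub>R partial b f x) \<le> real DIM('a) * C"
  proof (rule onorm_le)
    fix h :: 'a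
    have "norm (\<Sum>b\<in>Basis. (h \<bullet> b) *\<^sub>R partial b f x) \<le> (\<Sum>b\<in>(Basis::'a set). norm h * C)"
    proof (rule sum_norm_le)
      fix b :: 'a assume "b \<in> Basis"
      then show "norm ((h \<bullet> b) *\<^sub>R partial b f x) \<le> norm h * C"
        using Basis_le_norm[of b h] bd[of b x] by (simp add: mult_mono)
    qed
    then show "norm (\<Sum>b\<in>Basis. (h \<bullet> b) *\<^sub>R partial b f x) \<le> real DIM('a) * C * norm h"
      by (simp add: mult_ac)
  qed
qed auto

section \<open>Smooth bump functions\<close>

text \<open>For \<open>p = 1\<close> this is the flat function \<open>exp (- 1 / s)\<close>. The polynomial is a parameter because
  the family is then closed under differentiation.\<close>

definition exp_tail :: "real poly \<Rightarrow> real \<Rightarrow> real" where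
  "exp_tail p s = (if s \<le> 0 then 0 else poly p (1 / s) * exp (- (1 / s)))"

lemma poly_times_exp_minus_tendsto: "((\<lambda>y::real. poly p y * exp (- y)) \<longlongrightarrow> 0) at_top"
proof -
  have "((\<lambda>y::real. \<Sum>i\<le>degree p. coeff p i * (y ^ i * exp (- y))) \<longlongrightarrow> (\<Sum>i\<le>degree p. coeff p i * 0)) at_top"
  proof (intro tendsto_sum tendsto_mult tendsto_const)
    fix i
    show "((\<lambda>y::real. y ^ i * exp (- y)) \<longlongrightarrow> 0) at_top"
      using tendsto_power_div_exp_0[of i] by (simp add: exp_minus divide_inverse)
  qed
  then show ?thesis
    by (simp add: poly_altdef sum_distrib_right mult.assoc)
qed

lemma exp_tail_at_right_0: "((\<lambda>s. exp_tail p s / s) \<longlongrightarrow> 0) (at_right 0)"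
proof -
  have "((\<lambda>s::real. poly (pCons 0 p) (inverse s) * exp (- inverse s)) \<longlongrightarrow> 0) (at_right 0)"
    by (rule filterlim_compose[OF poly_times_exp_minus_tendsto filterlim_inverse_at_top_right])
  moreover have "\<forall>\<^sub>F s in at_right 0. poly (pCons 0 p) (inverse s) * exp (- inverse s) = exp_tail p s / s"
    unfolding eventually_at_right_field by (intro exI[of _ 1]) (auto simp: exp_tail_def divide_inverse)
  ultimately show ?thesis by (rule Lim_transform_eventually)
qed

text \<open>Away from \<open>0\<close> this is the chain rule: the factor \<open>1 / s\<^sup>2\<close> produces the polynomial
  \<open>[:0, 0, 1:]\<close>. At \<open>0\<close> the difference quotient is \<open>exp_tail p s / s\<close>, which the exponential
  decay sends to \<open>0\<close>.\<close>

lemma exp_tail_has_derivative: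
  "(exp_tail p has_real_derivative exp_tail ([:0, 0, 1:] * (p - pderiv p)) s) (at s)"
proof -
  consider "s < 0" | "s = 0" | "s > 0" by linarith
  then show ?thesis
  proof cases
    case 1
    have "((\<lambda>_. 0) has_real_derivative 0) (at s)" by simp
    then have "(exp_tail p has_real_derivative 0) (at s)"
      by (rule DERIV_cong_ev[THEN iffD1, rotated -1, OF _ refl _ refl])
        (use 1 eventually_nhds_in_open[of "{..<0}" s] in \<open>auto simp: exp_tail_def elim!: eventually_mono\<close>)
    then show ?thesis using 1 by (simp add: exp_tail_def)
  next
    case 2
    have "((\<lambda>s. exp_tail p s / s) \<longlongrightarrow> 0) (at_left 0)"
      by (rule Lim_transform_eventually[OF tendsto_const])
        (auto simp: eventually_at_left_field exp_tail_def intro!: exI[of _ "-1"])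
    then have "((\<lambda>s. exp_tail p s / s) \<longlongrightarrow> 0) (at 0)"
      using exp_tail_at_right_0 by (simp add: filterlim_split_at)
    then show ?thesis using 2
      by (simp add: has_field_derivative_iff exp_tail_def)
  next
    case 3
    have "((\<lambda>s. poly p (1 / s) * exp (- (1 / s))) has_real_derivative
        poly ([:0, 0, 1:] * (p - pderiv p)) (1 / s) * exp (- (1 / s))) (at s)"
      using 3 by (auto intro!: derivative_eq_intros simp: field_simps power2_eq_square)
    then have "(exp_tail p has_real_derivative poly ([:0, 0, 1:] * (p - pderiv p)) (1 / s) * exp (- (1 / s))) (at s)"
      by (rule DERIV_cong_ev[THEN iffD1, rotated -1, OF _ refl _ refl])
        (use 3 eventually_nhds_in_open[of "{0<..}" s] in \<open>auto simp: exp_tail_def elim!: eventually_mono\<close>)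
    then show ?thesis using 3 by (simp add: exp_tail_def)
  qed
qed

lemma C_k_const: "C_k k (\<lambda>_::'a::euclidean_space. c)"
proof (induction k arbitrary: c)
  case (Suc k)
  have "partial b (\<lambda>_::'a. c) = (\<lambda>_. 0)" "partial_diff b (\<lambda>_. c) x" for b x
    using has_derivative_imp_partial[of "\<lambda>_::'a. c" "\<lambda>_. 0"] by (auto intro!: ext)
  then show ?case using Suc by simp
qed simp

lemma partial_add:
  assumes "partial_diff b f x" "partial_diff b g x"
  shows "partial_diff b (\<lambda>x. f x + g x) x" "partial b (\<lambda>x. f x + g x) x = partial b f x + partial b g x"
proof -
  have "((\<lambda>s. f (x + s *\<^sub>R b) + g (x + s *\<^sub>R b)) has_vector_derivative partial b f x + partial b g x) (at 0)"
    using assms unfolding partial_diff_def partial_def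
    by (intro has_vector_derivative_add) (auto simp: vector_derivative_works)
  then show "partial_diff b (\<lambda>x. f x + g x) x" "partial b (\<lambda>x. f x + g x) x = partial b f x + partial b g x"
    unfolding partial_diff_def by (auto simp: partial_def[of b "\<lambda>x. f x + g x"] intro: vector_derivative_at differentiableI_vector)
qed

lemma partial_mult:
  fixes f g :: "'a::real_normed_vector \<Rightarrow> real"
  assumes "partial_diff b f x" "partial_diff b g x"
  shows "partial_diff b (\<lambda>x. f x * g x) x"
    "partial b (\<lambda>x. f x * g x) x = f x * partial b g x + partial b f x * g x"
proof -
  have "((\<lambda>s. f (x + s *\<^sub>R b) * g (x + s *\<^sub>R b)) has_vector_derivative
      f (x + 0 *\<^sub>R b) * partial b g x + partial b f x * g (x + 0 *\<^sub>R b)) (at 0)"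
    using assms unfolding partial_diff_def partial_def
    by (intro has_vector_derivative_mult) (auto simp: vector_derivative_works)
  then have "((\<lambda>s. f (x + s *\<^sub>R b) * g (x + s *\<^sub>R b)) has_vector_derivative
      f x * partial b g x + partial b f x * g x) (at 0)" by simp
  then show "partial_diff b (\<lambda>x. f x * g x) x"
    "partial b (\<lambda>x. f x * g x) x = f x * partial b g x + partial b f x * g x"
    unfolding partial_diff_def by (auto simp: partial_def[of b "\<lambda>x. f x * g x"] intro: vector_derivative_at differentiableI_vector)
qed

lemma C_k_add: "C_k k f \<Longrightarrow> C_k k g \<Longrightarrow> C_k k (\<lambda>x. f x + g x)"
proof (induction k arbitrary: f g)
  case (Suc k)
  have "partial b (\<lambda>x. f x + g x) = (\<lambda>x. partial b f x + partial b g x)" if "b \<in> Basis" for b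
    using Suc.prems that by (auto simp: partial_add)
  then show ?case
    using Suc.prems by (auto simp: partial_add intro!: continuous_on_add Suc.IH)
qed (auto intro: continuous_on_add)

lemma C_k_mult:
  fixes f g :: "'a::euclidean_space \<Rightarrow> real"
  shows "C_k k f \<Longrightarrow> C_k k g \<Longrightarrow> C_k k (\<lambda>x. f x * g x)"
proof (induction k arbitrary: f g)
  case (Suc k)
  have "partial b (\<lambda>x. f x * g x) = (\<lambda>x. f x * partial b g x + partial b f x * g x)" if "b \<in> Basis" for b
    using Suc.prems that by (auto simp: partial_mult)
  then show ?case
    using Suc.prems C_k_SucD[OF Suc.prems(1)] C_k_SucD[OF Suc.prems(2)]
    by (auto simp: partial_mult intro!: continuous_on_mult C_k_add Suc.IH)
qed (auto intro: continuous_on_mult)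

lemma C_k_prod:
  fixes f :: "'i \<Rightarrow> 'a::euclidean_space \<Rightarrow> real"
  shows "(\<And>i. i \<in> I \<Longrightarrow> C_k k (f i)) \<Longrightarrow> C_k k (\<lambda>x. \<Prod>i\<in>I. f i x)"
  by (induction I rule: infinite_finite_induct) (auto intro: C_k_const C_k_mult)

lemma C_k_exp_tail: "C_k k (\<lambda>x::'a::euclidean_space. exp_tail p (c + x \<bullet> a))"
proof (induction k arbitrary: p)
  case (Suc k)
  define q where "q = [:0, 0, 1:] * (p - pderiv p)"
  have der: "((\<lambda>x. exp_tail p (c + x \<bullet> a)) has_derivative (\<lambda>h. (h \<bullet> a) * exp_tail q (c + x \<bullet> a))) (at x)" for x
  proof -
    have "((\<lambda>x. c + x \<bullet> a) has_derivative (\<lambda>h. h \<bullet> a)) (at x)"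
      by (auto intro!: derivative_eq_intros)
    from has_derivative_compose[OF this exp_tail_has_derivative[unfolded has_field_derivative_def]]
    show ?thesis by (simp add: q_def mult.commute)
  qed
  have "continuous_on UNIV (\<lambda>x. exp_tail p (c + x \<bullet> a))"
    by (rule has_derivative_continuous_on) (use der in \<open>auto intro: has_derivative_at_withinI\<close>)
  moreover have "partial b (\<lambda>x. exp_tail p (c + x \<bullet> a)) = (\<lambda>x. (b \<bullet> a) * exp_tail q (c + x \<bullet> a))" for b
    using has_derivative_imp_partial(2)[OF der] by auto
  ultimately show ?case
    using has_derivative_imp_partial(1)[OF der] by (auto intro: C_k_mult C_k_const Suc.IH)
next
  case 0
  have "continuous_on UNIV (exp_tail p)"
    by (rule DERIV_continuous_on) (rule DERIV_subset[OF exp_tail_has_derivative subset_UNIV])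
  then show ?case
    by (auto intro!: continuous_intros continuous_on_compose2[of UNIV "exp_tail p"])
qed

text \<open>A product over the coordinates of flat functions, two for each coordinate, is positive exactly
  on an open cube. With half side \<open>\<delta> / DIM('a)\<close> the cube lies in the ball of radius \<open>\<delta>\<close>.\<close>

lemma exists_bump:
  fixes x\<^sub>0 :: "'a::euclidean_space"
  assumes "\<delta> > 0"
  obtains \<phi> where "test_fun \<phi>" "\<And>x. \<phi> x \<ge> 0" "\<phi> x\<^sub>0 > 0" "\<And>x. \<phi> x \<noteq> 0 \<Longrightarrow> dist x x\<^sub>0 < \<delta>"
proof -
  define d where "d = \<delta> / (real DIM('a))"
  have d: "d > 0" using assms by (simp add: d_def)
  define \<phi> where "\<phi> = (\<lambda>x::'a. \<Prod>b\<in>Basis. exp_tail 1 ((d - x\<^sub>0 \<bullet> b) + x \<bullet> b) * exp_tail 1 ((d + x\<^sub>0 \<bullet> b) + x \<bullet> (- b)))"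
  have nn: "exp_tail 1 s \<ge> 0" and pos: "exp_tail 1 s > 0 \<longleftrightarrow> s > 0" for s
    by (auto simp: exp_tail_def)
  have C: "C_k k \<phi>" for k
    unfolding \<phi>_def by (intro C_k_prod C_k_mult C_k_exp_tail)
  have ball: "dist x x\<^sub>0 < \<delta>" if "\<phi> x \<noteq> 0" for x
  proof -
    have "\<bar>(x - x\<^sub>0) \<bullet> b\<bar> < d" if "b \<in> Basis" for b
    proof -
      have "exp_tail 1 ((d - x\<^sub>0 \<bullet> b) + x \<bullet> b) \<noteq> 0" "exp_tail 1 ((d + x\<^sub>0 \<bullet> b) + x \<bullet> (- b)) \<noteq> 0"
        using \<open>\<phi> x \<noteq> 0\<close> that unfolding \<phi>_def by auto
      then show ?thesis
        by (auto simp: exp_tail_def inner_diff_left split: if_splits)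
    qed
    then have "(\<Sum>b\<in>Basis. \<bar>(x - x\<^sub>0) \<bullet> b\<bar>) < (\<Sum>b\<in>(Basis::'a set). d)"
      by (intro sum_strict_mono) auto
    then show ?thesis
      using norm_le_l1[of "x - x\<^sub>0"] by (simp add: d_def dist_norm)
  qed
  show thesis
  proof
    have "closure {x. \<phi> x \<noteq> 0} \<subseteq> cball x\<^sub>0 \<delta>"
      by (intro closure_minimal) (auto simp: dist_commute dest!: ball)
    then have "compact (closure {x. \<phi> x \<noteq> 0})"
      by (meson closed_closure compact_cball compact_closure bounded_cball bounded_subset closure_closure compact_eq_bounded_closed)
    then show "test_fun \<phi>" using C by (simp add: test_fun_def)
    show "\<phi> x \<ge> 0" for x unfolding \<phi>_def by (intro prod_nonneg mult_nonneg_nonneg ballI nn)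
    show "\<phi> x\<^sub>0 > 0" unfolding \<phi>_def using d by (intro prod_pos mult_pos_pos ballI) (auto simp: pos)
  qed (use ball in auto)
qed

text \<open>The radius is a parameter because it has to be followed along a flow.\<close>

definition vanishes_outside :: "real \<Rightarrow> ('a::real_normed_vector \<Rightarrow> 'b::zero) \<Rightarrow> bool" where
  "vanishes_outside R f \<longleftrightarrow> (\<forall>x. R < norm x \<longrightarrow> f x = 0)"

section \<open>Integration by parts and bounded weak derivatives\<close>

lemma Lipschitz_imp_continuous:
  fixes f :: "'a::real_normed_vector \<Rightarrow> 'b::real_normed_vector"
  assumes "\<And>x y. norm (f x - f y) \<le> C * norm (x - y)"
  shows "continuous_on UNIV f"
proof (rule lipschitz_on_continuous_on)
  have "norm (f x - f y) \<le> \<bar>C\<bar> * norm (x - y)" for x y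
    using assms[of x y] mult_right_mono[OF abs_ge_self[of C] norm_ge_zero[of "x - y"]] by linarith
  then show "\<bar>C\<bar>-lipschitz_on UNIV f" by (simp add: lipschitz_on_def dist_norm)
qed

lemma vanishes_outside_partial:
  assumes "vanishes_outside R f"
  shows "vanishes_outside R (partial b f)"
  unfolding vanishes_outside_def
proof (intro allI impI)
  fix x :: 'a assume x: "R < norm x"
  have "continuous_on UNIV (\<lambda>s::real. norm (x + s *\<^sub>R b))" by (intro continuous_intros)
  then have "open {s::real. R < norm (x + s *\<^sub>R b)}"
    by (intro open_Collect_less) (auto intro: continuous_intros)
  then have "\<forall>\<^sub>F s::real in nhds 0. R < norm (x + s *\<^sub>R b)"
    using x by (auto simp: eventually_nhds intro!: exI[of _ "{s. R < norm (x + s *\<^sub>R b)}"])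
  then have "\<forall>\<^sub>F s::real in nhds 0. f (x + s *\<^sub>R b) = 0"
    by eventually_elim (use assms in \<open>auto simp: vanishes_outside_def\<close>)
  then have ev: "\<forall>\<^sub>F s in at 0. (0::'b) = f (x + s *\<^sub>R b)" and f0: "f (x + 0 *\<^sub>R b) = 0"
    using eventually_nhds_x_imp_x[of "\<lambda>s. f (x + s *\<^sub>R b) = 0" "0::real"]
    by (auto simp: eventually_at_filter elim: eventually_mono)
  have "((\<lambda>s. f (x + s *\<^sub>R b)) has_derivative (\<lambda>_. 0)) (at (0::real))"
    by (rule has_derivative_transform_eventually[OF has_derivative_const ev]) (simp_all add: f0[simplified])
  then have "((\<lambda>s. f (x + s *\<^sub>R b)) has_vector_derivative 0) (at (0::real))"
    by (simp add: has_vector_derivative_def)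
  then show "partial b f x = 0"
    unfolding partial_def by (rule vector_derivative_at)
qed

lemma continuous_vanishes_imp_bounded:
  fixes f :: "'a::euclidean_space \<Rightarrow> real"
  assumes "continuous_on UNIV f" "vanishes_outside R f"
  obtains C where "C \<ge> 0" "\<And>x. \<bar>f x\<bar> \<le> C"
proof -
  have "bounded (f ` cball 0 R)"
    using assms(1) by (intro compact_imp_bounded compact_continuous_image) (auto intro: continuous_on_subset)
  then obtain C where C: "\<forall>y\<in>f ` cball 0 R. norm y \<le> C" by (auto simp: bounded_iff)
  show thesis
  proof
    show "\<bar>f x\<bar> \<le> max 0 C" for x
    proof (cases "norm x \<le> R")
      case True
      then have "\<bar>f x\<bar> \<le> C" using C by simp
      then show ?thesis by simp
    next
      case False
      then show ?thesis using assms(2) by (simp add: vanishes_outside_def)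
    qed
  qed simp
qed

lemma integrable_indicator_cball: "integrable lebesgue (\<lambda>x::'a::euclidean_space. indicator (cball a R) x * (C::real))"
  using lmeasurable_cball[of a R] unfolding lmeasurable_iff_integrable by simp

lemma bounded_vanishes_imp_integrable:
  fixes f :: "'a::euclidean_space \<Rightarrow> real"
  assumes "f \<in> borel_measurable lebesgue" "vanishes_outside R f" "\<And>x. \<bar>f x\<bar> \<le> C"
  shows "integrable lebesgue f"
proof (rule Bochner_Integration.integrable_bound)
  show "integrable lebesgue (\<lambda>x::'a. indicator (cball 0 R) x * C)"
    by (rule integrable_indicator_cball)
  show "AE x in lebesgue. norm (f x) \<le> norm (indicator (cball 0 R) x * C)"
  proof (intro AE_I2)
    fix x
    show "norm (f x) \<le> norm (indicator (cball 0 R) x * C)"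
      using assms(2) assms(3)[of x] unfolding vanishes_outside_def
      by (cases "norm x \<le> R") auto
  qed
qed fact

lemma continuous_imp_measurable_lebesgue:
  fixes f :: "'a::euclidean_space \<Rightarrow> 'b::euclidean_space"
  assumes "continuous_on UNIV f"
  shows "f \<in> borel_measurable lebesgue"
proof -
  have "f \<in> borel_measurable lborel" using borel_measurable_continuous_onI[OF assms] by simp
  then show ?thesis by (rule measurable_completion)
qed

lemma continuous_vanishes_imp_integrable:
  fixes f :: "'a::euclidean_space \<Rightarrow> real"
  assumes "continuous_on UNIV f" "vanishes_outside R f"
  shows "integrable lebesgue f"
proof -
  obtain C where "\<And>x. \<bar>f x\<bar> \<le> C" using continuous_vanishes_imp_bounded[OF assms] by blast
  then show ?thesis
    using assms by (intro bounded_vanishes_imp_integrable continuous_imp_measurable_lebesgue) auto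
qed

lemma lebesgue_integral_translation:
  fixes f :: "'a::euclidean_space \<Rightarrow> real"
  assumes "continuous_on UNIV f"
  shows "(LINT x|lebesgue. f (x + a)) = (LINT x|lebesgue. f x)"
proof -
  have f: "f \<in> borel_measurable borel" using assms by (rule borel_measurable_continuous_onI)
  have f': "(\<lambda>x. f (x + a)) \<in> borel_measurable borel"
    by (rule measurable_compose[OF _ f]) simp
  have "(LINT x|lborel. f (x + a)) = (LINT x|distr lborel borel ((+) a). f x)"
    using f by (subst integral_distr) (auto simp: add.commute)
  also have "\<dots> = (LINT x|lborel. f x)" by (simp add: lborel_distr_plus)
  finally show ?thesis using f f' by (simp add: integral_completion)
qed

lemma difference_quotient_tendsto:
  fixes f :: "'a::real_normed_vector \<Rightarrow> real"
  assumes diff: "\<And>x. partial_diff b f x" and S: "S \<longlonglongrightarrow> 0" "\<And>n. S n \<noteq> 0"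
  shows "(\<lambda>n. (f (x + S n *\<^sub>R b) - f x) / S n) \<longlonglongrightarrow> partial b f x"
proof -
  have "((\<lambda>s. f (x + s *\<^sub>R b)) has_real_derivative partial b f x) (at 0)"
    using partial_has_vector_derivative[OF diff, of x 0]
    by (simp add: has_real_derivative_iff_has_vector_derivative)
  then have "((\<lambda>s. (f (x + s *\<^sub>R b) - f x) / s) \<longlongrightarrow> partial b f x) (at 0)"
    by (simp add: has_field_derivative_iff)
  then show ?thesis
    unfolding tendsto_at_iff_sequentially using S by (auto simp: o_def)
qed

lemma partial_bound_imp_increment_le:
  fixes f :: "'a::real_normed_vector \<Rightarrow> real"
  assumes diff: "\<And>x. partial_diff b f x" and C: "\<And>x. \<bar>partial b f x\<bar> \<le> C"
  shows "\<bar>f (x + s *\<^sub>R b) - f x\<bar> \<le> C * \<bar>s\<bar>"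
proof -
  have "norm ((\<lambda>s. f (x + s *\<^sub>R b)) s - (\<lambda>s. f (x + s *\<^sub>R b)) 0) \<le> C * norm (s - 0)"
  proof (rule field_differentiable_bound[where S = UNIV and f' = "\<lambda>s. partial b f (x + s *\<^sub>R b)"])
    show "((\<lambda>s. f (x + s *\<^sub>R b)) has_real_derivative partial b f (x + s *\<^sub>R b)) (at s within UNIV)" for s
      using partial_has_vector_derivative[OF diff, of x s]
      by (simp add: has_real_derivative_iff_has_vector_derivative)
  qed (use C in auto)
  then show ?thesis by simp
qed

text \<open>The difference quotients of \<open>F\<close> along \<open>b\<close> have integral \<open>0\<close> because Lebesgue measure is
  invariant under translations. They converge to the partial derivative and are dominated by a
  constant on a ball.\<close>

lemma integral_partial_eq_0:
  fixes F :: "'a::euclidean_space \<Rightarrow> real"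
  assumes F: "C_k 1 F" and van: "vanishes_outside R F" and b: "b \<in> Basis"
  shows "(LINT x|lebesgue. partial b F x) = 0"
proof -
  have contF: "continuous_on UNIV F" and contd: "continuous_on UNIV (partial b F)"
    and diff: "\<And>x. partial_diff b F x" using F b by auto
  obtain C where C: "C \<ge> 0" "\<And>x. \<bar>partial b F x\<bar> \<le> C"
    using continuous_vanishes_imp_bounded[OF contd vanishes_outside_partial[OF van]] by blast
  define q where "q = (\<lambda>n x. (F (x + (1 / real (Suc n)) *\<^sub>R b) - F x) * real (Suc n))"
  have contq: "continuous_on UNIV (q n)" for n
    unfolding q_def by (intro continuous_intros continuous_on_compose2[OF contF]) auto
  have q0: "(LINT x|lebesgue. q n x) = 0" for n
  proof -
    define a where "a = (1 / real (Suc n)) *\<^sub>R b"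
    have contFa: "continuous_on UNIV (\<lambda>x. F (x + a))"
      by (intro continuous_intros continuous_on_compose2[OF contF]) auto
    have "vanishes_outside (R + norm a) (\<lambda>x. F (x + a))"
      unfolding vanishes_outside_def
    proof (intro allI impI)
      fix x :: 'a assume "R + norm a < norm x"
      then have "R < norm (x + a)" using norm_triangle_ineq4[of "x + a" a] by simp
      then show "F (x + a) = 0" using van by (simp add: vanishes_outside_def)
    qed
    then have "integrable lebesgue (\<lambda>x. F (x + a))" "integrable lebesgue F"
      using contFa contF van continuous_vanishes_imp_integrable by blast+
    then show ?thesis
      unfolding q_def a_def[symmetric]
      by (simp add: lebesgue_integral_translation[OF contF] Bochner_Integration.integral_diff)
  qed
  have "(\<lambda>n. LINT x|lebesgue. q n x) \<longlonglongrightarrow> (LINT x|lebesgue. partial b F x)"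
  proof (rule integral_dominated_convergence[where w = "\<lambda>x. indicator (cball 0 (R + 1)) x * C"])
    show "integrable lebesgue (\<lambda>x::'a. indicator (cball 0 (R + 1)) x * C)"
      by (rule integrable_indicator_cball)
    show "AE x in lebesgue. (\<lambda>n. q n x) \<longlonglongrightarrow> partial b F x"
    proof (intro AE_I2)
      fix x
      have "(\<lambda>n. 1 / real (Suc n)) \<longlonglongrightarrow> 0"
        using LIMSEQ_inverse_real_of_nat by (simp add: inverse_eq_divide)
      from difference_quotient_tendsto[OF diff this, of x]
      show "(\<lambda>n. q n x) \<longlonglongrightarrow> partial b F x"
        by (simp add: q_def)
    qed
    show "AE x in lebesgue. norm (q n x) \<le> indicator (cball 0 (R + 1)) x * C" for n
    proof (intro AE_I2)
      fix x
      define a where "a = 1 / real (Suc n)"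
      have a: "0 < a" "a \<le> 1" by (auto simp: a_def field_simps)
      show "norm (q n x) \<le> indicator (cball 0 (R + 1)) x * C"
      proof (cases "norm x \<le> R + 1")
        case True
        have "\<bar>F (x + a *\<^sub>R b) - F x\<bar> \<le> C * \<bar>a\<bar>"
          by (rule partial_bound_imp_increment_le[OF diff C(2)])
        then have "\<bar>F (x + a *\<^sub>R b) - F x\<bar> / a \<le> C" using a by (simp add: divide_le_eq)
        then show ?thesis using True by (simp add: q_def a_def abs_mult)
      next
        case False
        have "norm (x + a *\<^sub>R b) \<ge> norm x - norm (a *\<^sub>R b)"
          using norm_triangle_ineq4[of "x + a *\<^sub>R b" "a *\<^sub>R b"] by simp
        then have "R < norm (x + a *\<^sub>R b)" "R < norm x" using False a b by auto
        then have "q n x = 0" using van unfolding q_def a_def vanishes_outside_def by simp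
        then show ?thesis using C by simp
      qed
    qed
  qed (use contq contd in \<open>auto intro: continuous_imp_measurable_lebesgue\<close>)
  then show ?thesis using q0 by (simp add: LIMSEQ_const_iff)
qed

lemma integration_by_parts:
  fixes h \<phi> :: "'a::euclidean_space \<Rightarrow> real"
  assumes h: "C_k 1 h" and \<phi>: "C_k 1 \<phi>" and van: "vanishes_outside R \<phi>" and b: "b \<in> Basis"
  shows "(LINT x|lebesgue. h x * partial b \<phi> x) = - (LINT x|lebesgue. partial b h x * \<phi> x)"
proof -
  have "continuous_on UNIV h" "continuous_on UNIV \<phi>"
    "continuous_on UNIV (partial b h)" "continuous_on UNIV (partial b \<phi>)"
    using h \<phi> b by auto
  moreover have "vanishes_outside R (\<lambda>x. h x * partial b \<phi> x)" "vanishes_outside R (\<lambda>x. partial b h x * \<phi> x)"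
    using van vanishes_outside_partial[OF van, of b] by (auto simp: vanishes_outside_def)
  ultimately have int: "integrable lebesgue (\<lambda>x. h x * partial b \<phi> x)" "integrable lebesgue (\<lambda>x. partial b h x * \<phi> x)"
    by (auto intro!: continuous_vanishes_imp_integrable continuous_on_mult)
  have "(LINT x|lebesgue. partial b (\<lambda>x. h x * \<phi> x) x) = 0"
    using C_k_mult[OF h \<phi>] b van by (intro integral_partial_eq_0[where R = R]) (auto simp: vanishes_outside_def)
  moreover have "partial b (\<lambda>x. h x * \<phi> x) = (\<lambda>x. h x * partial b \<phi> x + partial b h x * \<phi> x)"
    using h \<phi> b by (auto simp: partial_mult)
  ultimately show ?thesis using int by (simp add: Bochner_Integration.integral_add)
qed

lemma test_fun_vanishes_outside:
  assumes "test_fun \<phi>"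
  obtains R where "vanishes_outside R \<phi>"
proof -
  have "bounded {x. \<phi> x \<noteq> 0}"
    using assms unfolding test_fun_def by (intro bounded_subset[OF compact_imp_bounded closure_subset]) simp
  then obtain R where "\<forall>x\<in>{x. \<phi> x \<noteq> 0}. norm x \<le> R" unfolding bounded_iff by blast
  then have "vanishes_outside R \<phi>"
    unfolding vanishes_outside_def by (metis mem_Collect_eq not_le)
  then show thesis by (rule that)
qed

lemma partials_append: "partials (bs @ cs) f = partials bs (partials cs f)"
  by (induction bs) auto

lemma partials_C_k: "C_k (k + length bs) f \<Longrightarrow> set bs \<subseteq> Basis \<Longrightarrow> C_k k (partials bs f)"
proof (induction bs arbitrary: k)
  case (Cons b bs)
  then have "C_k (Suc k) (partials bs f)" by (intro Cons.IH) (simp_all del: C_k.simps)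
  then show ?case using Cons.prems by simp
qed simp

lemma partials_vanishes_outside: "vanishes_outside R f \<Longrightarrow> vanishes_outside R (partials bs f)"
  by (induction bs) (auto intro: vanishes_outside_partial)

text \<open>The outermost derivative of \<open>\<phi>\<close> is moved to \<open>h\<close> first and becomes the innermost one there, so
  that the list is reversed.\<close>

lemma iterated_integration_by_parts:
  fixes h \<phi> :: "'a::euclidean_space \<Rightarrow> real"
  assumes \<phi>: "test_fun \<phi>"
  shows "C_k (length bs) h \<Longrightarrow> set bs \<subseteq> Basis \<Longrightarrow>
    (LINT x|lebesgue. h x * partials bs \<phi> x) = (-1) ^ length bs * (LINT x|lebesgue. partials (rev bs) h x * \<phi> x)"
proof (induction bs arbitrary: h)
  case (Cons b bs)
  obtain R where R: "vanishes_outside R \<phi>" using \<phi> test_fun_vanishes_outside by blast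
  have "C_k (1 + length bs) \<phi>" using \<phi> by (simp add: test_fun_def)
  then have 1: "C_k 1 (partials bs \<phi>)" using Cons.prems by (intro partials_C_k) auto
  have 2: "C_k 1 h" using Cons.prems(1) by (rule C_k_mono) simp
  have "(LINT x|lebesgue. h x * partials (b # bs) \<phi> x) = - (LINT x|lebesgue. partial b h x * partials bs \<phi> x)"
    using integration_by_parts[OF 2 1 partials_vanishes_outside[OF R]] Cons.prems by simp
  also have "\<dots> = - ((-1) ^ length bs * (LINT x|lebesgue. partials (rev bs) (partial b h) x * \<phi> x))"
    using Cons.prems by (subst Cons.IH) auto
  finally show ?case by (simp add: partials_append)
qed simp

text \<open>If \<open>u\<close> were larger than \<open>C\<close> at \<open>x\<close>, it would be so near \<open>x\<close>. A bump \<open>\<phi>\<close> concentrated there gives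
  \<open>\<integral>u \<phi> > C \<integral>\<phi> \<ge> \<integral>g \<phi>\<close>, against the equality of the two integrals.\<close>

lemma weak_le_imp_le:
  fixes u g :: "'a::euclidean_space \<Rightarrow> real"
  assumes u: "continuous_on UNIV u" and g: "g \<in> borel_measurable lebesgue" and C: "AE x in lebesgue. \<bar>g x\<bar> \<le> C"
    and eq: "\<And>\<phi>. test_fun \<phi> \<Longrightarrow> (LINT x|lebesgue. u x * \<phi> x) = (LINT x|lebesgue. g x * \<phi> x)"
  shows "u x \<le> C"
proof (rule ccontr)
  assume "\<not> u x \<le> C"
  moreover have "isCont u x" using u by (simp add: continuous_on_eq_continuous_at)
  ultimately obtain \<delta> where "\<delta> > 0" and \<delta>: "\<And>y. dist y x < \<delta> \<Longrightarrow> dist (u y) (u x) < u x - C"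
    unfolding continuous_at_eps_delta by (metis diff_gt_0_iff_gt not_le)
  obtain \<phi> where \<phi>: "test_fun \<phi>" "\<And>y. \<phi> y \<ge> 0" "\<phi> x > 0" "\<And>y. \<phi> y \<noteq> 0 \<Longrightarrow> dist y x < \<delta>"
    using exists_bump[OF \<open>\<delta> > 0\<close>] by blast
  obtain R where R: "vanishes_outside R \<phi>" using \<phi>(1) test_fun_vanishes_outside by blast
  have "C_k 0 \<phi>" using \<phi>(1) unfolding test_fun_def by blast
  then have cont: "continuous_on UNIV \<phi>" by simp
  have int: "integrable lebesgue \<phi>" using cont R by (rule continuous_vanishes_imp_integrable)
  have intu: "integrable lebesgue (\<lambda>y. u y * \<phi> y)"
    using R by (intro continuous_vanishes_imp_integrable[where R = R] continuous_on_mult u cont)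
      (auto simp: vanishes_outside_def)
  have intg: "integrable lebesgue (\<lambda>y. g y * \<phi> y)"
  proof (rule Bochner_Integration.integrable_bound)
    show "integrable lebesgue (\<lambda>y. C * \<phi> y)" using int by simp
    show "(\<lambda>y. g y * \<phi> y) \<in> borel_measurable lebesgue"
      using g int by (intro borel_measurable_times) auto
    show "AE y in lebesgue. norm (g y * \<phi> y) \<le> norm (C * \<phi> y)"
      using C by eventually_elim (use \<phi>(2) in \<open>auto simp: abs_mult intro!: mult_mono\<close>)
  qed
  have "(LINT y|lebesgue. g y * \<phi> y) \<le> (LINT y|lebesgue. C * \<phi> y)"
    by (rule integral_mono_AE[OF intg]) (use C \<phi>(2) int in \<open>auto elim!: eventually_mono intro: mult_right_mono abs_le_D1\<close>)
  moreover have le: "C * \<phi> y \<le> u y * \<phi> y" for y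
  proof (cases "\<phi> y = 0")
    case False
    then have "C \<le> u y" using \<delta>[OF \<phi>(4)[OF False]] by (simp add: dist_real_def abs_if split: if_splits)
    then show ?thesis using \<phi>(2) by (simp add: mult_right_mono)
  qed simp
  ultimately have eq0: "(LINT y|lebesgue. u y * \<phi> y - C * \<phi> y) \<le> 0"
    using eq[OF \<phi>(1)] intu int by (simp add: Bochner_Integration.integral_diff)
  have "AE y in lebesgue. u y * \<phi> y - C * \<phi> y = 0"
  proof -
    have i: "integrable lebesgue (\<lambda>y. u y * \<phi> y - C * \<phi> y)" using intu int by simp
    have "(LINT y|lebesgue. u y * \<phi> y - C * \<phi> y) = 0"
      using eq0 le by (intro antisym) (auto intro!: integral_nonneg_AE)
    moreover have "AE y in lebesgue. 0 \<le> u y * \<phi> y - C * \<phi> y" using le by simp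
    ultimately show ?thesis using integral_nonneg_eq_0_iff_AE[OF i] by blast
  qed
  then have "AE y in lebesgue. u y * \<phi> y - C * \<phi> y \<le> 0"
    by (rule eventually_mono) (rule eq_refl)
  from continuous_AE_le_imp_le[OF _ this, of x] have "(u x - C) * \<phi> x \<le> 0"
    using u cont by (simp add: continuous_intros left_diff_distrib)
  then show False using \<phi>(3) \<open>\<not> u x \<le> C\<close> by (simp add: mult_le_0_iff)
qed

text \<open>The same constant bounds the function and all its partial derivatives up to order \<open>k\<close>.
  Convolution with \<open>f\<close> then simply multiplies this constant by the \<open>L\<^sup>1\<close> norm of \<open>f\<close>.\<close>

primrec C_k_bounded :: "real \<Rightarrow> nat \<Rightarrow> ('a::euclidean_space \<Rightarrow> real) \<Rightarrow> bool" where
  "C_k_bounded C 0 g \<longleftrightarrow> continuous_on UNIV g \<and> (\<forall>x. \<bar>g x\<bar> \<le> C)"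
| "C_k_bounded C (Suc k) g \<longleftrightarrow> (continuous_on UNIV g \<and> (\<forall>x. \<bar>g x\<bar> \<le> C)) \<and>
     (\<forall>b\<in>Basis. (\<forall>x. partial_diff b g x) \<and> C_k_bounded C k (partial b g))"

lemma C_k_boundedI:
  "C_k k g \<Longrightarrow> (\<And>bs x. set bs \<subseteq> Basis \<Longrightarrow> length bs \<le> k \<Longrightarrow> \<bar>partials bs g x\<bar> \<le> C) \<Longrightarrow> C_k_bounded C k g"
proof (induction k arbitrary: g)
  case 0
  from 0(2)[of "[]"] 0(1) show ?case by simp
next
  case (Suc k)
  have "C_k_bounded C k (partial b g)" if "b \<in> Basis" for b
  proof (rule Suc.IH)
    show "C_k k (partial b g)" using Suc.prems(1) that by simp
    show "\<bar>partials bs (partial b g) x\<bar> \<le> C" if "set bs \<subseteq> Basis" "length bs \<le> k" for bs x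
      using Suc.prems(2)[of "bs @ [b]" x] that \<open>b \<in> Basis\<close> by (simp add: partials_append)
  qed
  then show ?case using Suc.prems(1) Suc.prems(2)[of "[]"] by simp
qed

text \<open>Integration by parts identifies the classical derivative with the weak one tested against
  smooth functions, so that the essential bound of the latter is a pointwise bound of the former.\<close>

lemma sobolev_Linf_imp_partial_bounded:
  fixes h :: "'a::euclidean_space \<Rightarrow> real"
  assumes h: "C_k k h" and sob: "in_sobolev k in_Linf h" and bs: "set bs \<subseteq> Basis" "length bs \<le> k"
  shows "\<exists>C. \<forall>x. \<bar>partials bs h x\<bar> \<le> C"
proof -
  obtain g where g: "in_Linf g" "weak_deriv (rev bs) h g"
    using sob bs unfolding in_sobolev_def by (metis length_rev set_rev)
  then obtain C where C: "g \<in> borel_measurable lebesgue" "AE x in lebesgue. \<bar>g x\<bar> \<le> C"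
    by (auto simp: in_Linf_def)
  have cont: "continuous_on UNIV (partials bs h)"
    using partials_C_k[of 0 bs h] C_k_mono[OF h bs(2)] bs(1) by simp
  have eq: "(LINT x|lebesgue. partials bs h x * \<phi> x) = (LINT x|lebesgue. g x * \<phi> x)" if "test_fun \<phi>" for \<phi>
    using iterated_integration_by_parts[OF that, of "rev bs" h] C_k_mono[OF h bs(2)] bs(1) g(2) that
    by (simp add: weak_deriv_def)
  have "partials bs h x \<le> C" for x
    by (rule weak_le_imp_le[OF cont C eq])
  moreover have "- partials bs h x \<le> C" for x
    by (rule weak_le_imp_le[of "\<lambda>x. - partials bs h x" "\<lambda>x. - g x"])
      (use cont C eq in \<open>auto intro: continuous_on_minus\<close>)
  ultimately show ?thesis by (auto simp: abs_le_iff)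
qed

lemma sobolev_Linf_imp_C_k_bounded:
  fixes h :: "'a::euclidean_space \<Rightarrow> real"
  assumes h: "C_k k h" and sob: "in_sobolev k in_Linf h"
  shows "\<exists>C\<ge>0. C_k_bounded C k h"
proof -
  define S where "S = {bs :: 'a list. set bs \<subseteq> Basis \<and> length bs \<le> k}"
  have fin: "finite S" unfolding S_def by (rule finite_lists_length_le) simp
  have "\<forall>bs\<in>S. \<exists>C. \<forall>x. \<bar>partials bs h x\<bar> \<le> C"
    using sobolev_Linf_imp_partial_bounded[OF h sob] by (simp add: S_def)
  then obtain C where C: "\<And>bs x. bs \<in> S \<Longrightarrow> \<bar>partials bs h x\<bar> \<le> C bs" by metis
  have "C_k_bounded (\<Sum>bs\<in>S. \<bar>C bs\<bar>) k h"
  proof (rule C_k_boundedI[OF h])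
    fix bs :: "'a list" and x assume "set bs \<subseteq> Basis" "length bs \<le> k"
    then have bs: "bs \<in> S" by (simp add: S_def)
    have "\<bar>partials bs h x\<bar> \<le> \<bar>C bs\<bar>" using C[OF bs, of x] by simp
    also have "\<dots> \<le> (\<Sum>bs\<in>S. \<bar>C bs\<bar>)" using fin bs by (intro member_le_sum) auto
    finally show "\<bar>partials bs h x\<bar> \<le> (\<Sum>bs\<in>S. \<bar>C bs\<bar>)" .
  qed
  then show ?thesis by (intro exI[of _ "\<Sum>bs\<in>S. \<bar>C bs\<bar>"]) (simp add: sum_nonneg)
qed

section \<open>Convolution with a kernel with bounded derivatives\<close>

lemma C_k_bounded_SucD: "C_k_bounded C (Suc k) g \<Longrightarrow> C_k_bounded C k g"
proof (induction k arbitrary: g)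
  case (Suc k)
  have *: "(continuous_on UNIV g \<and> (\<forall>x. \<bar>g x\<bar> \<le> C)) \<and>
      (\<forall>b\<in>Basis. (\<forall>x. partial_diff b g x) \<and> C_k_bounded C (Suc k) (partial b g))"
    using Suc.prems by (rule C_k_bounded.simps(2)[THEN iffD1])
  then have "\<forall>b\<in>Basis. (\<forall>x. partial_diff b g x) \<and> C_k_bounded C k (partial b g)"
    using Suc.IH by blast
  with * show ?case by (intro C_k_bounded.simps(2)[THEN iffD2]) (rule conjI[OF conjunct1])
qed simp

lemma C_k_bounded_mono_order: "C_k_bounded C l g \<Longrightarrow> k \<le> l \<Longrightarrow> C_k_bounded C k g"
proof (induction l)
  case (Suc l)
  then show ?case using C_k_bounded_SucD[of C l g] by (cases "k = Suc l") auto
qed simp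

lemma C_k_bounded_imp_C_k: "C_k_bounded C k g \<Longrightarrow> C_k k g"
proof (induction k arbitrary: g)
  case (Suc k)
  then show ?case unfolding C_k_bounded.simps(2) C_k.simps(2) by blast
qed simp

lemma norm_mult_le_bound: "\<bar>c\<bar> \<le> C \<Longrightarrow> norm (a * c) \<le> C * norm a" for a c C :: real
  using mult_left_mono[of "\<bar>c\<bar>" C "\<bar>a\<bar>"] by (simp add: abs_mult mult.commute[of "\<bar>a\<bar>"])

lemma integrable_convol:
  fixes f g :: "'a::euclidean_space \<Rightarrow> real"
  assumes f: "integrable lebesgue f" and g: "C_k_bounded C 0 g"
  shows "integrable lebesgue (\<lambda>\<xi>. f \<xi> * g (x - \<xi>))"
proof (rule Bochner_Integration.integrable_bound)
  show "integrable lebesgue (\<lambda>\<xi>. C * f \<xi>)" using f by simp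
  have "continuous_on UNIV (\<lambda>\<xi>. g (x - \<xi>))"
    using g by (auto intro!: continuous_on_compose2[of UNIV g] continuous_intros)
  then show "(\<lambda>\<xi>. f \<xi> * g (x - \<xi>)) \<in> borel_measurable lebesgue"
    using f continuous_imp_measurable_lebesgue by (intro borel_measurable_times) auto
  show "AE \<xi> in lebesgue. norm (f \<xi> * g (x - \<xi>)) \<le> norm (C * f \<xi>)"
  proof (intro AE_I2)
    fix \<xi>
    have "\<bar>g (x - \<xi>)\<bar> \<le> \<bar>C\<bar>" using g by (metis C_k_bounded.simps(1) abs_ge_self order_trans)
    then show "norm (f \<xi> * g (x - \<xi>)) \<le> norm (C * f \<xi>)"
      using norm_mult_le_bound[of "g (x - \<xi>)" "\<bar>C\<bar>" "f \<xi>"] by (simp add: abs_mult)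
  qed
qed

lemma abs_convol_le:
  fixes f g :: "'a::euclidean_space \<Rightarrow> real"
  assumes f: "integrable lebesgue f" and g: "C_k_bounded C 0 g"
  shows "\<bar>convol f g x\<bar> \<le> C * L1_norm f"
proof -
  have "norm (convol f g x) \<le> (LINT \<xi>|lebesgue. C * norm (f \<xi>))"
    unfolding convol_def
    by (rule Bochner_Integration.integral_norm_bound_integral[OF integrable_convol[OF f g]])
      (use f g in \<open>auto intro!: norm_mult_le_bound simp del: real_norm_def\<close>)
  then show ?thesis by (simp add: L1_norm_def)
qed

lemma convol_diff:
  fixes f f' g :: "'a::euclidean_space \<Rightarrow> real"
  assumes "integrable lebesgue f" "integrable lebesgue f'" "C_k_bounded C 0 g"
  shows "convol (\<lambda>\<xi>. f \<xi> - f' \<xi>) g x = convol f g x - convol f' g x"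
  unfolding convol_def left_diff_distrib
  using Bochner_Integration.integral_diff[OF integrable_convol[OF assms(1,3), of x] integrable_convol[OF assms(2,3), of x]] .

lemma continuous_convol:
  fixes f g :: "'a::euclidean_space \<Rightarrow> real"
  assumes f: "integrable lebesgue f" and g: "C_k_bounded C 0 g"
  shows "continuous_on UNIV (convol f g)"
  unfolding continuous_on_sequentially comp_def
proof (intro allI impI ballI, elim conjE)
  fix X :: "nat \<Rightarrow> 'a" and x assume X: "X \<longlonglongrightarrow> x"
  show "(\<lambda>n. convol f g (X n)) \<longlonglongrightarrow> convol f g x"
    unfolding convol_def
  proof (rule integral_dominated_convergence[where w = "\<lambda>\<xi>. C * norm (f \<xi>)"])
    show "AE \<xi> in lebesgue. (\<lambda>n. f \<xi> * g (X n - \<xi>)) \<longlonglongrightarrow> f \<xi> * g (x - \<xi>)"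
    proof (intro AE_I2 tendsto_mult tendsto_const)
      fix \<xi>
      have "(\<lambda>n. X n - \<xi>) \<longlonglongrightarrow> x - \<xi>" by (intro tendsto_diff X tendsto_const)
      then show "(\<lambda>n. g (X n - \<xi>)) \<longlonglongrightarrow> g (x - \<xi>)"
        using g by (intro continuous_on_tendsto_compose[of UNIV g]) auto
    qed
    show "AE \<xi> in lebesgue. norm (f \<xi> * g (X n - \<xi>)) \<le> C * norm (f \<xi>)" for n
      using g by (intro AE_I2 norm_mult_le_bound) simp
  qed (use f integrable_convol[OF f g] in auto)
qed

text \<open>Differentiation under the integral sign: the difference quotients of \<open>g\<close> are bounded by \<open>C\<close>, and
  \<open>C * norm (f \<xi>)\<close> is an integrable majorant.\<close>

lemma partial_convol:
  fixes f g :: "'a::euclidean_space \<Rightarrow> real"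
  assumes f: "integrable lebesgue f" and g: "C_k_bounded C (Suc k) g" and b: "b \<in> Basis"
  shows "partial_diff b (convol f g) x" "partial b (convol f g) x = convol f (partial b g) x"
proof -
  have g0: "C_k_bounded C 0 g" using C_k_bounded_mono_order[OF g, of 0] by simp
  have g1: "C_k_bounded C 0 (partial b g)" using g b C_k_bounded_mono_order[of C k "partial b g" 0] by simp
  have diff: "\<And>x. partial_diff b g x" using g b by simp
  have "((\<lambda>s. convol f g (x + s *\<^sub>R b)) has_real_derivative convol f (partial b g) x) (at 0)"
    unfolding has_field_derivative_iff
  proof (subst tendsto_at_iff_sequentially, intro allI impI)
    fix S :: "nat \<Rightarrow> real" assume S: "\<forall>i. S i \<in> UNIV - {0}" "S \<longlonglongrightarrow> 0"
    let ?q = "\<lambda>n \<xi>. (g (x - \<xi> + S n *\<^sub>R b) - g (x - \<xi>)) / S n"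
    have "(\<lambda>n. LINT \<xi>|lebesgue. f \<xi> * ?q n \<xi>) \<longlonglongrightarrow> convol f (partial b g) x"
      unfolding convol_def
    proof (rule integral_dominated_convergence[where w = "\<lambda>\<xi>. C * norm (f \<xi>)"])
      show "AE \<xi> in lebesgue. (\<lambda>n. f \<xi> * ?q n \<xi>) \<longlonglongrightarrow> f \<xi> * partial b g (x - \<xi>)"
      proof (intro AE_I2 tendsto_mult tendsto_const)
        fix \<xi>
        show "(\<lambda>n. ?q n \<xi>) \<longlonglongrightarrow> partial b g (x - \<xi>)"
          using S by (intro difference_quotient_tendsto diff) auto
      qed
      show "AE \<xi> in lebesgue. norm (f \<xi> * ?q n \<xi>) \<le> C * norm (f \<xi>)" for n
      proof (intro AE_I2)
        fix \<xi>
        have "\<bar>g (x - \<xi> + S n *\<^sub>R b) - g (x - \<xi>)\<bar> \<le> C * \<bar>S n\<bar>"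
          using g1 by (intro partial_bound_imp_increment_le diff) simp
        then have "\<bar>?q n \<xi>\<bar> \<le> C"
          using S(1) by (simp add: abs_divide divide_le_eq)
        then show "norm (f \<xi> * ?q n \<xi>) \<le> C * norm (f \<xi>)"
          by (rule norm_mult_le_bound)
      qed
      show "(\<lambda>\<xi>. f \<xi> * ?q n \<xi>) \<in> borel_measurable lebesgue" for n
      proof -
        have "continuous_on UNIV (\<lambda>\<xi>. (g (x - \<xi> + S n *\<^sub>R b) - g (x - \<xi>)) * (1 / S n))"
        proof -
          have "continuous_on UNIV (\<lambda>\<xi>. g (x - \<xi> + a))" for a
            using g by (intro continuous_on_compose2[of UNIV g UNIV "\<lambda>\<xi>. x - \<xi> + a"] continuous_intros) auto
          from this[of "S n *\<^sub>R b"] this[of 0] show ?thesis by (intro continuous_intros) auto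
        qed
        then show ?thesis
          using f continuous_imp_measurable_lebesgue by (intro borel_measurable_times) auto
      qed
      show "(\<lambda>\<xi>. f \<xi> * partial b g (x - \<xi>)) \<in> borel_measurable lebesgue"
        using integrable_convol[OF f g1] by auto
    qed (use f in auto)
    note lim = this
    have quot: "(LINT \<xi>|lebesgue. f \<xi> * ?q n \<xi>)
        = (convol f g (x + S n *\<^sub>R b) - convol f g x) / S n" for n
    proof -
      have "(LINT \<xi>|lebesgue. f \<xi> * ?q n \<xi>)
        = (LINT \<xi>|lebesgue. (f \<xi> * g (x + S n *\<^sub>R b - \<xi>) - f \<xi> * g (x - \<xi>)) / S n)"
        by (simp add: algebra_simps diff_divide_distrib)
      also have "\<dots> = (convol f g (x + S n *\<^sub>R b) - convol f g x) / S n"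
        unfolding convol_def
        by (simp add: Bochner_Integration.integral_diff integrable_convol[OF f g0])
      finally show ?thesis .
    qed
    show "((\<lambda>s. (convol f g (x + s *\<^sub>R b) - convol f g (x + 0 *\<^sub>R b)) / (s - 0)) \<circ> S) \<longlonglongrightarrow> convol f (partial b g) x"
      using lim unfolding quot by (simp add: o_def)
  qed
  then have "((\<lambda>s. convol f g (x + s *\<^sub>R b)) has_vector_derivative convol f (partial b g) x) (at 0)"
    by (simp add: has_real_derivative_iff_has_vector_derivative)
  then show "partial_diff b (convol f g) x" "partial b (convol f g) x = convol f (partial b g) x"
    unfolding partial_diff_def partial_def[of b "convol f g"]
    by (auto intro: vector_derivative_at differentiableI_vector)
qed

lemma C_k_bounded_convol:
  fixes f g :: "'a::euclidean_space \<Rightarrow> real"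
  assumes f: "integrable lebesgue f"
  shows "C_k_bounded C k g \<Longrightarrow> C_k_bounded (C * L1_norm f) k (convol f g)"
proof (induction k arbitrary: g)
  case 0
  then show ?case using abs_convol_le[OF f 0] continuous_convol[OF f 0] by simp
next
  case (Suc k)
  have g0: "C_k_bounded C 0 g" using C_k_bounded_mono_order[OF Suc.prems, of 0] by simp
  have "partial b (convol f g) = convol f (partial b g)" if "b \<in> Basis" for b
    using partial_convol(2)[OF f Suc.prems that] by auto
  then show ?case
    using partial_convol(1)[OF f Suc.prems] abs_convol_le[OF f g0] continuous_convol[OF f g0]
      Suc.IH Suc.prems by simp
qed

section \<open>Changes of variables close to the identity\<close>

text \<open>In the Leibniz formula a permutation different from the identity moves at least two indices.
  Its product has two factors that vanish at the identity matrix, so that its derivative vanishes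
  there. The identity permutation contributes the sum of the diagonal entries.\<close>

lemma has_derivative_det_at_mat_1:
  "((det :: real^'n^'n \<Rightarrow> real) has_derivative trace) (at (mat 1))"
proof -
  let ?P = "{p. p permutes (UNIV :: 'n set)}"
  let ?m = "\<lambda>p i. \<Prod>j\<in>UNIV - {i}. (mat 1 :: real^'n^'n) $ j $ p j"
  have entry: "((\<lambda>A::real^'n^'n. A $ i $ j) has_derivative (\<lambda>H. H $ i $ j)) F" for i j F
    by (intro bounded_linear_imp_has_derivative bounded_linear_compose[OF bounded_linear_vec_nth] bounded_linear_vec_nth)
  have "((\<lambda>A::real^'n^'n. \<Sum>p\<in>?P. of_int (sign p) * (\<Prod>i\<in>UNIV. A $ i $ p i)) has_derivative
     (\<lambda>H. \<Sum>p\<in>?P. of_int (sign p) * (\<Sum>i\<in>UNIV. H $ i $ p i * ?m p i)))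
     (at (mat 1))"
    by (intro has_derivative_sum has_derivative_mult_right has_derivative_prod entry)
  moreover have "(\<Sum>p\<in>?P. of_int (sign p) * (\<Sum>i\<in>UNIV. H $ i $ p i * ?m p i)) = trace H" for H :: "real^'n^'n"
  proof -
    have z: "?m p i = 0" if p: "p \<in> ?P" "p \<noteq> id" for p i
    proof -
      obtain k where k: "p k \<noteq> k" using p by (auto simp: fun_eq_iff)
      have "p (p k) \<noteq> p k" using k p permutes_inj by (metis mem_Collect_eq injD)
      then have "\<exists>j\<in>UNIV - {i}. p j \<noteq> j" using k by (cases "k = i") auto
      then obtain j where "j \<in> UNIV - {i}" "p j \<noteq> j" by blast
      then show ?thesis by (intro prod_zero bexI[of _ j]) (simp_all add: mat_def)
    qed
    have "(\<Sum>p\<in>?P. of_int (sign p) * (\<Sum>i\<in>UNIV. H $ i $ p i * ?m p i))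
      = (\<Sum>p\<in>{id}. of_int (sign p) * (\<Sum>i\<in>UNIV. H $ i $ p i * ?m p i))"
    proof (rule sum.mono_neutral_right)
      show "\<forall>p\<in>?P - {id}. of_int (sign p) *
          (\<Sum>i\<in>UNIV. H $ i $ p i * ?m p i) = 0"
      proof
        fix p assume "p \<in> ?P - {id}"
        then have "(\<Sum>i\<in>UNIV. H $ i $ p i * ?m p i) = 0"
          by (intro sum.neutral ballI) (simp add: z del: prod_zero_iff)
        then show "of_int (sign p) * (\<Sum>i\<in>UNIV. H $ i $ p i * ?m p i) = 0"
          by simp
      qed
    qed (auto simp: permutes_id finite_permutations)
    then show ?thesis by (simp add: mat_def trace_def)
  qed
  ultimately show ?thesis by (simp add: det_def[abs_def])
qed

lemma norm_matrix_le:
  fixes G :: "real^'n \<Rightarrow> real^'n"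
  assumes "\<And>y. norm (G y) \<le> K * norm y"
  shows "norm (matrix G) \<le> real CARD('n) * real CARD('n) * K"
proof -
  have "norm (matrix G) \<le> (\<Sum>i\<in>UNIV. norm (matrix G $ i))"
    unfolding norm_vec_def[of "matrix G"] by (rule L2_set_le_sum) simp
  also have "\<dots> \<le> (\<Sum>i\<in>(UNIV::'n set). \<Sum>j\<in>(UNIV::'n set). K)"
  proof (rule sum_mono)
    fix i
    have "norm (matrix G $ i) \<le> (\<Sum>j\<in>UNIV. \<bar>matrix G $ i $ j\<bar>)" using norm_le_l1_cart[of "matrix G $ i"] by simp
    also have "\<dots> \<le> (\<Sum>j\<in>(UNIV::'n set). K)"
    proof (rule sum_mono)
      fix j :: 'n
      have "\<bar>matrix G $ i $ j\<bar> \<le> norm (G (axis j 1))" by (simp add: matrix_def component_le_norm_cart)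
      also have "\<dots> \<le> K" using assms[of "axis j 1"] by (simp add: norm_axis_1)
      finally show "\<bar>matrix G $ i $ j\<bar> \<le> K" .
    qed
    finally show "norm (matrix G $ i) \<le> (\<Sum>j\<in>(UNIV::'n set). K)" .
  qed
  finally show ?thesis by simp
qed

text \<open>The threshold \<open>\<delta>\<close> depends on the bound \<open>K\<close> only, not on the linear map: this uniformity lets the
  estimate be used at all points and all times at once.\<close>

lemma Jacobian_near_identity:
  assumes "e > 0" "K \<ge> 0"
  obtains \<delta> where "\<delta> > 0" "\<And>h G. \<bar>h\<bar> < \<delta> \<Longrightarrow> linear G \<Longrightarrow> (\<And>y::real^'n. norm (G y) \<le> K * norm y) \<Longrightarrow>
    1 - h * trace (matrix G) - e * \<bar>h\<bar> \<le> \<bar>det (matrix (\<lambda>y. y - h *\<^sub>R G y))\<bar>"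
proof -
  define M where "M = real CARD('n) * real CARD('n) * K + 1"
  have M: "M > 0" using assms unfolding M_def by (intro add_nonneg_pos) auto
  obtain \<delta> where "\<delta> > 0" and \<delta>: "\<And>B::real^'n^'n. norm (B - mat 1) < \<delta> \<Longrightarrow>
      norm (det B - det (mat 1 :: real^'n^'n) - trace (B - mat 1)) \<le> e / M * norm (B - mat 1)"
    using has_derivative_det_at_mat_1[where 'n='n] assms M unfolding has_derivative_at_alt
    by (metis divide_pos_pos)
  show thesis
  proof (rule that[of "\<delta> / M"])
    show "\<delta> / M > 0" using M \<open>\<delta> > 0\<close> by simp
    fix h :: real and G :: "real^'n \<Rightarrow> real^'n"
    assume h: "\<bar>h\<bar> < \<delta> / M" and G: "linear G" "\<And>y. norm (G y) \<le> K * norm y"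
    define B :: "real^'n^'n" where "B = matrix (\<lambda>y. y - h *\<^sub>R G y)"
    have B: "B - mat 1 = - h *\<^sub>R matrix G"
      unfolding B_def by (auto simp: vec_eq_iff matrix_def mat_def axis_def)
    have nB: "norm (B - mat 1) \<le> \<bar>h\<bar> * M"
      unfolding B using norm_matrix_le[OF G(2)] by (auto simp: M_def intro!: mult_left_mono)
    also have "\<dots> < \<delta>" using h M by (simp add: pos_less_divide_eq)
    finally have "norm (det B - det (mat 1 :: real^'n^'n) - trace (B - mat 1)) \<le> e / M * norm (B - mat 1)"
      by (rule \<delta>)
    also have "\<dots> \<le> e / M * (\<bar>h\<bar> * M)" using nB assms M by (intro mult_left_mono) auto
    also have "\<dots> = e * \<bar>h\<bar>" using M by simp
    finally have "\<bar>det B - 1 - trace (B - mat 1)\<bar> \<le> e * \<bar>h\<bar>" by simp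
    moreover have "trace (B - mat 1) = - (h * trace (matrix G))"
      unfolding B by (simp add: trace_def sum_distrib_left sum_negf)
    ultimately show "1 - h * trace (matrix G) - e * \<bar>h\<bar> \<le> \<bar>det (matrix (\<lambda>y. y - h *\<^sub>R G y))\<bar>"
      unfolding B_def[symmetric] by (simp add: abs_if split: if_splits)
  qed
qed

text \<open>The range of \<open>P\<close> may be a proper subset of the space, hence an inequality.\<close>

lemma change_of_variables_le:
  fixes P :: "real^'n::{finite,wellorder} \<Rightarrow> real^'n::_" and u :: "real^'n::_ \<Rightarrow> real"
  assumes der: "\<And>x. (P has_derivative P' x) (at x)" and inj: "inj P"
    and u: "integrable lebesgue u" "\<And>x. u x \<ge> 0"
  shows "integrable lebesgue (\<lambda>x. \<bar>det (matrix (P' x))\<bar> * u (P x))"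
    and "(LINT x|lebesgue. \<bar>det (matrix (P' x))\<bar> * u (P x)) \<le> (LINT x|lebesgue. u x)"
proof -
  \<comment> \<open>A one-dimensional space carries the scalar integrand as a vector.\<close>
  define e :: "real^1" where "e = axis 1 1"
  have e: "e \<bullet> e = 1" by (simp add: e_def inner_axis_axis)
  have meas: "range P \<in> sets lebesgue"
    using der by (intro differentiable_image_in_sets_lebesgue)
      (auto simp: differentiable_on_def differentiable_def)
  have si: "set_integrable lebesgue (range P) u"
    unfolding set_integrable_def by (rule integrable_mult_indicator[OF meas u(1)])
  then have sie: "(\<lambda>y. u y *\<^sub>R e) absolutely_integrable_on range P"
    unfolding set_integrable_def using integrable_scaleR_left[of e] by fastforce
  have cv: "(\<lambda>x. \<bar>det (matrix (P' x))\<bar> *\<^sub>R (u (P x) *\<^sub>R e)) absolutely_integrable_on UNIV \<and>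
           integral UNIV (\<lambda>x. \<bar>det (matrix (P' x))\<bar> *\<^sub>R (u (P x) *\<^sub>R e)) = integral (range P) (\<lambda>y. u y *\<^sub>R e)"
    using has_absolute_integral_change_of_variables[of UNIV P P' "\<lambda>y. u y *\<^sub>R e" "integral (range P) (\<lambda>y. u y *\<^sub>R e)"]
      der inj sie by simp
  then have "integrable lebesgue (\<lambda>x. (\<bar>det (matrix (P' x))\<bar> *\<^sub>R (u (P x) *\<^sub>R e)) \<bullet> e)"
    unfolding set_integrable_def by (intro integrable_inner_left) simp
  then show int: "integrable lebesgue (\<lambda>x. \<bar>det (matrix (P' x))\<bar> * u (P x))"
    by (simp add: e)
  have "(LINT x|lebesgue. (\<bar>det (matrix (P' x))\<bar> * u (P x)) *\<^sub>R e) = (LINT x:range P|lebesgue. u x *\<^sub>R e)"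
  proof -
    have "(LINT x|lebesgue. (\<bar>det (matrix (P' x))\<bar> * u (P x)) *\<^sub>R e)
        = integral UNIV (\<lambda>x. \<bar>det (matrix (P' x))\<bar> *\<^sub>R (u (P x) *\<^sub>R e))"
      using set_lebesgue_integral_eq_integral(2)[OF conjunct1[OF cv]] by (simp add: set_lebesgue_integral_def)
    also have "\<dots> = (LINT x:range P|lebesgue. u x *\<^sub>R e)"
      using cv set_lebesgue_integral_eq_integral(2)[OF sie] by simp
    finally show ?thesis .
  qed
  also have "\<dots> = (LINT x|lebesgue. indicator (range P) x * u x) *\<^sub>R e"
    using si integral_scaleR_left[of e lebesgue "\<lambda>x. indicator (range P) x * u x"]
    by (simp add: set_lebesgue_integral_def set_integrable_def)
  finally have "(LINT x|lebesgue. \<bar>det (matrix (P' x))\<bar> * u (P x)) *\<^sub>R e = (LINT x|lebesgue. indicator (range P) x * u x) *\<^sub>R e"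
    using int by simp
  then have "(LINT x|lebesgue. \<bar>det (matrix (P' x))\<bar> * u (P x)) = (LINT x|lebesgue. indicator (range P) x * u x)"
    using e by auto
  also have "\<dots> \<le> (LINT x|lebesgue. u x)"
    using si u by (intro integral_mono) (auto simp: set_integrable_def indicator_def)
  finally show "(LINT x|lebesgue. \<bar>det (matrix (P' x))\<bar> * u (P x)) \<le> (LINT x|lebesgue. u x)" .
qed

lemma Lipschitz_imp_derivative_bounded:
  fixes g :: "'a::real_normed_vector \<Rightarrow> 'b::real_normed_vector"
  assumes der: "(g has_derivative G) (at x)" and lip: "\<And>x y. norm (g x - g y) \<le> K * norm (x - y)"
  shows "norm (G y) \<le> K * norm y"
proof -
  have lin: "linear G" using der by (rule has_derivative_linear)
  show ?thesis
  proof (cases "y = 0")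
    case True
    then show ?thesis using linear_0[OF lin] by simp
  next
    case False
    show ?thesis
    proof (rule field_le_epsilon)
      fix e :: real assume "e > 0"
      then obtain d where "d > 0" and d: "\<And>z. norm (z - x) < d \<Longrightarrow>
          norm (g z - g x - G (z - x)) \<le> e / norm y * norm (z - x)"
        using der False unfolding has_derivative_at_alt by (metis divide_pos_pos zero_less_norm_iff)
      define s where "s = d / (2 * norm y)"
      have s: "s > 0" "norm (s *\<^sub>R y) < d" using \<open>d > 0\<close> False by (auto simp: s_def)
      have "s * norm (G y) = norm (G (s *\<^sub>R y))"
        using s by (simp add: linear_cmul[OF lin])
      also have "\<dots> \<le> norm (g (x + s *\<^sub>R y) - g x) + norm (g (x + s *\<^sub>R y) - g x - G (s *\<^sub>R y))"
        using norm_triangle_ineq4[of "g (x + s *\<^sub>R y) - g x" "g (x + s *\<^sub>R y) - g x - G (s *\<^sub>R y)"] by simp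
      also have "\<dots> \<le> K * norm (s *\<^sub>R y) + e / norm y * norm (s *\<^sub>R y)"
        using lip[of "x + s *\<^sub>R y" x] d[of "x + s *\<^sub>R y"] s by simp
      also have "\<dots> = s * (K * norm y + e)" using s False by (simp add: field_simps)
      finally show "norm (G y) \<le> K * norm y + e" using s by simp
    qed
  qed
qed

lemma integrable_compose_displacement:
  fixes u q :: "'a::euclidean_space \<Rightarrow> real" and g :: "'a \<Rightarrow> 'a"
  assumes u: "continuous_on UNIV u" "vanishes_outside R u" and q: "continuous_on UNIV q"
    and g: "continuous_on UNIV g" "\<And>x. norm (g x) \<le> K"
  shows "integrable lebesgue (\<lambda>x. q x * u (x - h *\<^sub>R g x))"
proof (rule continuous_vanishes_imp_integrable)
  have "continuous_on UNIV (\<lambda>x. u (x - h *\<^sub>R g x))"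
    by (rule continuous_on_compose2[OF u(1), of UNIV "\<lambda>x. x - h *\<^sub>R g x"]) (intro continuous_intros g, auto)
  then show "continuous_on UNIV (\<lambda>x. q x * u (x - h *\<^sub>R g x))" by (intro continuous_intros q)
  show "vanishes_outside (R + \<bar>h\<bar> * K) (\<lambda>x. q x * u (x - h *\<^sub>R g x))"
    unfolding vanishes_outside_def
  proof (intro allI impI)
    fix x :: 'a assume x: "R + \<bar>h\<bar> * K < norm x"
    have "norm (h *\<^sub>R g x) \<le> \<bar>h\<bar> * K" using g(2) by (simp add: mult_left_mono)
    then have "R < norm (x - h *\<^sub>R g x)" using x norm_triangle_ineq2[of x "h *\<^sub>R g x"] by simp
    then show "q x * u (x - h *\<^sub>R g x) = 0" using u(2) by (simp add: vanishes_outside_def)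
  qed
qed

text \<open>The map \<open>x \<mapsto> x - h *\<^sub>R g x\<close> is one explicit Euler step backwards along the field \<open>g\<close>, and \<open>u\<close> is the
  density that it transports.\<close>

definition euler_step_data ::
  "real \<Rightarrow> ((real, 'n::finite) vec \<Rightarrow> (real, 'n) vec) \<Rightarrow> ((real, 'n) vec \<Rightarrow> (real, 'n) vec \<Rightarrow> (real, 'n) vec) \<Rightarrow>
    ((real, 'n) vec \<Rightarrow> real) \<Rightarrow> real \<Rightarrow> bool" where
  "euler_step_data K g G u R \<longleftrightarrow> (\<forall>x. (g has_derivative G x) (at x)) \<and>
    (\<forall>x y. norm (g x - g y) \<le> K * norm (x - y)) \<and> (\<forall>x. norm (g x) \<le> K) \<and>
    continuous_on UNIV (\<lambda>x. trace (matrix (G x))) \<and>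
    continuous_on UNIV u \<and> vanishes_outside R u \<and> (\<forall>x. 0 \<le> u x)"

text \<open>Since \<open>\<bar>h\<bar> * K < 1\<close> the Euler step is injective, and its Jacobian is at least
  \<open>1 - h * trace (matrix (G x)) - e * \<bar>h\<bar>\<close>.\<close>

lemma near_identity_integral_le_wellorder:
  assumes "e > 0" "K \<ge> 0"
  obtains \<delta> where "\<delta> > 0"
    "\<And>h g G R. \<And>u :: (real, 'n::{finite,wellorder}) vec \<Rightarrow> real. \<bar>h\<bar> < \<delta> \<Longrightarrow> euler_step_data K g G u R \<Longrightarrow>
      (LINT x|lebesgue. (1 - h * trace (matrix (G x)) - e * \<bar>h\<bar>) * u (x - h *\<^sub>R g x)) \<le> (LINT x|lebesgue. u x)"
proof -
  obtain \<delta> where "\<delta> > 0" and \<delta>: "\<And>h G. \<bar>h\<bar> < \<delta> \<Longrightarrow> linear G \<Longrightarrow> (\<And>y::(real, 'n) vec. norm (G y) \<le> K * norm y) \<Longrightarrow>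
    1 - h * trace (matrix G) - e * \<bar>h\<bar> \<le> \<bar>det (matrix (\<lambda>y. y - h *\<^sub>R G y))\<bar>"
    using Jacobian_near_identity[OF assms] by blast
  show thesis
  proof (rule that[of "min \<delta> (1 / (K + 1))"])
    show "0 < min \<delta> (1 / (K + 1))" using \<open>\<delta> > 0\<close> assms by simp
    fix h R :: real and g :: "(real, 'n) vec \<Rightarrow> (real, 'n) vec" and G and u :: "(real, 'n) vec \<Rightarrow> real"
    assume h: "\<bar>h\<bar> < min \<delta> (1 / (K + 1))" and "euler_step_data K g G u R"
    then have der: "\<And>x. (g has_derivative G x) (at x)"
      and lip: "\<And>x y. norm (g x - g y) \<le> K * norm (x - y)" and bd: "\<And>x. norm (g x) \<le> K"
      and w: "continuous_on UNIV (\<lambda>x. trace (matrix (G x)))"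
      and u: "continuous_on UNIV u" "vanishes_outside R u" "\<And>x. 0 \<le> u x"
      by (auto simp: euler_step_data_def)
    have contg: "continuous_on UNIV g"
      using has_derivative_continuous[OF der] by (simp add: continuous_on_eq_continuous_at)
    have hK: "\<bar>h\<bar> * K < 1"
    proof -
      have "\<bar>h\<bar> * (K + 1) < 1" using h assms by (simp add: field_simps)
      then show ?thesis by (simp add: algebra_simps)
    qed
    define P where "P = (\<lambda>x. x - h *\<^sub>R g x)"
    define P' where "P' = (\<lambda>x y. y - h *\<^sub>R G x y)"
    have derP: "(P has_derivative P' x) (at x)" for x
      unfolding P_def P'_def by (auto intro!: derivative_eq_intros der)
    have "inj P"
    proof (rule injI)
      fix x y assume "P x = P y"
      then have "x - y = h *\<^sub>R (g x - g y)" by (simp add: P_def algebra_simps)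
      then have "norm (x - y) \<le> \<bar>h\<bar> * (K * norm (x - y))"
        using lip[of x y] by (simp add: mult_left_mono)
      then have "(1 - \<bar>h\<bar> * K) * norm (x - y) \<le> 0" by (simp add: algebra_simps)
      then have "norm (x - y) \<le> 0" using hK by (simp add: mult_le_0_iff)
      then show "x = y" by simp
    qed
    have int: "integrable lebesgue u" using u by (intro continuous_vanishes_imp_integrable)
    note cv = change_of_variables_le[OF derP \<open>inj P\<close> int u(3)]
    have "integrable lebesgue (\<lambda>x. (1 - h * trace (matrix (G x)) - e * \<bar>h\<bar>) * u (P x))"
      unfolding P_def by (rule integrable_compose_displacement[OF u(1,2) _ contg bd]) (intro continuous_intros w)
    then have "(LINT x|lebesgue. (1 - h * trace (matrix (G x)) - e * \<bar>h\<bar>) * u (P x))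
        \<le> (LINT x|lebesgue. \<bar>det (matrix (P' x))\<bar> * u (P x))"
    proof (rule integral_mono[OF _ cv(1)])
      fix x
      have "1 - h * trace (matrix (G x)) - e * \<bar>h\<bar> \<le> \<bar>det (matrix (P' x))\<bar>"
        unfolding P'_def using h
        by (intro \<delta> has_derivative_linear[OF der] Lipschitz_imp_derivative_bounded[OF der lip]) auto
      then show "(1 - h * trace (matrix (G x)) - e * \<bar>h\<bar>) * u (P x) \<le> \<bar>det (matrix (P' x))\<bar> * u (P x)"
        using u(3) by (rule mult_right_mono)
    qed
    also have "\<dots> \<le> (LINT x|lebesgue. u x)" by (rule cv(2))
    finally show "(LINT x|lebesgue. (1 - h * trace (matrix (G x)) - e * \<bar>h\<bar>) * u (x - h *\<^sub>R g x)) \<le> (LINT x|lebesgue. u x)"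
      by (simp add: P_def)
  qed
qed

text \<open>The change of variables formula is formulated for coordinates indexed by a well-ordered type.
  A finite index type has no order of its own; it is replaced by an initial segment of the natural
  numbers of the same cardinality, and the coordinates are renamed accordingly.\<close>

typedef (overloaded) ('a::finite) enumerated = "{..<CARD('a)}"
  by (rule exI[of _ 0]) simp

setup_lifting type_definition_enumerated

instantiation enumerated :: (finite) "{finite, wellorder}"
begin

lift_definition less_eq_enumerated :: "'a enumerated \<Rightarrow> 'a enumerated \<Rightarrow> bool" is "(\<le>)" .
lift_definition less_enumerated :: "'a enumerated \<Rightarrow> 'a enumerated \<Rightarrow> bool" is "(<)" .

instance
proof
  show "finite (UNIV :: 'a enumerated set)"
    by (metis finite_imageD finite_lessThan inj_on_def Rep_enumerated_inject finite_subset Rep_enumerated image_subset_iff)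
  fix P :: "'a enumerated \<Rightarrow> bool" and x
  assume step: "\<And>x. (\<And>y. y < x \<Longrightarrow> P y) \<Longrightarrow> P x"
  show "P x"
    by (induction x rule: measure_induct_rule[of Rep_enumerated]) (rule step, simp add: less_enumerated.rep_eq)
qed (transfer; force)+

end

lemma exists_bij_enumerated: "\<exists>\<sigma>. bij_betw (\<sigma> :: 'n::finite \<Rightarrow> 'n enumerated) UNIV UNIV"
proof (rule finite_same_card_bij)
  show "CARD('n) = CARD('n enumerated)"
    by (simp add: type_definition.card[OF type_definition_enumerated])
qed auto

definition reindex :: "('m \<Rightarrow> 'n) \<Rightarrow> (real, 'n::finite) vec \<Rightarrow> (real, 'm::finite) vec" where
  "reindex \<sigma> x = (\<chi> i. x $ \<sigma> i)"

lemma linear_reindex: "linear (reindex \<sigma>)"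
  by (rule linearI) (simp_all add: reindex_def vec_eq_iff)

lemma continuous_on_reindex: "continuous_on S (reindex \<sigma>)"
  by (rule linear_continuous_on[OF linear_conv_bounded_linear[THEN iffD1, OF linear_reindex]])

lemma norm_reindex:
  assumes "bij \<sigma>"
  shows "norm (reindex \<sigma> x) = norm x"
  using sum.reindex_bij_betw[OF assms, of "\<lambda>i. (x $ i)\<^sup>2"]
  by (simp add: reindex_def norm_vec_def L2_set_def)

lemma prod_inner_Basis_vec: "(\<Prod>b\<in>Basis. (x :: (real, 'k::finite) vec) \<bullet> b) = (\<Prod>i\<in>UNIV. x $ i)"
proof -
  have B: "(Basis :: (real, 'k) vec set) = range (\<lambda>i. axis i 1)" by (auto simp: Basis_vec_def)
  show ?thesis unfolding B by (subst prod.reindex) (auto simp: inj_on_def axis_eq_axis inner_axis)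
qed

lemma distr_reindex_lborel:
  fixes \<sigma> :: "'m::finite \<Rightarrow> 'n::finite"
  assumes "bij \<sigma>"
  shows "distr lborel borel (reindex \<sigma>) = (lborel :: (real, 'm) vec measure)"
proof -
  have inv: "\<sigma> (inv \<sigma> j) = j" "inv \<sigma> (\<sigma> i) = i" for i j
    using assms by (auto simp: bij_is_inj bij_is_surj surj_f_inv_f)
  have meas: "reindex \<sigma> \<in> borel_measurable borel"
    by (intro borel_measurable_continuous_onI continuous_on_reindex)
  have "lborel = distr lborel borel (reindex \<sigma> :: (real, 'n) vec \<Rightarrow> (real, 'm) vec)"
  proof (rule lborel_eqI)
    fix l u :: "(real, 'm) vec" assume lu: "\<And>b. b \<in> Basis \<Longrightarrow> l \<bullet> b \<le> u \<bullet> b"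
    have le: "l $ i \<le> u $ i" for i using lu[of "axis i 1"] by (simp add: inner_axis axis_in_Basis_iff)
    have pre: "reindex \<sigma> -` box l u = box (reindex (inv \<sigma>) l) (reindex (inv \<sigma>) u)"
    proof (intro set_eqI)
      fix x :: "(real, 'n) vec"
      have "(\<forall>i. l $ i < x $ \<sigma> i \<and> x $ \<sigma> i < u $ i) \<longleftrightarrow> (\<forall>j. l $ inv \<sigma> j < x $ j \<and> x $ j < u $ inv \<sigma> j)"
        by (metis inv)
      then show "x \<in> reindex \<sigma> -` box l u \<longleftrightarrow> x \<in> box (reindex (inv \<sigma>) l) (reindex (inv \<sigma>) u)"
        by (simp add: mem_box_cart reindex_def)
    qed
    have "emeasure (distr lborel borel (reindex \<sigma>)) (box l u) = emeasure lborel (box (reindex (inv \<sigma>) l) (reindex (inv \<sigma>) u))"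
      using meas by (subst emeasure_distr) (simp_all add: pre)
    also have "\<dots> = ennreal (\<Prod>b\<in>Basis. (reindex (inv \<sigma>) u - reindex (inv \<sigma>) l) \<bullet> b)"
      using le by (intro emeasure_lborel_box) (auto simp: Basis_vec_def reindex_def inner_axis)
    also have "(\<Prod>b\<in>Basis. (reindex (inv \<sigma>) u - reindex (inv \<sigma>) l) \<bullet> b) = (\<Prod>j\<in>UNIV. (u - l) $ inv \<sigma> j)"
      unfolding prod_inner_Basis_vec by (simp add: reindex_def)
    also have "\<dots> = (\<Prod>b\<in>Basis. (u - l) \<bullet> b)"
      unfolding prod_inner_Basis_vec using bij_imp_bij_inv[OF assms] by (rule prod.reindex_bij_betw)
    finally show "emeasure (distr lborel borel (reindex \<sigma>)) (box l u) = ennreal (\<Prod>b\<in>Basis. (u - l) \<bullet> b)" .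
  qed simp
  then show ?thesis by simp
qed

lemma lebesgue_integral_reindex:
  fixes f :: "(real, 'm::finite) vec \<Rightarrow> real" and \<sigma> :: "'m \<Rightarrow> 'n::finite"
  assumes "bij \<sigma>" "continuous_on UNIV f"
  shows "(LINT x|lebesgue. f (reindex \<sigma> x)) = (LINT y|lebesgue. f y)"
proof -
  have f: "f \<in> borel_measurable borel" using assms(2) by (rule borel_measurable_continuous_onI)
  have r: "reindex \<sigma> \<in> borel_measurable borel"
    by (intro borel_measurable_continuous_onI continuous_on_reindex)
  have "(LINT x|lborel. f (reindex \<sigma> x)) = (LINT y|distr lborel borel (reindex \<sigma>). f y)"
    using f r by (subst integral_distr) auto
  also have "\<dots> = (LINT y|lborel. f y)" by (simp add: distr_reindex_lborel[OF assms(1)])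
  finally show ?thesis using f measurable_compose[OF r f] by (simp add: integral_completion)
qed

lemma trace_matrix: "trace (matrix G) = (\<Sum>i\<in>UNIV. G (axis i 1) $ i)"
  by (simp add: trace_def matrix_def)

text \<open>Renaming the coordinates preserves the norm, Lebesgue measure and the trace, so that the
  estimate for an Euler step holds for an arbitrary finite index type.\<close>

lemma near_identity_integral_le:
  assumes "e > 0" "K \<ge> 0"
  obtains \<delta> where "\<delta> > 0"
    "\<And>h g G R. \<And>u :: real^'n \<Rightarrow> real. \<bar>h\<bar> < \<delta> \<Longrightarrow> euler_step_data K g G u R \<Longrightarrow>
      (LINT x|lebesgue. (1 - h * trace (matrix (G x)) - e * \<bar>h\<bar>) * u (x - h *\<^sub>R g x)) \<le> (LINT x|lebesgue. u x)"
proof -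
  obtain \<sigma> :: "'n \<Rightarrow> 'n enumerated" where \<sigma>: "bij \<sigma>" using exists_bij_enumerated by blast
  define \<tau> where "\<tau> = inv \<sigma>"
  have \<tau>: "bij \<tau>" using \<sigma> bij_imp_bij_inv by (simp add: \<tau>_def)
  have st: "\<sigma> (\<tau> j) = j" "\<tau> (\<sigma> i) = i" for i j
    using \<sigma> by (auto simp: \<tau>_def bij_is_inj bij_is_surj surj_f_inv_f)
  define \<phi> :: "real^'n \<Rightarrow> (real, 'n enumerated) vec" where "\<phi> = reindex \<tau>"
  define \<psi> :: "(real, 'n enumerated) vec \<Rightarrow> real^'n" where "\<psi> = reindex \<sigma>"
  have inv: "\<phi> (\<psi> y) = y" "\<psi> (\<phi> x) = x" for x y
    by (auto simp: \<phi>_def \<psi>_def reindex_def vec_eq_iff st)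
  have lin: "linear \<phi>" "linear \<psi>" by (auto simp: \<phi>_def \<psi>_def linear_reindex)
  then have bl: "bounded_linear \<phi>" "bounded_linear \<psi>" by (auto simp: linear_conv_bounded_linear)
  have nrm: "norm (\<phi> x) = norm x" "norm (\<psi> y) = norm y" for x y
    using \<sigma> \<tau> by (auto simp: \<phi>_def \<psi>_def norm_reindex)
  have cont: "continuous_on S \<phi>" "continuous_on S' \<psi>" for S S'
    by (auto simp: \<phi>_def \<psi>_def continuous_on_reindex)
  show thesis
  proof (rule near_identity_integral_le_wellorder[OF assms, where 'n = "'n enumerated"])
  fix \<delta> :: real assume "\<delta> > 0" and \<delta>:
    "\<And>h g G R. \<And>u :: (real, 'n enumerated) vec \<Rightarrow> real. \<bar>h\<bar> < \<delta> \<Longrightarrow> euler_step_data K g G u R \<Longrightarrow>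
      (LINT x|lebesgue. (1 - h * trace (matrix (G x)) - e * \<bar>h\<bar>) * u (x - h *\<^sub>R g x)) \<le> (LINT x|lebesgue. u x)"
  show thesis
  proof (rule that[OF \<open>\<delta> > 0\<close>])
    fix h R :: real and g :: "real^'n \<Rightarrow> real^'n" and G and u :: "real^'n \<Rightarrow> real"
    assume h: "\<bar>h\<bar> < \<delta>" and "euler_step_data K g G u R"
    then have der: "\<And>x. (g has_derivative G x) (at x)"
      and lip: "\<And>x y. norm (g x - g y) \<le> K * norm (x - y)" and bd: "\<And>x. norm (g x) \<le> K"
      and w: "continuous_on UNIV (\<lambda>x. trace (matrix (G x)))"
      and u: "continuous_on UNIV u" "vanishes_outside R u" "\<And>x. 0 \<le> u x"
      by (auto simp: euler_step_data_def)
    have contg: "continuous_on UNIV g"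
      using has_derivative_continuous[OF der] by (simp add: continuous_on_eq_continuous_at)
    define g' where "g' = (\<lambda>y. \<phi> (g (\<psi> y)))"
    define G' where "G' = (\<lambda>y z. \<phi> (G (\<psi> y) (\<psi> z)))"
    define u' where "u' = (\<lambda>y. u (\<psi> y))"
    have der': "(g' has_derivative G' y) (at y)" for y
    proof -
      have 1: "(\<psi> has_derivative \<psi>) (at y)" using bl by (simp add: bounded_linear_imp_has_derivative)
      have 2: "((\<lambda>y. g (\<psi> y)) has_derivative (\<lambda>z. G (\<psi> y) (\<psi> z))) (at y)"
        by (rule has_derivative_compose[OF 1 der])
      show ?thesis unfolding g'_def G'_def by (rule bounded_linear.has_derivative[OF bl(1) 2])
    qed
    have lip': "norm (g' x - g' y) \<le> K * norm (x - y)" for x y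
      using lip[of "\<psi> x" "\<psi> y"] nrm
      by (simp add: g'_def linear_diff[OF lin(1), symmetric] linear_diff[OF lin(2), symmetric])
    have tr: "trace (matrix (G' y)) = trace (matrix (G (\<psi> y)))" for y
    proof -
      have "\<sigma> i = j \<longleftrightarrow> i = \<tau> j" for i j using st by metis
      then have ax: "\<psi> (axis j 1) = axis (\<tau> j) 1" for j
        by (simp add: \<psi>_def reindex_def vec_eq_iff axis_def)
      have "trace (matrix (G' y)) = (\<Sum>j\<in>UNIV. G (\<psi> y) (axis (\<tau> j) 1) $ \<tau> j)"
        by (simp add: trace_matrix G'_def ax) (simp add: \<phi>_def reindex_def)
      also have "\<dots> = (\<Sum>i\<in>UNIV. G (\<psi> y) (axis i 1) $ i)"
        using \<tau> by (rule sum.reindex_bij_betw)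
      finally show ?thesis by (simp add: trace_matrix)
    qed
    have "continuous_on UNIV (\<lambda>x. u (x - h *\<^sub>R g x))"
      by (rule continuous_on_compose2[OF u(1), of UNIV "\<lambda>x. x - h *\<^sub>R g x"]) (intro continuous_intros contg, auto)
    then have "continuous_on UNIV (\<lambda>x. (1 - h * trace (matrix (G x)) - e * \<bar>h\<bar>) * u (x - h *\<^sub>R g x))"
      by (intro continuous_intros w)
    from lebesgue_integral_reindex[OF \<sigma> this]
    have "(LINT x|lebesgue. (1 - h * trace (matrix (G x)) - e * \<bar>h\<bar>) * u (x - h *\<^sub>R g x))
        = (LINT y|lebesgue. (1 - h * trace (matrix (G (\<psi> y))) - e * \<bar>h\<bar>) * u (\<psi> y - h *\<^sub>R g (\<psi> y)))"
      unfolding \<psi>_def by simp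
    also have "\<dots> = (LINT y|lebesgue. (1 - h * trace (matrix (G' y)) - e * \<bar>h\<bar>) * u' (y - h *\<^sub>R g' y))"
      by (simp add: tr u'_def g'_def inv linear_diff[OF lin(2)] linear_cmul[OF lin(2)])
    also have "\<dots> \<le> (LINT y|lebesgue. u' y)"
    proof (rule \<delta>[OF h])
      have "norm (g' x) \<le> K" "0 \<le> u' x" for x using bd nrm u(3) by (simp_all add: g'_def u'_def)
      moreover have "continuous_on UNIV (\<lambda>x. trace (matrix (G' x)))"
        unfolding tr by (rule continuous_on_compose2[OF w cont(2)]) auto
      moreover have "continuous_on UNIV u'"
        unfolding u'_def by (rule continuous_on_compose2[OF u(1) cont(2)]) auto
      moreover have "vanishes_outside R u'" using u(2) nrm by (simp add: vanishes_outside_def u'_def)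
      ultimately show "euler_step_data K g' G' u' R"
        using der' lip' by (simp add: euler_step_data_def)
    qed
    also have "\<dots> = (LINT x|lebesgue. u x)"
      unfolding u'_def \<psi>_def by (rule lebesgue_integral_reindex[OF \<sigma> u(1)])
    finally show "(LINT x|lebesgue. (1 - h * trace (matrix (G x)) - e * \<bar>h\<bar>) * u (x - h *\<^sub>R g x)) \<le> (LINT x|lebesgue. u x)" .
  qed
  qed
qed

section \<open>Differential inequalities in one variable\<close>

lemma vector_derivative_bound:
  fixes f :: "real \<Rightarrow> 'a::real_normed_vector"
  assumes der: "\<And>\<tau>. \<tau> \<in> closed_segment s t \<Longrightarrow> (f has_vector_derivative f' \<tau>) (at \<tau> within closed_segment s t)"
    and bd: "\<And>\<tau>. \<tau> \<in> closed_segment s t \<Longrightarrow> norm (f' \<tau>) \<le> B"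
  shows "norm (f s - f t) \<le> B * \<bar>s - t\<bar>"
proof -
  have "norm (f s - f t) \<le> B * norm (s - t)"
  proof (rule differentiable_bound[where S = "closed_segment s t" and f' = "\<lambda>\<tau> h. h *\<^sub>R f' \<tau>"])
    fix \<tau> assume \<tau>: "\<tau> \<in> closed_segment s t"
    show "(f has_derivative (\<lambda>h. h *\<^sub>R f' \<tau>)) (at \<tau> within closed_segment s t)"
      using der[OF \<tau>] by (simp add: has_vector_derivative_def)
    show "onorm (\<lambda>h. h *\<^sub>R f' \<tau>) \<le> B"
    proof (rule onorm_le)
      fix h :: real
      show "norm (h *\<^sub>R f' \<tau>) \<le> B * norm h"
        using mult_left_mono[OF bd[OF \<tau>] abs_ge_zero[of h]] by (simp add: mult.commute)
    qed
  qed auto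
  then show ?thesis by simp
qed

text \<open>The function \<open>exp (c * \<tau>) * (norm (a \<tau> - b \<tau>))\<^sup>2\<close> is nonincreasing for \<open>c = - 2 * L\<close> and
  nondecreasing for \<open>c = 2 * L\<close>; this covers both directions of time.\<close>

lemma Gronwall_distance:
  fixes a b :: "real \<Rightarrow> 'a::real_inner"
  assumes a: "\<And>\<tau>. \<tau> \<in> {\<alpha>..\<beta>} \<Longrightarrow> (a has_vector_derivative a' \<tau>) (at \<tau>)"
    and b: "\<And>\<tau>. \<tau> \<in> {\<alpha>..\<beta>} \<Longrightarrow> (b has_vector_derivative b' \<tau>) (at \<tau>)"
    and L: "\<And>\<tau>. \<tau> \<in> {\<alpha>..\<beta>} \<Longrightarrow> norm (a' \<tau> - b' \<tau>) \<le> L * norm (a \<tau> - b \<tau>)"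
    and s: "s \<in> {\<alpha>..\<beta>}" and t: "t \<in> {\<alpha>..\<beta>}"
  shows "norm (a s - b s) \<le> exp (L * \<bar>s - t\<bar>) * norm (a t - b t)"
proof -
  define z where "z = (\<lambda>\<tau>. a \<tau> - b \<tau>)"
  define z' where "z' = (\<lambda>\<tau>. a' \<tau> - b' \<tau>)"
  have der: "((\<lambda>\<tau>. (z \<tau> \<bullet> z \<tau>) * exp (c * \<tau>)) has_real_derivative (2 * (z \<tau> \<bullet> z' \<tau>) + c * (z \<tau> \<bullet> z \<tau>)) * exp (c * \<tau>)) (at \<tau>)"
    if "\<tau> \<in> {\<alpha>..\<beta>}" for \<tau> c
  proof -
    have "(z has_derivative (\<lambda>h. h *\<^sub>R z' \<tau>)) (at \<tau>)"
      unfolding z_def z'_def using has_vector_derivative_diff[OF a[OF that] b[OF that]]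
      by (simp add: has_vector_derivative_def)
    from has_derivative_inner[OF this this]
    have "((\<lambda>\<tau>. z \<tau> \<bullet> z \<tau>) has_real_derivative 2 * (z \<tau> \<bullet> z' \<tau>)) (at \<tau>)"
      unfolding has_field_derivative_def by (rule has_derivative_eq_rhs) (auto simp: inner_commute fun_eq_iff)
    moreover have "((\<lambda>\<tau>. exp (c * \<tau>)) has_real_derivative exp (c * \<tau>) * c) (at \<tau>)"
      by (auto intro!: derivative_eq_intros)
    ultimately show ?thesis
      by (rule DERIV_cong[OF DERIV_mult]) (simp add: algebra_simps)
  qed
  have bd: "\<bar>2 * (z \<tau> \<bullet> z' \<tau>)\<bar> \<le> 2 * L * (z \<tau> \<bullet> z \<tau>)" if "\<tau> \<in> {\<alpha>..\<beta>}" for \<tau>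
  proof -
    have "\<bar>z \<tau> \<bullet> z' \<tau>\<bar> \<le> norm (z \<tau>) * norm (z' \<tau>)" by (rule Cauchy_Schwarz_ineq2)
    also have "\<dots> \<le> norm (z \<tau>) * (L * norm (z \<tau>))"
      using L[OF that] by (intro mult_left_mono) (auto simp: z_def z'_def)
    finally show ?thesis by (simp add: power2_norm_eq_inner[symmetric] power2_eq_square mult_ac)
  qed
  have "z s \<bullet> z s \<le> exp (2 * L * \<bar>s - t\<bar>) * (z t \<bullet> z t)"
  proof (cases "t \<le> s")
    case True
    have "(z s \<bullet> z s) * exp (- (2 * L) * s) \<le> (z t \<bullet> z t) * exp (- (2 * L) * t)"
    proof (rule DERIV_nonpos_imp_nonincreasing[OF True, of "\<lambda>\<tau>. (z \<tau> \<bullet> z \<tau>) * exp (- (2 * L) * \<tau>)"], goal_cases)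
      case (1 \<tau>)
      then have \<tau>: "\<tau> \<in> {\<alpha>..\<beta>}" using s t by auto
      have "(2 * (z \<tau> \<bullet> z' \<tau>) + - (2 * L) * (z \<tau> \<bullet> z \<tau>)) * exp (- (2 * L) * \<tau>) \<le> 0"
        using bd[OF \<tau>] by (intro mult_nonpos_nonneg) (auto simp: abs_le_iff)
      with der[OF \<tau>, of "- (2 * L)"] show ?case by blast
    qed
    then have "(z s \<bullet> z s) * exp (- (2 * L) * s) * exp (2 * L * s) \<le> (z t \<bullet> z t) * exp (- (2 * L) * t) * exp (2 * L * s)"
      by (rule mult_right_mono) simp
    then show ?thesis using True by (simp add: mult.assoc exp_add[symmetric] algebra_simps)
  next
    case False
    then have "s \<le> t" by simp
    have "(z s \<bullet> z s) * exp (2 * L * s) \<le> (z t \<bullet> z t) * exp (2 * L * t)"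
    proof (rule DERIV_nonneg_imp_nondecreasing[OF \<open>s \<le> t\<close>, of "\<lambda>\<tau>. (z \<tau> \<bullet> z \<tau>) * exp (2 * L * \<tau>)"], goal_cases)
      case (1 \<tau>)
      then have \<tau>: "\<tau> \<in> {\<alpha>..\<beta>}" using s t by auto
      have "0 \<le> (2 * (z \<tau> \<bullet> z' \<tau>) + 2 * L * (z \<tau> \<bullet> z \<tau>)) * exp (2 * L * \<tau>)"
        using bd[OF \<tau>] by (intro mult_nonneg_nonneg) (auto simp: abs_le_iff)
      with der[OF \<tau>, of "2 * L"] show ?case by blast
    qed
    then have "(z s \<bullet> z s) * exp (2 * L * s) * exp (- (2 * L * s)) \<le> (z t \<bullet> z t) * exp (2 * L * t) * exp (- (2 * L * s))"
      by (rule mult_right_mono) simp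
    then show ?thesis using False by (simp add: mult.assoc exp_add[symmetric] algebra_simps)
  qed
  also have "exp (2 * L * \<bar>s - t\<bar>) = (exp (L * \<bar>s - t\<bar>))\<^sup>2"
    by (simp add: exp_double[symmetric] mult.assoc)
  finally have "(norm (z s))\<^sup>2 \<le> (exp (L * \<bar>s - t\<bar>) * norm (z t))\<^sup>2"
    by (simp add: power2_norm_eq_inner power_mult_distrib)
  then show ?thesis unfolding z_def by (rule power2_le_imp_le) simp
qed

lemma divergence_eq_trace:
  assumes "(g has_derivative G) (at x)"
  shows "divergence g x = trace (matrix G)"
proof -
  have comp: "((\<lambda>y. g y $ j) has_derivative (\<lambda>h. G h $ j)) (at x)" for j
    by (rule bounded_linear.has_derivative[OF bounded_linear_vec_nth assms])
  show ?thesis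
    by (simp add: divergence_def trace_matrix has_derivative_imp_partial(2)[OF comp])
qed

text \<open>Cut the segment from \<open>t\<close> to \<open>s\<close> into equal steps shorter than \<open>\<delta>\<close>: the errors add up to
  \<open>e * \<bar>s - t\<bar>\<close>. The hypothesis is symmetric in \<open>s\<close> and \<open>t\<close>, so that \<open>\<Phi>\<close> is in fact constant on
  \<open>S\<close>, whichever of the two times comes first.\<close>

lemma locally_nonincreasing_imp_le:
  fixes \<Phi> :: "real \<Rightarrow> real"
  assumes S: "convex S" "s \<in> S" "t \<in> S"
    and loc: "\<And>e. e > 0 \<Longrightarrow> \<exists>\<delta>>0. \<forall>s\<in>S. \<forall>t\<in>S. \<bar>s - t\<bar> < \<delta> \<longrightarrow> \<Phi> s \<le> \<Phi> t + e * \<bar>s - t\<bar>"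
  shows "\<Phi> s \<le> \<Phi> t"
proof (rule field_le_epsilon)
  fix e' :: real assume "e' > 0"
  define e where "e = e' / (\<bar>s - t\<bar> + 1)"
  have e: "e > 0" "e * \<bar>s - t\<bar> \<le> e'" using \<open>e' > 0\<close> by (auto simp: e_def field_simps)
  from loc[OF e(1)] obtain \<delta> where "\<delta> > 0" and \<delta>: "\<And>s t. s \<in> S \<Longrightarrow> t \<in> S \<Longrightarrow> \<bar>s - t\<bar> < \<delta> \<Longrightarrow> \<Phi> s \<le> \<Phi> t + e * \<bar>s - t\<bar>"
    by blast
  obtain N :: nat where N: "\<bar>s - t\<bar> / \<delta> < real N" using reals_Archimedean2 by blast
  have Npos: "real N > 0" using N \<open>\<delta> > 0\<close> by (smt (verit) divide_nonneg_pos)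
  define p where "p = (\<lambda>k::nat. t + (real k / real N) * (s - t))"
  have pS: "p k \<in> S" if "k \<le> N" for k
  proof -
    have "p k = (1 - real k / real N) *\<^sub>R t + (real k / real N) *\<^sub>R s"
      by (simp add: p_def left_diff_distrib right_diff_distrib)
    then show ?thesis using S that Npos by (simp only:) (rule convexD, auto simp: field_simps)
  qed
  have diff: "\<bar>p (Suc k) - p k\<bar> = \<bar>s - t\<bar> / real N" for k
  proof -
    have "p (Suc k) - p k = (s - t) / real N" 
      by (simp add: p_def add_divide_distrib left_diff_distrib right_diff_distrib diff_divide_distrib distrib_right)
    then show ?thesis using Npos by (simp add: abs_divide)
  qed
  have "\<Phi> (p k) \<le> \<Phi> t + e * (real k * (\<bar>s - t\<bar> / real N))" if "k \<le> N" for k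
    using that
  proof (induction k)
    case 0
    then show ?case by (simp add: p_def)
  next
    case (Suc k)
    have "\<bar>p (Suc k) - p k\<bar> < \<delta>" unfolding diff using N Npos \<open>\<delta> > 0\<close> by (simp add: field_simps)
    then have "\<Phi> (p (Suc k)) \<le> \<Phi> (p k) + e * (\<bar>s - t\<bar> / real N)"
      using \<delta>[of "p (Suc k)" "p k"] pS Suc.prems by (simp add: diff)
    then show ?case using Suc by (simp add: algebra_simps add_divide_distrib)
  qed
  from this[of N] have "\<Phi> s \<le> \<Phi> t + e * \<bar>s - t\<bar>" using Npos by (simp add: p_def)
  then show "\<Phi> s \<le> \<Phi> t + e'" using e(2) by linarith
qed

lemma exp_minus_le_quadratic:
  fixes p :: real
  assumes "\<bar>p\<bar> \<le> 1"
  shows "exp (- p) \<le> 1 - p + p\<^sup>2"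
proof (cases "p \<le> 0")
  case True
  then show ?thesis using exp_bound[of "- p"] assms by simp
next
  case False
  then have p: "p > 0" by simp
  have "exp (- p) \<le> 1 / (1 + p)"
    using exp_ge_add_one_self[of p] p by (simp add: exp_minus field_simps)
  also have "\<dots> \<le> 1 - p + p\<^sup>2"
  proof -
    have "(1 - p + p\<^sup>2) * (1 + p) = 1 + p ^ 3" by (simp add: algebra_simps power2_eq_square power3_eq_cube)
    then have "1 \<le> (1 - p + p\<^sup>2) * (1 + p)" using p by simp
    then show ?thesis using p by (simp add: pos_divide_le_eq)
  qed
  finally show ?thesis .
qed

lemma exp_Lipschitz:
  fixes p q :: real
  assumes "\<bar>p\<bar> \<le> B" "\<bar>q\<bar> \<le> B"
  shows "\<bar>exp p - exp q\<bar> \<le> exp B * \<bar>p - q\<bar>"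
proof -
  have "norm (exp p - exp q) \<le> exp B * norm (p - q)"
    by (rule field_differentiable_bound[where S = "{-B..B}" and f' = exp])
      (use assms in \<open>auto intro: DERIV_subset[OF DERIV_exp]\<close>)
  then show ?thesis by simp
qed

section \<open>Mass of Lipschitz densities along a flow\<close>

text \<open>The dependence on time enters only through \<open>d\<close>, which is the \<open>L\<^sup>1\<close> distance of the states of
  the system at the two times when the locale is applied. Then the field and its divergence are
  Lipschitz in the pair formed by the position and the state, while in time they are merely
  continuous.\<close>

locale regular_flow =
  fixes v :: "real \<Rightarrow> real^'n \<Rightarrow> real^'n" and D :: "real \<Rightarrow> real^'n \<Rightarrow> real^'n \<Rightarrow> real^'n"
    and X :: "real \<Rightarrow> real \<Rightarrow> real^'n \<Rightarrow> real^'n" and d :: "real \<Rightarrow> real \<Rightarrow> real" and T K :: real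
  assumes flow: "characteristics UNIV v X"
    and T: "T \<ge> 0" and K: "K \<ge> 0"
    and der: "\<And>t x. t \<in> {-T..T} \<Longrightarrow> (v t has_derivative D t x) (at x)"
    and v_bd: "\<And>t x. t \<in> {-T..T} \<Longrightarrow> norm (v t x) \<le> K"
    and v_lip: "\<And>t s x y. t \<in> {-T..T} \<Longrightarrow> s \<in> {-T..T} \<Longrightarrow> norm (v t x - v s y) \<le> K * (norm (x - y) + d t s)"
    and div_bd: "\<And>t x. t \<in> {-T..T} \<Longrightarrow> \<bar>divergence (v t) x\<bar> \<le> K"
    and div_lip: "\<And>t s x y. t \<in> {-T..T} \<Longrightarrow> s \<in> {-T..T} \<Longrightarrow>
      \<bar>divergence (v t) x - divergence (v s) y\<bar> \<le> K * (norm (x - y) + d t s)"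
    and d_refl: "\<And>t. d t t = 0"
    and d_unif: "\<And>e. e > 0 \<Longrightarrow> \<exists>\<delta>>0. \<forall>t\<in>{-T..T}. \<forall>s\<in>{-T..T}. \<bar>t - s\<bar> < \<delta> \<longrightarrow> d t s < e"
begin

lemma segment_in: "s \<in> {-T..T} \<Longrightarrow> t \<in> {-T..T} \<Longrightarrow> \<tau> \<in> closed_segment s t \<Longrightarrow> \<tau> \<in> {-T..T}"
  by (auto simp: closed_segment_eq_real_ivl split: if_splits)

lemma zero_in: "0 \<in> {-T..T}"
  using T by auto

abbreviation div_along :: "real \<Rightarrow> real^'n \<Rightarrow> real \<Rightarrow> real" where
  "div_along t x \<tau> \<equiv> divergence (v \<tau>) (X \<tau> t x)"

lemma X_init: "X t t x = x"
  using flow by (simp add: characteristics_def)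

lemma X_der: "((\<lambda>s. X s t x) has_vector_derivative v s (X s t x)) (at s)"
  using flow by (simp add: characteristics_def)

lemma X_closeness:
  assumes "\<tau> \<in> {-T..T}" "s \<in> {-T..T}"
  shows "norm (X \<tau> t x - X \<tau> t' y) \<le> exp (2 * K * T) * norm (X s t x - X s t' y)"
proof -
  have "norm (X \<tau> t x - X \<tau> t' y) \<le> exp (K * \<bar>\<tau> - s\<bar>) * norm (X s t x - X s t' y)"
  proof (rule Gronwall_distance[where \<alpha> = "-T" and \<beta> = T, OF X_der X_der _ assms])
    fix \<sigma> assume "\<sigma> \<in> {-T..T}"
    from v_lip[OF this this, of "X \<sigma> t x" "X \<sigma> t' y"]
    show "norm (v \<sigma> (X \<sigma> t x) - v \<sigma> (X \<sigma> t' y)) \<le> K * norm (X \<sigma> t x - X \<sigma> t' y)"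
      by (simp add: d_refl)
  qed
  also have "\<dots> \<le> exp (2 * K * T) * norm (X s t x - X s t' y)"
  proof (rule mult_right_mono)
    have "K * \<bar>\<tau> - s\<bar> \<le> K * (2 * T)" using assms K by (intro mult_left_mono) auto
    then show "exp (K * \<bar>\<tau> - s\<bar>) \<le> exp (2 * K * T)" by (simp add: mult_ac)
  qed simp
  finally show ?thesis .
qed

lemma X_Lipschitz:
  assumes "\<tau> \<in> {-T..T}" "t \<in> {-T..T}"
  shows "norm (X \<tau> t x - X \<tau> t y) \<le> exp (2 * K * T) * norm (x - y)"
  using X_closeness[OF assms, of t x t y] by (simp add: X_init)

lemma X_semigroup:
  assumes "\<tau> \<in> {-T..T}" "s \<in> {-T..T}"
  shows "X \<tau> s (X s t x) = X \<tau> t x"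
  using X_closeness[OF assms, of s "X s t x" t x] by (simp add: X_init)

lemma X_displacement:
  assumes "s \<in> {-T..T}" "s' \<in> {-T..T}"
  shows "norm (X s t x - X s' t x) \<le> K * \<bar>s - s'\<bar>"
  by (rule vector_derivative_bound[of s s' "\<lambda>s. X s t x" "\<lambda>s. v s (X s t x)",
        OF has_vector_derivative_at_within[OF X_der] v_bd[OF segment_in[OF assms]]])

lemma modulus:
  assumes "e > 0"
  obtains \<delta> where "\<delta> > 0" "\<And>t s. t \<in> {-T..T} \<Longrightarrow> s \<in> {-T..T} \<Longrightarrow> \<bar>t - s\<bar> < \<delta> \<Longrightarrow> K * (K * \<bar>t - s\<bar> + d t s) \<le> e"
proof -
  define e' where "e' = e / (2 * (K + 1))"
  have e': "e' > 0" "2 * (K * e') \<le> e" using assms K by (auto simp: e'_def field_simps)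
  obtain \<delta> where "\<delta> > 0" and \<delta>: "\<And>t s. t \<in> {-T..T} \<Longrightarrow> s \<in> {-T..T} \<Longrightarrow> \<bar>t - s\<bar> < \<delta> \<Longrightarrow> d t s < e'"
    using d_unif[OF e'(1)] by blast
  show thesis
  proof (rule that[of "min \<delta> (e' / (K + 1))"])
    show "0 < min \<delta> (e' / (K + 1))" using \<open>\<delta> > 0\<close> e' K by simp
    fix t s assume ts: "t \<in> {-T..T}" "s \<in> {-T..T}" "\<bar>t - s\<bar> < min \<delta> (e' / (K + 1))"
    have "(K + 1) * \<bar>t - s\<bar> < e'" using ts(3) K by (simp add: field_simps)
    then have "K * \<bar>t - s\<bar> \<le> e'" by (simp add: algebra_simps)
    moreover have "d t s \<le> e'" using \<delta>[of t s] ts by simp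
    ultimately have "K * (K * \<bar>t - s\<bar> + d t s) \<le> K * (e' + e')" using K by (intro mult_left_mono add_mono) auto
    then show "K * (K * \<bar>t - s\<bar> + d t s) \<le> e" using e'(2) by simp
  qed
qed

lemma v_along_modulus:
  assumes "\<tau> \<in> {-T..T}" "s \<in> {-T..T}"
  shows "norm (v \<tau> (X \<tau> t x) - v s (X s t x)) \<le> K * (K * \<bar>\<tau> - s\<bar> + d \<tau> s)"
    and "\<bar>div_along t x \<tau> - div_along t x s\<bar> \<le> K * (K * \<bar>\<tau> - s\<bar> + d \<tau> s)"
proof -
  have "K * (norm (X \<tau> t x - X s t x) + d \<tau> s) \<le> K * (K * \<bar>\<tau> - s\<bar> + d \<tau> s)"
    using X_displacement[OF assms] K by (intro mult_left_mono add_right_mono) auto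
  then show "norm (v \<tau> (X \<tau> t x) - v s (X s t x)) \<le> K * (K * \<bar>\<tau> - s\<bar> + d \<tau> s)"
    "\<bar>div_along t x \<tau> - div_along t x s\<bar> \<le> K * (K * \<bar>\<tau> - s\<bar> + d \<tau> s)"
    using v_lip[OF assms] div_lip[OF assms] order_trans by blast+
qed

text \<open>The exponent of the Lagrangian formula. All its estimates follow from its derivative, given by
  the fundamental theorem of calculus, which treats positive and negative times alike.\<close>

definition expansion :: "real \<Rightarrow> real^'n \<Rightarrow> real \<Rightarrow> real" where
  "expansion t x \<tau> = (LBINT \<sigma>=ereal 0..ereal \<tau>. div_along t x \<sigma>)"

lemma continuous_div_along: "continuous_on {-T..T} (div_along t x)"
  unfolding continuous_on_iff
proof (intro ballI allI impI)
  fix s e :: real assume s: "s \<in> {-T..T}" and "e > 0"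
  then obtain \<delta> where "\<delta> > 0" and \<delta>: "\<And>t s. t \<in> {-T..T} \<Longrightarrow> s \<in> {-T..T} \<Longrightarrow> \<bar>t - s\<bar> < \<delta> \<Longrightarrow> K * (K * \<bar>t - s\<bar> + d t s) \<le> e / 2"
    using modulus[of "e / 2"] by (metis half_gt_zero)
  show "\<exists>\<delta>>0. \<forall>\<tau>\<in>{-T..T}. dist \<tau> s < \<delta> \<longrightarrow> dist (div_along t x \<tau>) (div_along t x s) < e"
  proof (intro exI[of _ \<delta>] conjI \<open>\<delta> > 0\<close> ballI impI)
    fix \<tau> assume \<tau>: "\<tau> \<in> {-T..T}" "dist \<tau> s < \<delta>"
    then show "dist (div_along t x \<tau>) (div_along t x s) < e"
      using \<delta>[OF \<tau>(1) s] v_along_modulus(2)[OF \<tau>(1) s, of t x] \<open>e > 0\<close> by (simp add: dist_real_def)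
  qed
qed

lemma expansion_0: "expansion t x 0 = 0"
  by (simp add: expansion_def)

lemma expansion_der:
  assumes "\<tau> \<in> {-T..T}"
  shows "(expansion t x has_vector_derivative div_along t x \<tau>) (at \<tau> within {-T..T})"
proof -
  have "((\<lambda>\<tau>. LBINT \<sigma>=ereal 0..ereal \<tau>. div_along t x \<sigma>) has_vector_derivative
      div_along t x \<tau>) (at \<tau> within {-T..T})"
    by (rule interval_integral_FTC2[where f = "div_along t x", OF _ _ continuous_div_along])
      (use T assms in auto)
  then show ?thesis unfolding expansion_def[abs_def] .
qed

lemma expansion_der_segment:
  assumes "s \<in> {-T..T}" "s' \<in> {-T..T}" "\<tau> \<in> closed_segment s s'"
  shows "(expansion t x has_vector_derivative div_along t x \<tau>) (at \<tau> within closed_segment s s')"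
  by (rule has_vector_derivative_within_subset[OF expansion_der[OF segment_in[OF assms]]])
    (rule subsetI, rule segment_in[OF assms(1,2)])

lemma expansion_bound:
  assumes "\<tau> \<in> {-T..T}"
  shows "\<bar>expansion t x \<tau>\<bar> \<le> K * T"
proof -
  have "norm (expansion t x \<tau> - expansion t x 0) \<le> K * \<bar>\<tau> - 0\<bar>"
    by (rule vector_derivative_bound[where f = "expansion t x" and f' = "div_along t x"])
      (use div_bd[OF segment_in[OF assms zero_in]] expansion_der_segment[OF assms zero_in] in simp_all)
  also have "\<dots> \<le> K * T" using assms K by (intro mult_left_mono) auto
  finally show ?thesis by (simp add: expansion_0)
qed

lemma expansion_Lipschitz:
  assumes "\<tau> \<in> {-T..T}" "t \<in> {-T..T}"
  shows "\<bar>expansion t x \<tau> - expansion t y \<tau>\<bar> \<le> K * exp (2 * K * T) * T * norm (x - y)"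
proof -
  let ?g = "\<lambda>\<tau>. expansion t x \<tau> - expansion t y \<tau>"
  have "norm (?g \<tau> - ?g 0) \<le> K * (exp (2 * K * T) * norm (x - y)) * \<bar>\<tau> - 0\<bar>"
  proof (rule vector_derivative_bound[where f = ?g and f' = "\<lambda>\<sigma>. div_along t x \<sigma> - div_along t y \<sigma>"])
    fix \<sigma> assume \<sigma>: "\<sigma> \<in> closed_segment \<tau> 0"
    show "(?g has_vector_derivative (div_along t x \<sigma> - div_along t y \<sigma>)) (at \<sigma> within closed_segment \<tau> 0)"
      by (rule has_vector_derivative_diff[OF expansion_der_segment[OF assms(1) zero_in \<sigma>] expansion_der_segment[OF assms(1) zero_in \<sigma>]])
    have \<sigma>': "\<sigma> \<in> {-T..T}" using segment_in[OF assms(1) zero_in \<sigma>] .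
    have "\<bar>div_along t x \<sigma> - div_along t y \<sigma>\<bar> \<le> K * norm (X \<sigma> t x - X \<sigma> t y)"
      using div_lip[OF \<sigma>' \<sigma>', of "X \<sigma> t x" "X \<sigma> t y"] by (simp add: d_refl)
    also have "\<dots> \<le> K * (exp (2 * K * T) * norm (x - y))"
      using X_Lipschitz[OF \<sigma>' assms(2)] K by (intro mult_left_mono) auto
    finally show "norm (div_along t x \<sigma> - div_along t y \<sigma>) \<le> K * (exp (2 * K * T) * norm (x - y))" by simp
  qed
  also have "\<dots> \<le> K * (exp (2 * K * T) * norm (x - y)) * T"
    using assms K by (intro mult_left_mono) auto
  finally show ?thesis by (simp add: expansion_0 mult_ac)
qed

lemma expansion_semigroup:
  assumes "\<tau> \<in> {-T..T}" "s \<in> {-T..T}"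
  shows "expansion s (X s t x) \<tau> = expansion t x \<tau>"
proof -
  let ?g = "\<lambda>\<tau>. expansion s (X s t x) \<tau> - expansion t x \<tau>"
  have "norm (?g \<tau> - ?g 0) \<le> 0 * \<bar>\<tau> - 0\<bar>"
  proof (rule vector_derivative_bound[where f = ?g and f' = "\<lambda>\<sigma>. div_along s (X s t x) \<sigma> - div_along t x \<sigma>"])
    fix \<sigma> assume \<sigma>: "\<sigma> \<in> closed_segment \<tau> 0"
    show "(?g has_vector_derivative (div_along s (X s t x) \<sigma> - div_along t x \<sigma>)) (at \<sigma> within closed_segment \<tau> 0)"
      by (rule has_vector_derivative_diff[OF expansion_der_segment[OF assms(1) zero_in \<sigma>] expansion_der_segment[OF assms(1) zero_in \<sigma>]])
    show "norm (div_along s (X s t x) \<sigma> - div_along t x \<sigma>) \<le> 0"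
      using X_semigroup[OF segment_in[OF assms(1) zero_in \<sigma>] assms(2)] by simp
  qed
  then show ?thesis by (simp add: expansion_0)
qed

text \<open>The Lagrangian solution with datum \<open>f\<close> at time \<open>0\<close>.\<close>

definition transported :: "(real^'n \<Rightarrow> real) \<Rightarrow> real \<Rightarrow> real^'n \<Rightarrow> real" where
  "transported f t x = f (X 0 t x) * exp (- expansion t x t)"

lemma transported_step:
  assumes "s \<in> {-T..T}" "t \<in> {-T..T}"
  shows "transported f s x = transported f t (X t s x) * exp (- (expansion s x s - expansion s x t))"
  using assms zero_in by (simp add: transported_def X_semigroup expansion_semigroup exp_add[symmetric] mult.assoc)

lemma transported_0: "transported f 0 x = f x"
  by (simp add: transported_def X_init expansion_0)

context
  fixes f :: "real^'n \<Rightarrow> real" and F R :: real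
  assumes f_bd: "\<And>x. 0 \<le> f x" "\<And>x. f x \<le> F"
    and f_lip: "\<And>x y. \<bar>f x - f y\<bar> \<le> F * norm (x - y)"
    and f_van: "vanishes_outside R f"
begin

lemma F_nonneg: "F \<ge> 0"
  using f_bd[of 0] by linarith

lemma transported_nonneg: "0 \<le> transported f t x"
  using f_bd by (simp add: transported_def)

lemma transported_bound:
  assumes "t \<in> {-T..T}"
  shows "transported f t x \<le> F * exp (K * T)"
  unfolding transported_def using f_bd expansion_bound[OF assms, of t x] F_nonneg
  by (intro mult_mono) (auto simp: abs_le_iff)

text \<open>The constant does not depend on \<open>t\<close>: this is what makes the error of one time step
  small compared with the step. It uses that the divergence is Lipschitz in space.\<close>

lemma transported_Lipschitz:
  obtains C where "C \<ge> 0" "\<And>t x y. t \<in> {-T..T} \<Longrightarrow> \<bar>transported f t x - transported f t y\<bar> \<le> C * norm (x - y)"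
proof
  let ?E = "exp (2 * K * T)" and ?M = "exp (K * T)"
  let ?C = "F * ?E * ?M + F * (?M * (K * ?E * T))"
  show "?C \<ge> 0" using F_nonneg K T by simp
  fix t x y assume t: "t \<in> {-T..T}"
  let ?p = "- expansion t x t" and ?q = "- expansion t y t"
  have "transported f t x - transported f t y = (f (X 0 t x) - f (X 0 t y)) * exp ?p + f (X 0 t y) * (exp ?p - exp ?q)"
    by (simp add: transported_def algebra_simps)
  then have "\<bar>transported f t x - transported f t y\<bar> \<le> \<bar>f (X 0 t x) - f (X 0 t y)\<bar> * exp ?p + f (X 0 t y) * \<bar>exp ?p - exp ?q\<bar>"
    using abs_triangle_ineq[of "(f (X 0 t x) - f (X 0 t y)) * exp ?p" "f (X 0 t y) * (exp ?p - exp ?q)"] f_bd(1)[of "X 0 t y"]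
    by (simp add: abs_mult)
  also have "\<dots> \<le> (F * (?E * norm (x - y))) * ?M + F * (?M * (K * ?E * T * norm (x - y)))"
  proof (intro add_mono mult_mono)
    show "\<bar>f (X 0 t x) - f (X 0 t y)\<bar> \<le> F * (?E * norm (x - y))"
      using f_lip[of "X 0 t x" "X 0 t y"] mult_left_mono[OF X_Lipschitz[OF zero_in t, of x y] F_nonneg] by linarith
    show "exp ?p \<le> ?M" using expansion_bound[OF t, of t x] by (simp add: abs_le_iff)
    have "\<bar>exp ?p - exp ?q\<bar> \<le> ?M * \<bar>?p - ?q\<bar>"
      using expansion_bound[OF t, of t] by (intro exp_Lipschitz) simp_all
    also have "\<dots> \<le> ?M * (K * ?E * T * norm (x - y))"
      using expansion_Lipschitz[OF t t, of x y] by (intro mult_left_mono) auto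
    finally show "\<bar>exp ?p - exp ?q\<bar> \<le> ?M * (K * ?E * T * norm (x - y))" .
  qed (use f_bd F_nonneg K T in auto)
  also have "\<dots> = ?C * norm (x - y)" by (simp add: algebra_simps)
  finally show "\<bar>transported f t x - transported f t y\<bar> \<le> ?C * norm (x - y)" .
qed

lemma continuous_transported:
  assumes "t \<in> {-T..T}"
  shows "continuous_on UNIV (transported f t)"
proof -
  obtain C where "\<And>x y. \<bar>transported f t x - transported f t y\<bar> \<le> C * norm (x - y)"
    using transported_Lipschitz assms by metis
  then show ?thesis by (intro Lipschitz_imp_continuous[of _ C]) simp
qed

lemma transported_vanishes:
  assumes "t \<in> {-T..T}"
  shows "vanishes_outside (R + K * T) (transported f t)"
  unfolding vanishes_outside_def
proof (intro allI impI)
  fix x :: "real^'n" assume x: "R + K * T < norm x"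
  have "norm (x - X 0 t x) \<le> K * \<bar>t - 0\<bar>" using X_displacement[OF assms zero_in, of t x] by (simp add: X_init)
  also have "\<dots> \<le> K * T" using assms K by (intro mult_left_mono) auto
  finally have "R < norm (X 0 t x)" using x norm_triangle_ineq2[of x "X 0 t x"] by linarith
  then show "transported f t x = 0" using f_van by (simp add: transported_def vanishes_outside_def)
qed

lemma integrable_transported: "t \<in> {-T..T} \<Longrightarrow> integrable lebesgue (transported f t)"
  by (rule continuous_vanishes_imp_integrable[OF continuous_transported transported_vanishes])

text \<open>The exact flow from time \<open>s\<close> to time \<open>t\<close> differs from the Euler step
  \<open>x \<mapsto> x - (s - t) *\<^sub>R v s x\<close> by \<open>o(s - t)\<close>, uniformly in \<open>x\<close>. Likewise the exponential weight
  differs from \<open>1 - (s - t) * divergence (v s) x\<close>, which is the Jacobian of the Euler step up to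
  \<open>o(s - t)\<close>. Hence the mass at time \<open>s\<close> exceeds the mass at time \<open>t\<close> by at most \<open>o(s - t)\<close>.\<close>

lemma transported_one_step:
  assumes "e > 0"
  shows "\<exists>\<delta>>0. \<forall>s\<in>{-T..T}. \<forall>t\<in>{-T..T}. \<bar>s - t\<bar> < \<delta> \<longrightarrow>
    (LINT x|lebesgue. transported f s x) \<le> (LINT x|lebesgue. transported f t x) + e * \<bar>s - t\<bar>"
proof -
  obtain C where C: "C \<ge> 0" "\<And>t x y. t \<in> {-T..T} \<Longrightarrow> \<bar>transported f t x - transported f t y\<bar> \<le> C * norm (x - y)"
    using transported_Lipschitz by metis
  define U where "U = F * exp (K * T)"
  have U: "U \<ge> 0" "\<And>t x. t \<in> {-T..T} \<Longrightarrow> transported f t x \<le> U"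
    using F_nonneg transported_bound by (auto simp: U_def)
  define \<rho> where "\<rho> = R + K * T"
  define V where "V = measure lebesgue (cball (0::real^'n) \<rho>)"
  have V: "V \<ge> 0" by (simp add: V_def)
  \<comment> \<open>The errors of the Jacobian, of the exponent and of the linearized exponential are each at
    most \<open>\<theta> * \<bar>h\<bar>\<close> and multiply a density bounded by \<open>U\<close>. The error of the position has the same size,
    costs the Lipschitz constant \<open>C\<close> and multiplies an exponential bounded by \<open>3\<close>. Integrated over
    a ball of volume \<open>V\<close> the sum must stay below \<open>e * \<bar>h\<bar>\<close>.\<close>
  define M where "M = 3 * (U + C) * (V + 1) + 1"
  have M: "M \<ge> 1" using U C V by (simp add: M_def)
  define \<theta> where "\<theta> = min 1 (e / M)"
  have \<theta>: "\<theta> > 0" "\<theta> \<le> 1" "\<theta> * M \<le> e" using assms M by (auto simp: \<theta>_def min_def field_simps)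
  obtain \<delta>1 where "\<delta>1 > 0" and \<delta>1: "\<And>t s. t \<in> {-T..T} \<Longrightarrow> s \<in> {-T..T} \<Longrightarrow> \<bar>t - s\<bar> < \<delta>1 \<Longrightarrow> K * (K * \<bar>t - s\<bar> + d t s) \<le> \<theta>"
    using modulus[OF \<theta>(1)] by blast
  show ?thesis
  proof (rule near_identity_integral_le[OF \<theta>(1) K, where 'n = 'n])
    fix \<delta>2 :: real assume "\<delta>2 > 0" and \<delta>2:
      "\<And>h g G R. \<And>u :: real^'n \<Rightarrow> real. \<bar>h\<bar> < \<delta>2 \<Longrightarrow> euler_step_data K g G u R \<Longrightarrow>
        (LINT x|lebesgue. (1 - h * trace (matrix (G x)) - \<theta> * \<bar>h\<bar>) * u (x - h *\<^sub>R g x)) \<le> (LINT x|lebesgue. u x)"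
    define \<delta> where "\<delta> = Min {\<delta>1, \<delta>2, \<theta> / (K + 1)\<^sup>2}"
    have "\<delta> > 0" using \<open>\<delta>1 > 0\<close> \<open>\<delta>2 > 0\<close> \<theta> K by (simp add: \<delta>_def)
    show ?thesis
    proof (intro exI[of _ \<delta>] conjI \<open>\<delta> > 0\<close> ballI impI)
      fix s t assume s: "s \<in> {-T..T}" and t: "t \<in> {-T..T}" and st: "\<bar>s - t\<bar> < \<delta>"
      define h where "h = s - t"
      have h: "\<bar>h\<bar> < \<delta>1" "\<bar>h\<bar> < \<delta>2" "(K + 1)\<^sup>2 * \<bar>h\<bar> \<le> \<theta>"
        using st K by (auto simp: \<delta>_def h_def field_simps)
      have hK: "(K + 1) * \<bar>h\<bar> \<le> \<theta>"
      proof -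
        have "(K + 1) * \<bar>h\<bar> \<le> (K + 1)\<^sup>2 * \<bar>h\<bar>" using K by (intro mult_right_mono) (auto simp: power2_eq_square)
        then show ?thesis using h(3) by linarith
      qed
      define q where "q = (\<lambda>x. 1 - h * divergence (v s) x - \<theta> * \<bar>h\<bar>)"
      define P where "P = (\<lambda>x. x - h *\<^sub>R v s x)"
      define u where "u = transported f t"
      \<comment> \<open>The left side bounds the variation, from time \<open>\<tau>\<close> to time \<open>s\<close> along a trajectory, of both
      the velocity and the divergence.\<close>
      have near: "K * (K * \<bar>\<tau> - s\<bar> + d \<tau> s) \<le> \<theta>" if "\<tau> \<in> closed_segment t s" for \<tau>
      proof -
        have "\<bar>\<tau> - s\<bar> \<le> \<bar>h\<bar>" using that by (auto simp: h_def closed_segment_eq_real_ivl split: if_splits)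
        then show ?thesis using \<delta>1[OF segment_in[OF t s that] s] h(1) by simp
      qed
      have pos: "norm (X t s x - P x) \<le> \<theta> * \<bar>h\<bar>" for x
      proof -
        have "norm (X t s x - X s s x - (t - s) *\<^sub>R v s (X s s x)) \<le> norm (t - s) * \<theta>"
          by (rule vector_differentiable_bound_linearization[where S = "closed_segment s t" and a = s and b = t
              and ?x0.0 = s and f = "\<lambda>\<tau>. X \<tau> s x" and f' = "\<lambda>\<tau>. v \<tau> (X \<tau> s x)"])
            (use order_trans[OF v_along_modulus(1)[OF segment_in[OF t s] s] near] in
              \<open>simp_all add: closed_segment_commute has_vector_derivative_at_within[OF X_der]\<close>)
        moreover have "X t s x - X s s x - (t - s) *\<^sub>R v s (X s s x) = X t s x - P x"
          by (simp add: X_init P_def h_def algebra_simps)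
        ultimately show ?thesis by (simp add: h_def abs_minus_commute mult.commute)
      qed
      have expn: "\<bar>expansion s x s - expansion s x t - h * divergence (v s) x\<bar> \<le> \<theta> * \<bar>h\<bar>" for x
      proof -
        have "norm (expansion s x t - expansion s x s - (t - s) *\<^sub>R div_along s x s) \<le> norm (t - s) * \<theta>"
          by (rule vector_differentiable_bound_linearization[where S = "closed_segment s t" and a = s and b = t
              and ?x0.0 = s and f = "expansion s x" and f' = "div_along s x"])
            (use order_trans[OF v_along_modulus(2)[OF segment_in[OF t s] s] near] expansion_der_segment[OF t s] in
              \<open>simp_all add: closed_segment_commute\<close>)
        moreover have "norm (expansion s x t - expansion s x s - (t - s) *\<^sub>R div_along s x s)
            = \<bar>expansion s x s - expansion s x t - h * divergence (v s) x\<bar>"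
          by (simp add: X_init h_def abs_if algebra_simps)
        ultimately show ?thesis by (simp add: h_def abs_minus_commute mult.commute)
      qed
      \<comment> \<open>Outside the ball the left side vanishes, and the right side is nonnegative because \<open>q\<close> is
      for small steps. Inside it the errors are collected.\<close>
      have qu: "transported f s x \<le> q x * u (P x) + indicator (cball 0 \<rho>) x * (3 * (U + C) * \<theta> * \<bar>h\<bar>)" for x
      proof (cases "norm x \<le> \<rho>")
        case False
        have "\<bar>h * divergence (v s) x\<bar> \<le> \<bar>h\<bar> * K"
          unfolding abs_mult using div_bd[OF s] by (intro mult_left_mono) auto
        moreover have "\<theta> * \<bar>h\<bar> \<le> \<bar>h\<bar>" using \<theta> by (simp add: mult_left_le_one_le)
        ultimately have "q x \<ge> 0" using hK \<theta> by (simp add: q_def algebra_simps abs_le_iff)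
        moreover have "transported f s x = 0"
          using transported_vanishes[OF s] False by (simp add: vanishes_outside_def \<rho>_def)
        ultimately show ?thesis using False transported_nonneg by (simp add: u_def)
      next
        case True
        define p where "p = expansion s x s - expansion s x t"
        have "norm p \<le> K * \<bar>s - t\<bar>"
          unfolding p_def
          by (rule vector_derivative_bound[where f = "expansion s x" and f' = "div_along s x"])
            (use div_bd[OF segment_in[OF s t]] expansion_der_segment[OF s t] in simp_all)
        then have p: "\<bar>p\<bar> \<le> K * \<bar>h\<bar>" by (simp add: h_def)
        have p1: "\<bar>p\<bar> \<le> 1" using p hK \<theta> by (simp add: algebra_simps)
        have "p\<^sup>2 \<le> (K * \<bar>h\<bar>)\<^sup>2" using p by (simp add: power2_le_iff_abs_le K)
        also have "\<dots> \<le> (K + 1)\<^sup>2 * \<bar>h\<bar> * \<bar>h\<bar>"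
        proof -
          have "K\<^sup>2 \<le> (K + 1)\<^sup>2" using K by (intro power_mono) auto
          then have "K\<^sup>2 * (\<bar>h\<bar> * \<bar>h\<bar>) \<le> (K + 1)\<^sup>2 * (\<bar>h\<bar> * \<bar>h\<bar>)" by (rule mult_right_mono) simp
          then show ?thesis
            unfolding power_mult_distrib power2_eq_square[of "\<bar>h\<bar>"] mult.assoc .
        qed
        also have "\<dots> \<le> \<theta> * \<bar>h\<bar>" using h(3) by (intro mult_right_mono) auto
        finally have p2: "p\<^sup>2 \<le> \<theta> * \<bar>h\<bar>" .
        have expq: "exp (- p) \<le> q x + 3 * \<theta> * \<bar>h\<bar>"
          using exp_minus_le_quadratic[OF p1] p2 expn[of x] by (simp add: q_def p_def[symmetric] abs_le_iff)
        have exp3: "exp (- p) \<le> 3"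
          using p1 exp_le order_trans[of "exp (- p)" "exp 1" 3] by (simp add: abs_le_iff)
        have "transported f s x = u (X t s x) * exp (- p)"
          unfolding u_def p_def by (rule transported_step[OF s t])
        also have "\<dots> \<le> (u (P x) + C * (\<theta> * \<bar>h\<bar>)) * exp (- p)"
        proof (rule mult_right_mono)
          have "\<bar>u (X t s x) - u (P x)\<bar> \<le> C * (\<theta> * \<bar>h\<bar>)"
            unfolding u_def using C(2)[OF t, of "X t s x" "P x"] mult_left_mono[OF pos[of x] C(1)] by linarith
          then show "u (X t s x) \<le> u (P x) + C * (\<theta> * \<bar>h\<bar>)" by linarith
        qed simp
        also have "\<dots> = u (P x) * exp (- p) + C * (\<theta> * \<bar>h\<bar>) * exp (- p)" by (simp add: algebra_simps)
        also have "\<dots> \<le> u (P x) * (q x + 3 * \<theta> * \<bar>h\<bar>) + C * (\<theta> * \<bar>h\<bar>) * 3"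
          using expq exp3 C \<theta> transported_nonneg by (intro add_mono mult_left_mono) (auto simp: u_def)
        also have "\<dots> \<le> q x * u (P x) + 3 * (U + C) * \<theta> * \<bar>h\<bar>"
        proof -
          have "u (P x) * (3 * \<theta> * \<bar>h\<bar>) \<le> U * (3 * \<theta> * \<bar>h\<bar>)"
            using U(2)[OF t, of "P x"] \<theta> unfolding u_def by (intro mult_right_mono) auto
          then show ?thesis by (simp add: algebra_simps)
        qed
        finally show ?thesis using True by simp
      qed
      have lip: "norm (v s x - v s y) \<le> K * norm (x - y)" for x y
        using v_lip[OF s s, of x y] by (simp add: d_refl)
      have tr: "trace (matrix (D s x)) = divergence (v s) x" for x
        using divergence_eq_trace[OF der[OF s]] by simp
      have cdiv: "continuous_on UNIV (divergence (v s))"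
        using div_lip[OF s s] by (intro Lipschitz_imp_continuous[of _ K]) (simp add: d_refl)
      have cv: "continuous_on UNIV (v s)"
        using has_derivative_continuous[OF der[OF s]] by (simp add: continuous_on_eq_continuous_at)
      have cq: "continuous_on UNIV q" unfolding q_def by (intro continuous_intros cdiv)
      have iq: "integrable lebesgue (\<lambda>x. q x * u (P x))"
        unfolding P_def u_def
        by (rule integrable_compose_displacement[OF continuous_transported[OF t] transported_vanishes[OF t] cq cv v_bd[OF s]])
      have "(LINT x|lebesgue. transported f s x)
          \<le> (LINT x|lebesgue. q x * u (P x) + indicator (cball 0 \<rho>) x * (3 * (U + C) * \<theta> * \<bar>h\<bar>))"
        by (intro integral_mono integrable_transported[OF s] Bochner_Integration.integrable_add iq integrable_indicator_cball qu)
      also have "\<dots> = (LINT x|lebesgue. q x * u (P x)) + V * (3 * (U + C) * \<theta> * \<bar>h\<bar>)"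
        by (subst Bochner_Integration.integral_add[OF iq integrable_indicator_cball]) (simp add: V_def)
      also have "(LINT x|lebesgue. q x * u (P x)) \<le> (LINT x|lebesgue. u x)"
      proof -
        have "euler_step_data K (v s) (D s) u (R + K * T)"
          unfolding euler_step_data_def u_def tr
          using der[OF s] lip v_bd[OF s] cdiv continuous_transported[OF t] transported_vanishes[OF t]
            transported_nonneg by blast
        from \<delta>2[OF h(2) this] show ?thesis by (simp add: tr q_def P_def)
      qed
      also have "V * (3 * (U + C) * \<theta> * \<bar>h\<bar>) \<le> e * \<bar>h\<bar>"
      proof -
        have "V * (3 * (U + C)) \<le> M" using U C V by (simp add: M_def algebra_simps)
        then have "\<theta> * (V * (3 * (U + C))) \<le> e" using \<theta> mult_left_mono[of "V * (3 * (U + C))" M \<theta>] by linarith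
        then have "\<theta> * (V * (3 * (U + C))) * \<bar>h\<bar> \<le> e * \<bar>h\<bar>" by (rule mult_right_mono) simp
        then show ?thesis by (simp add: mult_ac)
      qed
      finally show "(LINT x|lebesgue. transported f s x) \<le> (LINT x|lebesgue. transported f t x) + e * \<bar>s - t\<bar>"
        by (simp add: u_def h_def)
    qed
  qed
qed

lemma integral_transported_le:
  assumes "t \<in> {-T..T}"
  shows "(LINT x|lebesgue. transported f t x) \<le> (LINT x|lebesgue. f x)"
proof -
  have "(LINT x|lebesgue. transported f t x) \<le> (LINT x|lebesgue. transported f 0 x)"
    by (rule locally_nonincreasing_imp_le[where \<Phi> = "\<lambda>t. LINT x|lebesgue. transported f t x", OF _ assms zero_in])
      (auto intro: transported_one_step)
  then show ?thesis by (simp add: transported_0)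
qed

end

end

section \<open>Mass of integrable densities along a flow\<close>

text \<open>The distance to the complement of \<open>U \<inter> ball 0 n\<close>, multiplied by \<open>n\<close> and cut at \<open>1\<close>.\<close>

lemma open_indicator_Lipschitz_approx:
  fixes U :: "'a::euclidean_space set"
  assumes "open U"
  obtains f :: "nat \<Rightarrow> 'a \<Rightarrow> real" where
    "\<And>n x. 0 \<le> f n x" "\<And>n x. f n x \<le> indicator U x" "\<And>n x y. \<bar>f n x - f n y\<bar> \<le> real n * norm (x - y)"
    "\<And>n. vanishes_outside (real n) (f n)" "\<And>x. (\<lambda>n. f n x) \<longlonglongrightarrow> indicator U x"
proof
  define C where "C = (\<lambda>n::nat. - (U \<inter> ball 0 (real n)))"
  have ne: "C n \<noteq> {}" for n
  proof -
    obtain x :: 'a where "norm x = real n" using vector_choose_size[of "real n"] by auto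
    then have "x \<in> C n" by (simp add: C_def)
    then show ?thesis by blast
  qed
  define f where "f = (\<lambda>n x. min 1 (real n * infdist x (C n)))"
  show "0 \<le> f n x" for n x by (simp add: f_def infdist_nonneg)
  have zero: "f n x = 0" if "x \<in> C n" for n x using that by (simp add: f_def)
  show "f n x \<le> indicator U x" for n x
    using zero[of x n] by (cases "x \<in> U") (auto simp: f_def C_def)
  show "vanishes_outside (real n) (f n)" for n
    unfolding vanishes_outside_def by (intro allI impI zero) (auto simp: C_def)
  show "\<bar>f n x - f n y\<bar> \<le> real n * norm (x - y)" for n x y
  proof -
    have "\<bar>infdist x (C n) - infdist y (C n)\<bar> \<le> dist x y" by (rule infdist_triangle_abs)
    then have "\<bar>real n * infdist x (C n) - real n * infdist y (C n)\<bar> \<le> real n * norm (x - y)"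
      unfolding right_diff_distrib[symmetric] abs_mult by (simp add: dist_norm mult_left_mono)
    then show ?thesis by (simp add: f_def min_def abs_if split: if_splits)
  qed
  show "(\<lambda>n. f n x) \<longlonglongrightarrow> indicator U x" for x
  proof (cases "x \<in> U")
    case False
    then have "f n x = 0" for n by (intro zero) (simp add: C_def)
    then show ?thesis using False by simp
  next
    case True
    then obtain r where r: "r > 0" "ball x r \<subseteq> U" using assms open_contains_ball by blast
    have "eventually (\<lambda>n. f n x = 1) sequentially"
    proof (rule eventually_mono)
      show "eventually (\<lambda>n. real n \<ge> max (norm x + r) (1 / r)) sequentially"
        using eventually_ge_at_top[of "nat \<lceil>max (norm x + r) (1 / r)\<rceil>"]
        by (rule eventually_mono) linarith
      fix n assume n: "real n \<ge> max (norm x + r) (1 / r)"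
      have "r \<le> infdist x (C n)"
        unfolding infdist_notempty[OF ne]
      proof (rule cINF_greatest[OF ne])
        fix y assume "y \<in> C n"
        then have "y \<notin> U \<or> real n \<le> norm y" by (auto simp: C_def not_less)
        then show "r \<le> dist x y"
        proof
          assume "y \<notin> U"
          then have "y \<notin> ball x r" using r by blast
          then show ?thesis by simp
        next
          assume "real n \<le> norm y"
          then have "r \<le> norm y - norm x" using n by simp
          also have "\<dots> \<le> norm (y - x)" by (rule norm_triangle_ineq2)
          finally show ?thesis by (simp add: dist_norm norm_minus_commute)
        qed
      qed
      then have "real n * r \<le> real n * infdist x (C n)" by (intro mult_left_mono) auto
      moreover have "1 \<le> real n * r" using n r by (simp add: pos_divide_le_eq)
      ultimately show "f n x = 1" by (simp add: f_def)
    qed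
    then show ?thesis using True by (simp add: tendsto_eventually)
  qed
qed

context regular_flow
begin

context
  fixes t :: real
  assumes t: "t \<in> {-T..T}"
begin

lemma continuous_X0: "continuous_on UNIV (X 0 t)"
  using X_Lipschitz[OF zero_in t] by (rule Lipschitz_imp_continuous)

lemma continuous_density: "continuous_on UNIV (\<lambda>x. exp (- expansion t x t))"
proof -
  have "continuous_on UNIV (\<lambda>x. expansion t x t)"
    using expansion_Lipschitz[OF t t] by (intro Lipschitz_imp_continuous) simp
  then show ?thesis by (intro continuous_intros)
qed

lemma measurable_X0 [measurable]: "X 0 t \<in> borel_measurable borel"
  by (rule borel_measurable_continuous_onI[OF continuous_X0])

lemma measurable_density [measurable]: "(\<lambda>x. exp (- expansion t x t)) \<in> borel_measurable borel"
  by (rule borel_measurable_continuous_onI[OF continuous_density])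

text \<open>The inequality for the mass of Lipschitz densities says that this measure is below Lebesgue
  measure. It is proved for open sets, then for Borel sets by outer regularity, and so for all
  nonnegative measurable densities.\<close>

definition pushforward :: "(real^'n) measure" where
  "pushforward = distr (density lborel (\<lambda>x. ennreal (exp (- expansion t x t)))) borel (X 0 t)"

lemma emeasure_pushforward:
  assumes "A \<in> sets borel"
  shows "emeasure pushforward A = (\<integral>\<^sup>+x. ennreal (indicator A (X 0 t x) * exp (- expansion t x t)) \<partial>lborel)"
proof -
  have "emeasure pushforward A = emeasure (density lborel (\<lambda>x. ennreal (exp (- expansion t x t)))) (X 0 t -` A)"
    unfolding pushforward_def using assms by (subst emeasure_distr) auto
  also have "\<dots> = (\<integral>\<^sup>+x. ennreal (exp (- expansion t x t)) * indicator (X 0 t -` A) x \<partial>lborel)"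
    using measurable_sets_borel[OF measurable_X0 assms] by (intro emeasure_density) auto
  also have "\<dots> = (\<integral>\<^sup>+x. ennreal (indicator A (X 0 t x) * exp (- expansion t x t)) \<partial>lborel)"
    by (intro nn_integral_cong) (auto simp: indicator_def)
  finally show ?thesis .
qed

lemma pushforward_open_le:
  assumes "open U"
  shows "emeasure pushforward U \<le> emeasure lborel U"
proof -
  obtain f where f: "\<And>n x. 0 \<le> f n x" "\<And>n x. f n x \<le> indicator U x"
    "\<And>n x y. \<bar>f n x - f n y\<bar> \<le> real n * norm (x - y)"
    "\<And>n. vanishes_outside (real n) (f n :: real^'n \<Rightarrow> real)" "\<And>x. (\<lambda>n. f n x) \<longlonglongrightarrow> indicator U x"
    using open_indicator_Lipschitz_approx[OF assms] by blast
  have step: "(\<integral>\<^sup>+x. ennreal (transported (f n) t x) \<partial>lborel) \<le> emeasure lborel U" for n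
  proof -
    have F: "f n x \<le> real (Suc n)" "\<bar>f n x - f n y\<bar> \<le> real (Suc n) * norm (x - y)" for x y
    proof -
      show "f n x \<le> real (Suc n)" using f(2)[of n x] by (cases "x \<in> U") auto
      show "\<bar>f n x - f n y\<bar> \<le> real (Suc n) * norm (x - y)"
        using f(3)[of n x y] mult_right_mono[of "real n" "real (Suc n)" "norm (x - y)"] by simp
    qed
    note facts = f(1) F f(4)
    have cont: "continuous_on UNIV (f n)"
      using f(3)[of n] by (intro Lipschitz_imp_continuous[of _ "real n"]) simp
    have meas: "f n \<in> borel_measurable borel" "transported (f n) t \<in> borel_measurable borel"
      by (rule borel_measurable_continuous_onI[OF cont])
        (rule borel_measurable_continuous_onI[OF continuous_transported[OF facts t]])
    have int: "integrable lborel (f n)" "integrable lborel (transported (f n) t)"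
      using continuous_vanishes_imp_integrable[OF cont f(4)] integrable_transported[OF facts t] meas
      by (simp_all add: integrable_completion)
    have "(LINT x|lborel. transported (f n) t x) \<le> (LINT x|lborel. f n x)"
      using integral_transported_le[OF facts t] meas by (simp add: integral_completion)
    moreover have "(\<integral>\<^sup>+x. ennreal (transported (f n) t x) \<partial>lborel) = ennreal (LINT x|lborel. transported (f n) t x)"
      using int transported_nonneg[OF facts] by (intro nn_integral_eq_integral) auto
    moreover have "(\<integral>\<^sup>+x. ennreal (f n x) \<partial>lborel) = ennreal (LINT x|lborel. f n x)"
      using int f(1) by (intro nn_integral_eq_integral) auto
    moreover have "(\<integral>\<^sup>+x. ennreal (f n x) \<partial>lborel) \<le> (\<integral>\<^sup>+x. indicator U x \<partial>lborel)"
      using ennreal_leI[OF f(2)] by (intro nn_integral_mono) (simp add: ennreal_indicator)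
    moreover have "(\<integral>\<^sup>+x. indicator U x \<partial>lborel) = emeasure lborel U"
      using assms by simp
    ultimately show ?thesis using ennreal_leI order_trans by fastforce
  qed
  have meas: "transported (f n) t \<in> borel_measurable borel" for n
  proof -
    have "continuous_on UNIV (f n)"
      using f(3)[of n] by (intro Lipschitz_imp_continuous[of _ "real n"]) simp
    then have "f n \<in> borel_measurable borel" by (rule borel_measurable_continuous_onI)
    then show ?thesis unfolding transported_def by measurable
  qed
  have "emeasure pushforward U = (\<integral>\<^sup>+x. liminf (\<lambda>n. ennreal (transported (f n) t x)) \<partial>lborel)"
    unfolding emeasure_pushforward[OF borel_open[OF assms]]
  proof (intro nn_integral_cong)
    fix x
    have "(\<lambda>n. transported (f n) t x) \<longlonglongrightarrow> indicator U (X 0 t x) * exp (- expansion t x t)"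
      unfolding transported_def by (intro tendsto_mult tendsto_const f(5))
    then have "(\<lambda>n. ennreal (transported (f n) t x)) \<longlonglongrightarrow> ennreal (indicator U (X 0 t x) * exp (- expansion t x t))"
      by (intro tendsto_ennrealI)
    then show "ennreal (indicator U (X 0 t x) * exp (- expansion t x t)) = liminf (\<lambda>n. ennreal (transported (f n) t x))"
      using lim_imp_Liminf[OF sequentially_bot] by metis
  qed
  also have "\<dots> \<le> liminf (\<lambda>n. \<integral>\<^sup>+x. ennreal (transported (f n) t x) \<partial>lborel)"
    using meas by (intro nn_integral_liminf) simp
  also have "\<dots> \<le> emeasure lborel U"
  proof -
    have "liminf (\<lambda>n. \<integral>\<^sup>+x. ennreal (transported (f n) t x) \<partial>lborel) \<le> liminf (\<lambda>n::nat. emeasure lborel U)"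
      using step by (intro Liminf_mono) simp
    then show ?thesis by (simp add: Liminf_const)
  qed
  finally show ?thesis .
qed

lemma pushforward_le:
  assumes "A \<in> sets borel"
  shows "emeasure pushforward A \<le> emeasure lborel A"
proof (rule ennreal_le_epsilon)
  fix e :: real assume "e > 0"
  have "A \<in> sets lebesgue" using assms by simp
  then obtain U where U: "open U" "A \<subseteq> U" "emeasure lebesgue (U - A) < ennreal e"
    using sets_lebesgue_outer_open[OF _ \<open>e > 0\<close>] by metis
  have sp: "sets pushforward = sets borel" by (simp add: pushforward_def)
  have "emeasure pushforward A \<le> emeasure pushforward U"
    using U by (intro emeasure_mono) (auto simp: sp)
  also have "\<dots> \<le> emeasure lborel U" by (rule pushforward_open_le[OF U(1)])
  also have "\<dots> = emeasure lborel (A \<union> (U - A))" using U(2) by (simp add: Un_absorb1)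
  also have "\<dots> \<le> emeasure lborel A + emeasure lborel (U - A)"
    using assms U(1) by (intro emeasure_subadditive) auto
  also have "\<dots> \<le> emeasure lborel A + ennreal e"
    using U assms by (intro add_left_mono) (simp add: less_imp_le)
  finally show "emeasure pushforward A \<le> emeasure lborel A + ennreal e" .
qed

text \<open>The density of the measure that is pushed forward is positive, so that the preimage of a null
  set under \<open>X 0 t\<close> is null. In particular composition with \<open>X 0 t\<close> respects equality almost
  everywhere.\<close>

lemma AE_compose_X0:
  assumes "AE y in lebesgue. P y"
  shows "AE x in lebesgue. P (X 0 t x)"
proof -
  obtain N where N: "N \<in> null_sets lborel" "\<And>y. y \<notin> N \<Longrightarrow> P y"
    using assms unfolding AE_completion_iff by (auto elim!: AE_E3)
  then have b: "N \<in> sets borel" by auto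
  have "emeasure pushforward N = 0"
    using pushforward_le[OF b] N by (simp add: null_sets_def)
  then have "AE x in lborel. ennreal (indicator N (X 0 t x) * exp (- expansion t x t)) = 0"
    unfolding emeasure_pushforward[OF b] using b by (subst (asm) nn_integral_0_iff_AE) auto
  then have "AE x in lborel. X 0 t x \<notin> N"
    by eventually_elim (auto simp: indicator_def ennreal_eq_0_iff split: if_splits)
  then have "AE x in lebesgue. X 0 t x \<notin> N" by (rule AE_completion)
  then show ?thesis by eventually_elim (rule N(2))
qed

text \<open>The datum \<open>h\<close> is only Lebesgue measurable; a Borel representative is pushed forward instead.\<close>

lemma L1_norm_transported_le:
  fixes h u :: "real^'n \<Rightarrow> real"
  assumes h: "integrable lebesgue h" and u: "integrable lebesgue u"
    and eq: "AE x in lebesgue. u x = transported h t x"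
  shows "L1_norm u \<le> L1_norm h"
proof -
  obtain h' where h': "h' \<in> borel_measurable lborel" "AE x in lborel. h x = h' x"
    using completion_ex_borel_measurable_real[OF borel_measurable_integrable[OF h]]
    by (rule bexE) (rule that)
  have eq': "AE x in lebesgue. \<bar>u x\<bar> = \<bar>h' (X 0 t x)\<bar> * exp (- expansion t x t)"
    using eq AE_compose_X0[OF AE_completion[OF h'(2)]]
    by eventually_elim (simp add: transported_def abs_mult)
  have "ennreal (L1_norm u) = (\<integral>\<^sup>+x. ennreal \<bar>u x\<bar> \<partial>lebesgue)"
    unfolding L1_norm_def using u by (subst nn_integral_eq_integral) auto
  also have "\<dots> = (\<integral>\<^sup>+x. ennreal (\<bar>h' (X 0 t x)\<bar> * exp (- expansion t x t)) \<partial>lebesgue)"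
    using eq' by (intro nn_integral_cong_AE) (auto elim: eventually_mono)
  also have "\<dots> = (\<integral>\<^sup>+x. ennreal (exp (- expansion t x t)) * ennreal \<bar>h' (X 0 t x)\<bar> \<partial>lborel)"
    using h' by (subst nn_integral_completion) (auto simp: ennreal_mult' mult.commute)
  also have "\<dots> = (\<integral>\<^sup>+y. ennreal \<bar>h' y\<bar> \<partial>pushforward)"
    unfolding pushforward_def using h'(1)
    by (subst nn_integral_distr, simp, simp, subst nn_integral_density) auto
  also have "\<dots> \<le> (\<integral>\<^sup>+y. ennreal \<bar>h' y\<bar> \<partial>lborel)"
  proof (rule nn_integral_mono_measure)
    show "sets pushforward = sets lborel" by (simp add: pushforward_def)
    then show "pushforward \<le> lborel" using pushforward_le by (subst le_measure) auto
  qed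
  also have "\<dots> = (\<integral>\<^sup>+y. ennreal \<bar>h' y\<bar> \<partial>lebesgue)"
    using h'(1) by (subst nn_integral_completion) auto
  also have "\<dots> = (\<integral>\<^sup>+y. ennreal \<bar>h y\<bar> \<partial>lebesgue)"
    using AE_completion[OF h'(2)] by (intro nn_integral_cong_AE) (auto elim: eventually_mono)
  also have "\<dots> = ennreal (L1_norm h)"
    unfolding L1_norm_def using h by (subst nn_integral_eq_integral) auto
  finally show ?thesis by (simp add: L1_norm_def integral_nonneg_AE)
qed

end

end

section \<open>The nonlinearity\<close>

lemma Linf_norm_nonneg: "0 \<le> Linf_norm (f :: 'a::euclidean_space \<Rightarrow> 'b::real_normed_vector)"
proof -
  have "0 = esssup lebesgue (\<lambda>_::'a. 0::ereal)" by (simp add: esssup_const)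
  also have "\<dots> \<le> Linf_norm f" unfolding Linf_norm_def by (rule esssup_mono) auto
  finally show ?thesis .
qed

lemma Linf_norm_le_imp_bound:
  fixes f :: "'a::euclidean_space \<Rightarrow> 'b::real_normed_vector"
  assumes "continuous_on UNIV f" "Linf_norm f \<le> ereal c"
  shows "norm (f x) \<le> c"
proof (rule continuous_AE_le_imp_le[where f = "\<lambda>x. norm (f x)"])
  show "continuous_on UNIV (\<lambda>x. norm (f x))" using assms(1) by (rule continuous_on_norm)
  have "AE x in lebesgue. ereal (norm (f x)) \<le> Linf_norm f" unfolding Linf_norm_def by (rule esssup_AE)
  then show "AE x in lebesgue. norm (f x) \<le> c"
    by eventually_elim (use assms(2) order_trans in fastforce)
qed

lemma W1inf_norm_le_imp_bounds:
  fixes u :: "real^'m^'n \<Rightarrow> 'b::real_normed_vector"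
  assumes "W1inf_norm u \<le> ereal c" "continuous_on UNIV u" "continuous_on UNIV (total_deriv u)"
  shows "norm (u A) \<le> c" "norm (total_deriv u A) \<le> c"
proof -
  have "Linf_norm u \<le> W1inf_norm u" "Linf_norm (total_deriv u) \<le> W1inf_norm u"
    unfolding W1inf_norm_def using Linf_norm_nonneg by (auto intro: ereal_le_add_self ereal_le_add_self2)
  then show "norm (u A) \<le> c" "norm (total_deriv u A) \<le> c"
    using assms Linf_norm_le_imp_bound order_trans by blast+
qed

lemma has_derivative_vecI:
  fixes F :: "'a::real_normed_vector \<Rightarrow> 'c::euclidean_space ^ 'm"
  assumes "\<And>k. ((\<lambda>x. F x $ k) has_derivative (\<lambda>h. F' h $ k)) (at x within S)"
  shows "(F has_derivative F') (at x within S)"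
proof (subst has_derivative_componentwise_within, intro ballI)
  fix e :: "'c^'m" assume "e \<in> Basis"
  then obtain k c where e: "e = axis k c" by (auto simp: Basis_vec_def)
  show "((\<lambda>x. F x \<bullet> e) has_derivative (\<lambda>h. F' h \<bullet> e)) (at x within S)"
    unfolding e inner_axis by (rule has_derivative_inner_left[OF assms])
qed

lemma sum_Basis_matrix: "(\<Sum>b\<in>(Basis :: (real^'m^'n) set). \<phi> b) = (\<Sum>k\<in>UNIV. \<Sum>l\<in>UNIV. \<phi> (axis k (axis l 1)))"
proof -
  have B: "(Basis :: (real^'m^'n) set) = (\<lambda>(k, l). axis k (axis l 1)) ` (UNIV \<times> UNIV)"
    by (auto simp: Basis_vec_def)
  have "inj_on (\<lambda>(k, l). axis k (axis l 1) :: real^'m^'n) (UNIV \<times> UNIV)"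
    by (auto simp: inj_on_def axis_eq_axis)
  then show ?thesis
    unfolding B by (subst sum.reindex) (simp_all add: sum.cartesian_product case_prod_unfold)
qed

lemma axis_axis_in_Basis: "axis k (axis l 1) \<in> (Basis :: (real^'m^'n) set)"
  by (auto simp: Basis_vec_def)

lemma continuous_total_deriv:
  assumes "C_k (Suc k) F"
  shows "continuous_on UNIV (total_deriv F)"
  unfolding total_deriv_def[abs_def]
  using assms by (intro continuous_on_vec_lambda) (auto intro: C_k_continuous axis_axis_in_Basis)

text \<open>The total derivative is an array of partial derivatives, and arrays are differentiated entry
  by entry.\<close>

lemma partial_total_deriv:
  fixes V :: "real^'m^'n \<Rightarrow> 'b::euclidean_space"
  assumes V: "C_k 2 V" and b: "b \<in> Basis"
  shows "partial b (total_deriv V) A = (\<chi> k l. partial b (partial (axis k (axis l 1)) V) A)"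
proof -
  let ?D = "\<lambda>k l. partial (axis k (axis l 1)) V"
  have "C_k (Suc 0) (?D k l)" for k l
    using V axis_axis_in_Basis[of k l] by (simp add: numeral_2_eq_2)
  then have "partial_diff b (?D k l) x" for k l x using b by simp
  from partial_has_vector_derivative[OF this, where y = A and s = 0]
  have der: "((\<lambda>s. ?D k l (A + s *\<^sub>R b)) has_derivative (\<lambda>s. s *\<^sub>R partial b (?D k l) A)) (at 0)" for k l
    by (simp add: has_vector_derivative_def)
  have "((\<lambda>s. total_deriv V (A + s *\<^sub>R b)) has_derivative (\<lambda>s. s *\<^sub>R (\<chi> k l. partial b (?D k l) A))) (at 0)"
    unfolding total_deriv_def by (intro has_derivative_vecI) (simp add: der)
  then show ?thesis
    unfolding partial_def[of b "total_deriv V"] by (intro vector_derivative_at) (simp add: has_vector_derivative_def)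
qed

lemma norm_component_component_le: "norm (M $ k $ l) \<le> norm M"
  by (rule order_trans[OF Finite_Cartesian_Product.norm_nth_le Finite_Cartesian_Product.norm_nth_le])

text \<open>The essential bounds on the first and second derivatives hold at every point by continuity.\<close>

lemma assumption_V_bounds:
  fixes V :: "real^'m^'n \<Rightarrow> real^'m^'n"
  assumes "assumption_V L V"
  shows "0 \<le> L" "C_k 2 V" "V 0 = 0" "norm (total_deriv V A) \<le> L"
    "b \<in> Basis \<Longrightarrow> b' \<in> Basis \<Longrightarrow> norm (partial b (partial b' V) A) \<le> L"
proof -
  show L: "0 \<le> L" and V: "C_k 2 V" and "V 0 = 0" using assms by (auto simp: assumption_V_def)
  have V2: "C_k (Suc (Suc 0)) V" using V by (simp add: numeral_2_eq_2)
  have cont2: "continuous_on UNIV (total_deriv (total_deriv V))"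
    unfolding total_deriv_def[of "total_deriv V", abs_def]
  proof (intro continuous_on_vec_lambda)
    fix k :: 'n and l :: 'm
    have eq: "partial (axis k (axis l 1)) (total_deriv V) = (\<lambda>A. \<chi> k' l'. partial (axis k (axis l 1)) (partial (axis k' (axis l' 1)) V) A)"
      using partial_total_deriv[OF V axis_axis_in_Basis] by auto
    show "continuous_on UNIV (\<lambda>A. partial (axis k (axis l 1)) (total_deriv V) A)"
      unfolding eq using V2 by (intro continuous_on_vec_lambda) (simp add: axis_axis_in_Basis)
  qed
  have W: "W1inf_norm (total_deriv V) \<le> ereal L" using assms by (simp add: assumption_V_def)
  note bounds = W1inf_norm_le_imp_bounds[OF W continuous_total_deriv[OF V2] cont2]
  show "norm (total_deriv V A) \<le> L" by (rule bounds(1))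
  assume b: "b \<in> Basis" "b' \<in> Basis"
  from b obtain k l k' l' where kl: "b = axis k (axis l 1)" "b' = axis k' (axis l' 1)"
    by (auto simp: Basis_vec_def)
  have "partial b (partial b' V) A = total_deriv (total_deriv V) A $ k $ l $ k' $ l'"
    using partial_total_deriv[OF V b(1)] by (simp add: total_deriv_def[of "total_deriv V"] kl)
  also have "norm \<dots> \<le> norm (total_deriv (total_deriv V) A)"
    by (rule order_trans[OF norm_component_component_le norm_component_component_le])
  also have "\<dots> \<le> L" by (rule bounds(2))
  finally show "norm (partial b (partial b' V) A) \<le> L" .
qed

lemma norm_matrix_eq_L2_Basis:
  fixes M :: "'b::real_normed_vector ^'m^'n"
  assumes "\<And>k l. M $ k $ l = \<phi> (axis k (axis l 1))"
  shows "norm M = L2_set (\<lambda>b. norm (\<phi> b)) (Basis :: (real^'m^'n) set)"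
proof -
  have "norm M = sqrt (\<Sum>k\<in>UNIV. \<Sum>l\<in>UNIV. (norm (M $ k $ l))\<^sup>2)"
    by (simp add: norm_vec_def L2_set_def sum_nonneg)
  then show ?thesis by (simp add: L2_set_def sum_Basis_matrix assms)
qed

text \<open>By the Cauchy-Schwarz inequality the Euclidean norm of the array of partial derivatives bounds
  the operator norm of the derivative, so that the Lipschitz constant is \<open>L\<close> itself. A larger
  constant would spoil the speed of propagation.\<close>

lemma assumption_V_Lipschitz:
  fixes V :: "real^'m^'n \<Rightarrow> real^'m^'n"
  assumes "assumption_V L V"
  shows "norm (V A - V B) \<le> L * norm (A - B)"
proof (rule differentiable_bound[where S = UNIV and f' = "\<lambda>A h. \<Sum>b\<in>Basis. (h \<bullet> b) *\<^sub>R partial b V A"])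
  note V = assumption_V_bounds[OF assms]
  have V2: "C_k (Suc (Suc 0)) V" using V(2) by (simp add: numeral_2_eq_2)
  fix A
  show "(V has_derivative (\<lambda>h. \<Sum>b\<in>Basis. (h \<bullet> b) *\<^sub>R partial b V A)) (at A within UNIV)"
    using C_k_has_derivative[OF V2] by simp
  show "onorm (\<lambda>h. \<Sum>b\<in>Basis. (h \<bullet> b) *\<^sub>R partial b V A) \<le> L"
  proof (rule onorm_le)
    fix h :: "real^'m^'n"
    have "norm (\<Sum>b\<in>Basis. (h \<bullet> b) *\<^sub>R partial b V A) \<le> (\<Sum>b\<in>Basis. \<bar>h \<bullet> b\<bar> * \<bar>norm (partial b V A)\<bar>)"
      by (rule sum_norm_le) simp
    also have "\<dots> \<le> L2_set (\<lambda>b. h \<bullet> b) Basis * L2_set (\<lambda>b. norm (partial b V A)) Basis"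
      by (rule L2_set_mult_ineq)
    also have "L2_set (\<lambda>b. norm (partial b V A)) Basis = norm (total_deriv V A)"
      by (rule norm_matrix_eq_L2_Basis[symmetric]) (simp add: total_deriv_def)
    also have "L2_set (\<lambda>b. h \<bullet> b) Basis = norm h"
      using euclidean_dist_l2[of h 0] by (simp add: dist_norm L2_set_def)
    also have "norm h * norm (total_deriv V A) \<le> norm h * L"
      using V(4) by (intro mult_left_mono) auto
    finally show "norm (\<Sum>b\<in>Basis. (h \<bullet> b) *\<^sub>R partial b V A) \<le> L * norm h" by (simp add: mult.commute)
  qed
qed auto

section \<open>Bounded fields that are Lipschitz in position and state\<close>

text \<open>The regularity demanded from each component of a field in \<open>regular_flow\<close>. As a class of bounded
  Lipschitz functions it is closed under sums, products and composition with Lipschitz maps.\<close>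

definition tame :: "real \<Rightarrow> (real \<Rightarrow> real \<Rightarrow> real) \<Rightarrow> (real \<Rightarrow> real^'n \<Rightarrow> real) \<Rightarrow> bool" where
  "tame T d q \<longleftrightarrow> (\<exists>B\<ge>0. \<forall>t\<in>{-T..T}. \<forall>s\<in>{-T..T}. \<forall>x y.
     \<bar>q t x\<bar> \<le> B \<and> \<bar>q t x - q s y\<bar> \<le> B * (norm (x - y) + d t s))"

lemma tame_pair_bounds:
  assumes d: "\<And>t s. 0 \<le> d t s" and p: "tame T d p" and q: "tame T d q"
  obtains B where "B \<ge> 0"
    "\<And>t x. t \<in> {-T..T} \<Longrightarrow> \<bar>p t x\<bar> \<le> B \<and> \<bar>q t x\<bar> \<le> B"
    "\<And>t s x y. t \<in> {-T..T} \<Longrightarrow> s \<in> {-T..T} \<Longrightarrow>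
      \<bar>p t x - p s y\<bar> \<le> B * (norm (x - y) + d t s) \<and> \<bar>q t x - q s y\<bar> \<le> B * (norm (x - y) + d t s)"
proof -
  obtain P where P: "P \<ge> 0" "\<And>t s x y. t \<in> {-T..T} \<Longrightarrow> s \<in> {-T..T} \<Longrightarrow>
     \<bar>p t x\<bar> \<le> P \<and> \<bar>p t x - p s y\<bar> \<le> P * (norm (x - y) + d t s)"
    using p unfolding tame_def by blast
  obtain Q where Q: "Q \<ge> 0" "\<And>t s x y. t \<in> {-T..T} \<Longrightarrow> s \<in> {-T..T} \<Longrightarrow>
     \<bar>q t x\<bar> \<le> Q \<and> \<bar>q t x - q s y\<bar> \<le> Q * (norm (x - y) + d t s)"
    using q unfolding tame_def by blast
  show thesis
  proof (rule that[of "P + Q"])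
    show "0 \<le> P + Q" using P Q by simp
    fix t x assume t: "t \<in> {-T..T}"
    show "\<bar>p t x\<bar> \<le> P + Q \<and> \<bar>q t x\<bar> \<le> P + Q"
      using P(2)[OF t t, THEN conjunct1, of x] Q(2)[OF t t, THEN conjunct1, of x] P(1) Q(1) by linarith
    fix s y assume s: "s \<in> {-T..T}"
    let ?m = "norm (x - y) + d t s"
    have "P * ?m \<le> (P + Q) * ?m" "Q * ?m \<le> (P + Q) * ?m"
      using P(1) Q(1) d[of t s] by (auto intro!: mult_right_mono)
    then show "\<bar>p t x - p s y\<bar> \<le> (P + Q) * ?m \<and> \<bar>q t x - q s y\<bar> \<le> (P + Q) * ?m"
      using P(2)[OF t s, THEN conjunct2, of x y] Q(2)[OF t s, THEN conjunct2, of x y] by linarith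
  qed
qed

lemma tame_const: "(\<And>t s. 0 \<le> d t s) \<Longrightarrow> tame T d (\<lambda>t x. c)"
  unfolding tame_def by (intro exI[of _ "\<bar>c\<bar>"]) simp

lemma tame_add:
  assumes d: "\<And>t s. 0 \<le> d t s" and p: "tame T d p" and q: "tame T d q"
  shows "tame T d (\<lambda>t x. p t x + q t x)"
proof (rule tame_pair_bounds[OF d p q])
  fix B assume B: "B \<ge> 0" "\<And>t x. t \<in> {-T..T} \<Longrightarrow> \<bar>p t x\<bar> \<le> B \<and> \<bar>q t x\<bar> \<le> B"
    "\<And>t s x y. t \<in> {-T..T} \<Longrightarrow> s \<in> {-T..T} \<Longrightarrow>
      \<bar>p t x - p s y\<bar> \<le> B * (norm (x - y) + d t s) \<and> \<bar>q t x - q s y\<bar> \<le> B * (norm (x - y) + d t s)"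
  show ?thesis unfolding tame_def
  proof (intro exI[of _ "2 * B"] conjI ballI allI)
    fix t s x y assume t: "t \<in> {-T..T}" and s: "s \<in> {-T..T}"
    show "\<bar>p t x + q t x\<bar> \<le> 2 * B" using B(2)[OF t, of x] by linarith
    show "\<bar>p t x + q t x - (p s y + q s y)\<bar> \<le> 2 * B * (norm (x - y) + d t s)"
      using B(3)[OF t s, of x y] by (simp only: mult.assoc) linarith
  qed (use B in simp)
qed

lemma tame_mult:
  assumes d: "\<And>t s. 0 \<le> d t s" and p: "tame T d p" and q: "tame T d q"
  shows "tame T d (\<lambda>t x. p t x * q t x)"
proof (rule tame_pair_bounds[OF d p q])
  fix B assume B: "B \<ge> 0" "\<And>t x. t \<in> {-T..T} \<Longrightarrow> \<bar>p t x\<bar> \<le> B \<and> \<bar>q t x\<bar> \<le> B"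
    "\<And>t s x y. t \<in> {-T..T} \<Longrightarrow> s \<in> {-T..T} \<Longrightarrow>
      \<bar>p t x - p s y\<bar> \<le> B * (norm (x - y) + d t s) \<and> \<bar>q t x - q s y\<bar> \<le> B * (norm (x - y) + d t s)"
  show ?thesis unfolding tame_def
  proof (intro exI[of _ "2 * (B * B)"] conjI ballI allI)
    fix t s x y assume t: "t \<in> {-T..T}" and s: "s \<in> {-T..T}"
    have "\<bar>p t x * q t x\<bar> \<le> B * B"
      unfolding abs_mult using B(2)[OF t, of x] B(1) by (intro mult_mono) auto
    then show "\<bar>p t x * q t x\<bar> \<le> 2 * (B * B)" using mult_nonneg_nonneg[OF B(1) B(1)] by linarith
    let ?m = "norm (x - y) + d t s"
    have "p t x * q t x - p s y * q s y = p t x * (q t x - q s y) + (p t x - p s y) * q s y"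
      by (simp add: algebra_simps)
    then have "\<bar>p t x * q t x - p s y * q s y\<bar> \<le> \<bar>p t x\<bar> * \<bar>q t x - q s y\<bar> + \<bar>p t x - p s y\<bar> * \<bar>q s y\<bar>"
      using abs_triangle_ineq[of "p t x * (q t x - q s y)" "(p t x - p s y) * q s y"] by (simp add: abs_mult)
    also have "\<dots> \<le> B * (B * ?m) + (B * ?m) * B"
      using d[of t s] B(1) B(2)[OF t, of x] B(2)[OF s, of y] B(3)[OF t s, of x y]
      by (intro add_mono mult_mono) auto
    also have "\<dots> = 2 * (B * B) * ?m" by (simp add: algebra_simps)
    finally show "\<bar>p t x * q t x - p s y * q s y\<bar> \<le> 2 * (B * B) * ?m" .
  qed (use B in simp)
qed

lemma tame_sum:
  assumes d: "\<And>t s. 0 \<le> d t s"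
  shows "(\<And>i. i \<in> I \<Longrightarrow> tame T d (q i)) \<Longrightarrow> tame T d (\<lambda>t x. \<Sum>i\<in>I. q i t x)"
  by (induction I rule: infinite_finite_induct) (simp_all add: tame_const[OF d] tame_add[OF d])

lemma norm_matrix_le_sum: "norm (M :: real^'m^'n) \<le> (\<Sum>k\<in>UNIV. \<Sum>l\<in>UNIV. \<bar>M $ k $ l\<bar>)"
proof -
  have "norm M \<le> (\<Sum>k\<in>UNIV. norm (M $ k))"
    unfolding norm_vec_def[of M] by (rule L2_set_le_sum) simp
  also have "\<dots> \<le> (\<Sum>k\<in>UNIV. \<Sum>l\<in>UNIV. \<bar>M $ k $ l\<bar>)"
    by (intro sum_mono norm_le_l1_cart)
  finally show ?thesis .
qed

lemma tame_compose:
  fixes G :: "real^'m^'n \<Rightarrow> real" and A :: "real \<Rightarrow> real^'n \<Rightarrow> real^'m^'n"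
  assumes d: "\<And>t s. 0 \<le> d t s" and A: "\<And>k l. tame T d (\<lambda>t x. A t x $ k $ l)"
    and G: "C \<ge> 0" "\<And>M N. \<bar>G M - G N\<bar> \<le> C * norm (M - N)"
  shows "tame T d (\<lambda>t x. G (A t x))"
proof -
  have "\<forall>k l. \<exists>B. B \<ge> 0 \<and> (\<forall>t\<in>{-T..T}. \<forall>s\<in>{-T..T}. \<forall>x y.
     \<bar>A t x $ k $ l\<bar> \<le> B \<and> \<bar>A t x $ k $ l - A s y $ k $ l\<bar> \<le> B * (norm (x - y) + d t s))"
    using A unfolding tame_def by blast
  then obtain B where B: "\<And>k l. B k l \<ge> 0" "\<And>k l t s x y. t \<in> {-T..T} \<Longrightarrow> s \<in> {-T..T} \<Longrightarrow>
     \<bar>A t x $ k $ l\<bar> \<le> B k l \<and> \<bar>A t x $ k $ l - A s y $ k $ l\<bar> \<le> B k l * (norm (x - y) + d t s)"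
    by metis
  define S where "S = (\<Sum>k\<in>UNIV. \<Sum>l\<in>UNIV. B k l)"
  have S: "S \<ge> 0" unfolding S_def by (intro sum_nonneg B)
  have A1: "norm (A t x) \<le> S" if "t \<in> {-T..T}" for t x
    unfolding S_def by (rule order_trans[OF norm_matrix_le_sum]) (intro sum_mono B(2)[OF that that, THEN conjunct1])
  have A2: "norm (A t x - A s y) \<le> S * (norm (x - y) + d t s)" if "t \<in> {-T..T}" "s \<in> {-T..T}" for t s x y
  proof -
    have "norm (A t x - A s y) \<le> (\<Sum>k\<in>UNIV. \<Sum>l\<in>UNIV. B k l * (norm (x - y) + d t s))"
      by (rule order_trans[OF norm_matrix_le_sum], intro sum_mono) (use B(2)[OF that] in simp)
    then show ?thesis by (simp add: S_def sum_distrib_right)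
  qed
  show ?thesis unfolding tame_def
  proof (intro exI[of _ "\<bar>G 0\<bar> + C * S"] conjI ballI allI)
    fix t s x y assume t: "t \<in> {-T..T}" and s: "s \<in> {-T..T}"
    show "\<bar>G (A t x)\<bar> \<le> \<bar>G 0\<bar> + C * S"
      using G(2)[of "A t x" 0] mult_left_mono[OF A1[OF t, of x] G(1)] by simp
    have "\<bar>G (A t x) - G (A s y)\<bar> \<le> C * (S * (norm (x - y) + d t s))"
      using G(2)[of "A t x" "A s y"] mult_left_mono[OF A2[OF t s, of x y] G(1)] by linarith
    also have "\<dots> \<le> (\<bar>G 0\<bar> + C * S) * (norm (x - y) + d t s)"
      using d[of t s] by (simp add: distrib_right mult.assoc)
    finally show "\<bar>G (A t x) - G (A s y)\<bar> \<le> (\<bar>G 0\<bar> + C * S) * (norm (x - y) + d t s)" .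
  qed (use G S in simp)
qed

section \<open>The velocity field of the system\<close>

lemma integrable_component_L1: "integrable lebesgue f \<Longrightarrow> integrable lebesgue (\<lambda>\<xi>. f \<xi> $ i)"
  for f :: "'a::euclidean_space \<Rightarrow> real^'m"
  using integrable_inner_left[of "axis i 1" lebesgue f] by (simp add: inner_axis)

lemma L1_norm_nonneg: "0 \<le> L1_norm f"
  by (simp add: L1_norm_def integral_nonneg_AE)

lemma L1_norm_component_le:
  fixes f :: "'a::euclidean_space \<Rightarrow> real^'m"
  assumes "integrable lebesgue f"
  shows "L1_norm (\<lambda>\<xi>. f \<xi> $ i) \<le> L1_norm f"
  unfolding L1_norm_def using assms integrable_component_L1[OF assms, of i]
  by (intro integral_mono integrable_norm) (auto simp: component_le_norm_cart)

lemma L1_norm_add_le: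
  fixes f g :: "'a::euclidean_space \<Rightarrow> 'b::euclidean_space"
  assumes "integrable lebesgue f" "integrable lebesgue g"
  shows "L1_norm (\<lambda>x. f x + g x) \<le> L1_norm f + L1_norm g"
proof -
  have "L1_norm (\<lambda>x. f x + g x) \<le> (LINT x|lebesgue. norm (f x) + norm (g x))"
    unfolding L1_norm_def using assms
    by (intro integral_mono integrable_norm Bochner_Integration.integrable_add norm_triangle_ineq)
  also have "\<dots> = L1_norm f + L1_norm g"
    unfolding L1_norm_def by (intro Bochner_Integration.integral_add integrable_norm assms)
  finally show ?thesis .
qed

lemma axis_in_Basis: "axis k (1::real) \<in> (Basis :: (real^'n) set)"
  by (simp add: axis_in_Basis_iff)

text \<open>The system of transport equations whose velocities depend on the whole state through the
  convolution with \<open>\<eta>\<close>.\<close>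

locale nonlocal_system =
  fixes \<eta> :: "real^'n \<Rightarrow> real" and V :: "real^'m^'n \<Rightarrow> real^'m^'n" and L :: real
    and \<rho>\<^sub>0 :: "real^'n \<Rightarrow> real^'m" and \<rho> :: "real \<Rightarrow> real^'n \<Rightarrow> real^'m"
  assumes eta: "assumption_eta \<eta>" and V: "assumption_V L V" and L1_datum: "in_L1 \<rho>\<^sub>0"
    and sol: "system_solution UNIV \<eta> V \<rho>\<^sub>0 \<rho>"
begin

definition L1_dist :: "real \<Rightarrow> real \<Rightarrow> real" where
  "L1_dist t s = L1_norm (\<lambda>x. \<rho> t x - \<rho> s x)"

definition velocity :: "'m \<Rightarrow> real \<Rightarrow> real^'n \<Rightarrow> real^'n" where
  "velocity i t x = column i (V (grad_conv (\<rho> t) \<eta> x))"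

lemma eta_bounded: "\<exists>C\<ge>0. C_k_bounded C 3 \<eta>"
  using eta sobolev_Linf_imp_C_k_bounded unfolding assumption_eta_def by blast

lemma eta_partial_bounded:
  obtains C where "C \<ge> 0" "\<And>k. C_k_bounded C (Suc (Suc 0)) (partial (axis k 1) \<eta>)"
proof -
  obtain C where "C \<ge> 0" "C_k_bounded C 3 \<eta>"
    using eta sobolev_Linf_imp_C_k_bounded unfolding assumption_eta_def by blast
  then show thesis by (intro that[of C]) (simp_all add: numeral_3_eq_3 axis_in_Basis)
qed

lemma integrable_solution: "integrable lebesgue (\<rho> t)"
  using sol by (simp add: system_solution_def continuous_L1_def in_L1_def)

lemma integrable_solution_component: "integrable lebesgue (\<lambda>\<xi>. \<rho> t \<xi> $ i)"
  by (rule integrable_component_L1[OF integrable_solution])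

lemma L1_dist_nonneg: "0 \<le> L1_dist t s"
  by (simp add: L1_dist_def L1_norm_nonneg)

lemma L1_dist_refl: "L1_dist t t = 0"
  by (simp add: L1_dist_def L1_norm_def)

lemma L1_dist_sym: "L1_dist t s = L1_dist s t"
  by (simp add: L1_dist_def L1_norm_def norm_minus_commute)

lemma L1_dist_triangle: "L1_dist t s \<le> L1_dist t r + L1_dist r s"
  using L1_norm_add_le[of "\<lambda>x. \<rho> t x - \<rho> r x" "\<lambda>x. \<rho> r x - \<rho> s x"]
    Bochner_Integration.integrable_diff[OF integrable_solution integrable_solution]
  by (simp add: L1_dist_def)

lemma L1_dist_tendsto:
  assumes "X \<longlonglongrightarrow> t"
  shows "(\<lambda>n. L1_dist (X n) t) \<longlonglongrightarrow> 0"
proof -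
  have "((\<lambda>s. L1_dist s t) \<longlongrightarrow> L1_dist t t) (at t)"
    using sol by (simp add: system_solution_def continuous_L1_def L1_dist_def L1_norm_def)
  then have "isCont (\<lambda>s. L1_dist s t) t" by (simp add: isCont_def)
  from isCont_tendsto_compose[OF this assms] show ?thesis by (simp add: L1_dist_refl)
qed

text \<open>A continuous curve in a pseudometric space is uniformly continuous on a compact interval, by
  extraction of a convergent subsequence.\<close>

lemma L1_dist_uniform:
  assumes "e > 0"
  shows "\<exists>\<delta>>0. \<forall>t\<in>{-T..T}. \<forall>s\<in>{-T..T}. \<bar>t - s\<bar> < \<delta> \<longrightarrow> L1_dist t s < e"
proof (rule ccontr)
  assume neg: "\<not> ?thesis"
  have "\<exists>t s. t \<in> {-T..T} \<and> \<bar>t - s\<bar> < inverse (real (Suc n)) \<and> e \<le> L1_dist t s" for n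
    using neg by (metis inverse_positive_iff_positive not_less of_nat_0_less_iff zero_less_Suc)
  then obtain t s where ts: "\<And>n. t n \<in> {-T..T}" "\<And>n. \<bar>t n - s n\<bar> < inverse (real (Suc n))" "\<And>n. e \<le> L1_dist (t n) (s n)"
    by metis
  obtain l r where r: "strict_mono r" "(t \<circ> r) \<longlonglongrightarrow> l"
    using compact_imp_seq_compact[OF compact_Icc[of "-T" T]] ts(1) unfolding seq_compact_def by metis
  have "(\<lambda>n. t n - s n) \<longlonglongrightarrow> 0"
    by (rule Lim_null_comparison[OF always_eventually LIMSEQ_inverse_real_of_nat])
      (use less_imp_le[OF ts(2)] in simp)
  from LIMSEQ_subseq_LIMSEQ[OF this r(1)] have diff: "(\<lambda>n. t (r n) - s (r n)) \<longlonglongrightarrow> 0" by (simp add: o_def)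
  have tl: "(\<lambda>n. t (r n)) \<longlonglongrightarrow> l" using r(2) by (simp add: o_def)
  have sl: "(\<lambda>n. s (r n)) \<longlonglongrightarrow> l" using tendsto_diff[OF tl diff] by simp
  have "(\<lambda>n. L1_dist (t (r n)) l + L1_dist (s (r n)) l) \<longlonglongrightarrow> 0 + 0"
    by (intro tendsto_add L1_dist_tendsto tl sl)
  then have "0 + 0 \<ge> e"
  proof (rule tendsto_lowerbound[OF _ always_eventually], intro allI)
    show "e \<le> L1_dist (t (r n)) l + L1_dist (s (r n)) l" for n
      using ts(3)[of "r n"] L1_dist_triangle[of "t (r n)" "s (r n)" l] L1_dist_sym[of l "s (r n)"] by linarith
  qed simp
  then show False using assms by simp
qed

lemma L1_norm_locally_bounded: "\<exists>R\<ge>0. \<forall>t\<in>{-T..T}. L1_norm (\<rho> t) \<le> R"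
proof -
  have "continuous_on {-T..T} (\<lambda>t. L1_dist t 0)"
    unfolding continuous_on_sequentially comp_def
  proof (intro allI impI ballI, elim conjE)
    fix X :: "nat \<Rightarrow> real" and t assume X: "X \<longlonglongrightarrow> t"
    have "(\<lambda>n. L1_dist (X n) 0 - L1_dist t 0) \<longlonglongrightarrow> 0"
    proof (rule Lim_null_comparison[OF always_eventually L1_dist_tendsto[OF X]], intro allI)
      fix n
      show "norm (L1_dist (X n) 0 - L1_dist t 0) \<le> L1_dist (X n) t"
        using L1_dist_triangle[of "X n" 0 t] L1_dist_triangle[of t 0 "X n"] L1_dist_sym[of t "X n"]
        by (simp add: abs_le_iff)
    qed
    then show "(\<lambda>n. L1_dist (X n) 0) \<longlonglongrightarrow> L1_dist t 0" by (simp add: LIM_zero_iff)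
  qed
  then have "bounded ((\<lambda>t. L1_dist t 0) ` {-T..T})"
    by (intro compact_imp_bounded compact_continuous_image) auto
  then obtain R where R: "\<And>t. t \<in> {-T..T} \<Longrightarrow> L1_dist t 0 \<le> R"
    unfolding bounded_iff by (metis abs_le_D1 imageI real_norm_def)
  have "L1_norm (\<rho> t) \<le> \<bar>R\<bar> + L1_norm (\<rho> 0)" if "t \<in> {-T..T}" for t
    using L1_norm_add_le[of "\<lambda>x. \<rho> t x - \<rho> 0 x" "\<rho> 0"] R[OF that]
      Bochner_Integration.integrable_diff[OF integrable_solution integrable_solution] integrable_solution
    by (simp add: L1_dist_def)
  then show ?thesis by (intro exI[of _ "\<bar>R\<bar> + L1_norm (\<rho> 0)"]) (simp add: L1_norm_nonneg)
qed

text \<open>The convolution is linear in the state, so that its variation in time is bounded by the \<open>L\<^sup>1\<close>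
  distance of the states; its variation in space is bounded through one derivative of the kernel.\<close>

lemma tame_convol:
  assumes C: "C \<ge> 0" and h: "C_k_bounded C (Suc k) h"
  shows "tame T L1_dist (\<lambda>t x. convol (\<lambda>\<xi>. \<rho> t \<xi> $ i) h x)"
proof -
  obtain R where R: "R \<ge> 0" "\<And>t. t \<in> {-T..T} \<Longrightarrow> L1_norm (\<rho> t) \<le> R"
    using L1_norm_locally_bounded by metis
  let ?f = "\<lambda>t \<xi>. \<rho> t \<xi> $ i"
  let ?n = "real DIM(real^'n)"
  have n: "?n \<ge> 1" using DIM_positive[where 'a = "real^'n"] by linarith
  have h0: "C_k_bounded C 0 h" using C_k_bounded_mono_order[OF h, of 0] by simp
  have fR: "C * L1_norm (?f t) \<le> C * R" if "t \<in> {-T..T}" for t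
    using L1_norm_component_le[OF integrable_solution, of t i] R(2)[OF that] C by (intro mult_left_mono) auto
  show ?thesis unfolding tame_def
  proof (intro exI[of _ "?n * (C * R) + C"] conjI ballI allI)
    show "0 \<le> ?n * (C * R) + C" using C R by simp
    fix t s x y assume t: "t \<in> {-T..T}" and s: "s \<in> {-T..T}"
    have "C * R \<le> ?n * (C * R)" using mult_right_mono[OF n, of "C * R"] C R by simp
    then show "\<bar>convol (?f t) h x\<bar> \<le> ?n * (C * R) + C"
      using abs_convol_le[OF integrable_solution_component h0, of t i x] fR[OF t] C by linarith
    have "\<bar>convol (?f t) h x - convol (?f t) h y\<bar> \<le> ?n * (C * R) * norm (x - y)"
    proof -
      have b: "C_k_bounded (C * L1_norm (?f t)) (Suc k) (convol (?f t) h)"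
        by (rule C_k_bounded_convol[OF integrable_solution_component h])
      have "norm (convol (?f t) h x - convol (?f t) h y) \<le> ?n * (C * R) * norm (x - y)"
      proof (rule partials_bounded_imp_Lipschitz[OF C_k_bounded_imp_C_k[OF b]])
        fix b' :: "real^'n" and z assume "b' \<in> Basis"
        then have 1: "C_k_bounded (C * L1_norm (?f t)) k (partial b' (convol (?f t) h))" using b by simp
        have "C_k_bounded (C * L1_norm (?f t)) 0 (partial b' (convol (?f t) h))"
          by (rule C_k_bounded_mono_order[OF 1]) simp
        then have "\<bar>partial b' (convol (?f t) h) z\<bar> \<le> C * L1_norm (?f t)" by simp
        then show "norm (partial b' (convol (?f t) h) z) \<le> C * R" using fR[OF t] by simp
      qed
      then show ?thesis by simp
    qed
    moreover have "\<bar>convol (?f t) h y - convol (?f s) h y\<bar> \<le> C * L1_dist t s"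
    proof -
      have id: "integrable lebesgue (\<lambda>x. \<rho> t x - \<rho> s x)"
        by (intro Bochner_Integration.integrable_diff integrable_solution)
      have "\<bar>convol (?f t) h y - convol (?f s) h y\<bar> = \<bar>convol (\<lambda>\<xi>. (\<rho> t \<xi> - \<rho> s \<xi>) $ i) h y\<bar>"
        using convol_diff[OF integrable_solution_component integrable_solution_component h0, of t i s i y] by simp
      also have "\<dots> \<le> C * L1_norm (\<lambda>\<xi>. (\<rho> t \<xi> - \<rho> s \<xi>) $ i)"
        by (rule abs_convol_le[OF integrable_component_L1[OF id] h0])
      also have "\<dots> \<le> C * L1_dist t s"
        unfolding L1_dist_def using L1_norm_component_le[OF id] C by (intro mult_left_mono)
      finally show ?thesis .
    qed
    ultimately have "\<bar>convol (?f t) h x - convol (?f s) h y\<bar> \<le> ?n * (C * R) * norm (x - y) + C * L1_dist t s"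
      by linarith
    also have "\<dots> \<le> (?n * (C * R) + C) * norm (x - y) + (?n * (C * R) + C) * L1_dist t s"
      using C R L1_dist_nonneg by (intro add_mono mult_right_mono) auto
    finally show "\<bar>convol (?f t) h x - convol (?f s) h y\<bar> \<le> (?n * (C * R) + C) * (norm (x - y) + L1_dist t s)"
      by (simp add: distrib_left)
  qed
qed

lemma grad_conv_component:
  "grad_conv (\<rho> t) \<eta> x $ k $ l = convol (\<lambda>\<xi>. \<rho> t \<xi> $ l) (partial (axis k 1) \<eta>) x"
proof -
  obtain C where "C_k_bounded C 3 \<eta>" using eta_bounded by blast
  then have C3: "C_k_bounded C (Suc 2) \<eta>" by (simp add: numeral_3_eq_3 numeral_2_eq_2)
  show ?thesis
    by (simp add: grad_conv_def partial_convol(2)[OF integrable_solution_component C3 axis_in_Basis])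
qed

definition grad_conv_deriv :: "real \<Rightarrow> real^'n \<Rightarrow> real^'n \<Rightarrow> real^'m^'n" where
  "grad_conv_deriv t x h =
    (\<chi> k l. \<Sum>b\<in>Basis. (h \<bullet> b) *\<^sub>R convol (\<lambda>\<xi>. \<rho> t \<xi> $ l) (partial b (partial (axis k 1) \<eta>)) x)"

lemma grad_conv_has_derivative: "(grad_conv (\<rho> t) \<eta> has_derivative grad_conv_deriv t x) (at x)"
proof -
  obtain C where C2: "\<And>k. C_k_bounded C (Suc (Suc 0)) (partial (axis k 1) \<eta>)"
    using eta_partial_bounded by blast
  have "((\<lambda>x. grad_conv (\<rho> t) \<eta> x $ k $ l) has_derivative (\<lambda>h. grad_conv_deriv t x h $ k $ l)) (at x)" for k l
  proof -
    have "C_k (Suc (Suc 0)) (convol (\<lambda>\<xi>. \<rho> t \<xi> $ l) (partial (axis k 1) \<eta>))"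
      by (rule C_k_bounded_imp_C_k[OF C_k_bounded_convol[OF integrable_solution_component C2]])
    from C_k_has_derivative[OF this, of x]
    show ?thesis
      by (simp add: grad_conv_component grad_conv_deriv_def partial_convol(2)[OF integrable_solution_component C2])
  qed
  then show ?thesis by (intro has_derivative_vecI)
qed

definition velocity_deriv :: "'m \<Rightarrow> real \<Rightarrow> real^'n \<Rightarrow> real^'n \<Rightarrow> real^'n" where
  "velocity_deriv i t x h =
    column i (\<Sum>b\<in>Basis. (grad_conv_deriv t x h \<bullet> b) *\<^sub>R partial b V (grad_conv (\<rho> t) \<eta> x))"

lemma bounded_linear_column: "bounded_linear (column i :: real^'m^'n \<Rightarrow> real^'n)"
proof -
  have "linear (column i :: real^'m^'n \<Rightarrow> real^'n)"
    by (rule linearI) (simp_all add: column_def vec_eq_iff)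
  then show ?thesis by (simp add: linear_conv_bounded_linear)
qed

lemma velocity_has_derivative: "(velocity i t has_derivative velocity_deriv i t x) (at x)"
proof -
  have V2: "C_k (Suc 1) V" using assumption_V_bounds(2)[OF V] by (simp add: numeral_2_eq_2)
  have "((\<lambda>x. V (grad_conv (\<rho> t) \<eta> x)) has_derivative
      (\<lambda>h. \<Sum>b\<in>Basis. (grad_conv_deriv t x h \<bullet> b) *\<^sub>R partial b V (grad_conv (\<rho> t) \<eta> x))) (at x)"
    by (rule has_derivative_compose[OF grad_conv_has_derivative C_k_has_derivative[OF V2]])
  from bounded_linear.has_derivative[OF bounded_linear_column this, of i]
  show ?thesis by (simp add: velocity_def[abs_def] velocity_deriv_def[abs_def])
qed

text \<open>The chain rule. The divergence involves second derivatives of \<open>\<eta>\<close>; its Lipschitz continuity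
  in space, needed below, therefore uses the third ones.\<close>

lemma divergence_velocity:
  "divergence (velocity i t) x = (\<Sum>j\<in>UNIV. \<Sum>k\<in>UNIV. \<Sum>l\<in>UNIV.
     convol (\<lambda>\<xi>. \<rho> t \<xi> $ l) (partial (axis j 1) (partial (axis k 1) \<eta>)) x *
     partial (axis k (axis l 1)) V (grad_conv (\<rho> t) \<eta> x) $ j $ i)"
proof -
  have ax: "(\<Sum>b\<in>Basis. (axis j (1::real) \<bullet> b) * \<phi> b) = \<phi> (axis j 1)" for j :: 'n and \<phi> :: "real^'n \<Rightarrow> real"
  proof -
    have "(\<Sum>b\<in>Basis. (axis j (1::real) \<bullet> b) * \<phi> b) = (\<Sum>b\<in>Basis. if b = axis j 1 then \<phi> b else 0)"
      by (intro sum.cong) (auto simp: inner_Basis axis_in_Basis)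
    then show ?thesis by (simp add: axis_in_Basis)
  qed
  show ?thesis
    unfolding divergence_eq_trace[OF velocity_has_derivative] trace_matrix velocity_deriv_def
    by (simp add: column_def sum_Basis_matrix inner_axis grad_conv_deriv_def ax)
qed

lemma tame_grad_conv: "tame T L1_dist (\<lambda>t x. grad_conv (\<rho> t) \<eta> x $ k $ l)"
proof -
  obtain C where "C \<ge> 0" "\<And>k. C_k_bounded C (Suc (Suc 0)) (partial (axis k 1) \<eta>)"
    using eta_partial_bounded by blast
  then show ?thesis unfolding grad_conv_component by (rule tame_convol)
qed

lemma tame_velocity: "tame T L1_dist (\<lambda>t x. velocity i t x $ j)"
proof -
  have "\<bar>V M $ j $ i - V N $ j $ i\<bar> \<le> L * norm (M - N)" for M N
    using norm_component_component_le[of "V M - V N" j i] assumption_V_Lipschitz[OF V, of M N] by simp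
  from tame_compose[OF L1_dist_nonneg tame_grad_conv assumption_V_bounds(1)[OF V], of "\<lambda>M. V M $ j $ i", OF this]
  show ?thesis by (simp add: velocity_def column_def)
qed

lemma tame_divergence: "tame T L1_dist (\<lambda>t x. divergence (velocity i t) x)"
  unfolding divergence_velocity
proof (intro tame_sum[OF L1_dist_nonneg] tame_mult[OF L1_dist_nonneg])
  fix j k :: 'n and l :: 'm
  obtain C where C: "C \<ge> 0" "\<And>k. C_k_bounded C (Suc (Suc 0)) (partial (axis k 1) \<eta>)"
    using eta_partial_bounded by blast
  then have "C_k_bounded C (Suc 0) (partial (axis j 1) (partial (axis k 1) \<eta>))"
    by (simp add: axis_in_Basis)
  then show "tame T L1_dist (\<lambda>t x. convol (\<lambda>\<xi>. \<rho> t \<xi> $ l) (partial (axis j 1) (partial (axis k 1) \<eta>)) x)"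
    by (rule tame_convol[OF C(1)])
  let ?b = "axis k (axis l 1) :: real^'m^'n"
  have Vb: "C_k (Suc 0) (partial ?b V)"
    using assumption_V_bounds(2)[OF V] axis_axis_in_Basis[of k l] by (simp add: numeral_2_eq_2)
  have nn: "0 \<le> real DIM(real^'m^'n) * L" using assumption_V_bounds(1)[OF V] by simp
  have "\<bar>partial ?b V M $ j $ i - partial ?b V N $ j $ i\<bar> \<le> real DIM(real^'m^'n) * L * norm (M - N)" for M N
  proof -
    have "norm (partial ?b V M - partial ?b V N) \<le> real DIM(real^'m^'n) * L * norm (M - N)"
      by (rule partials_bounded_imp_Lipschitz[OF Vb assumption_V_bounds(5)[OF V _ axis_axis_in_Basis]])
    then show ?thesis
      using norm_component_component_le[of "partial ?b V M - partial ?b V N" j i] by simp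
  qed
  from tame_compose[OF L1_dist_nonneg tame_grad_conv nn, of "\<lambda>M. partial ?b V M $ j $ i", OF this]
  show "tame T L1_dist (\<lambda>t x. partial ?b V (grad_conv (\<rho> t) \<eta> x) $ j $ i)" .
qed

lemma regular_flow_velocity:
  assumes X: "characteristics UNIV (velocity i) X" and T: "T \<ge> 0"
  shows "\<exists>K. regular_flow (velocity i) (velocity_deriv i) X L1_dist T K"
proof -
  have "\<forall>j. \<exists>B. B \<ge> 0 \<and> (\<forall>t\<in>{-T..T}. \<forall>s\<in>{-T..T}. \<forall>x y. \<bar>velocity i t x $ j\<bar> \<le> B \<and>
     \<bar>velocity i t x $ j - velocity i s y $ j\<bar> \<le> B * (norm (x - y) + L1_dist t s))"
    using tame_velocity[of T i] unfolding tame_def by blast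
  then obtain B where B: "\<And>j. B j \<ge> 0" "\<And>j t s x y. t \<in> {-T..T} \<Longrightarrow> s \<in> {-T..T} \<Longrightarrow> \<bar>velocity i t x $ j\<bar> \<le> B j \<and>
     \<bar>velocity i t x $ j - velocity i s y $ j\<bar> \<le> B j * (norm (x - y) + L1_dist t s)"
    by metis
  obtain Bd where Bd: "Bd \<ge> 0" "\<And>t s x y. t \<in> {-T..T} \<Longrightarrow> s \<in> {-T..T} \<Longrightarrow> \<bar>divergence (velocity i t) x\<bar> \<le> Bd \<and>
     \<bar>divergence (velocity i t) x - divergence (velocity i s) y\<bar> \<le> Bd * (norm (x - y) + L1_dist t s)"
    using tame_divergence[of T i] unfolding tame_def by metis
  define S where "S = (\<Sum>j\<in>UNIV. B j)"
  have S: "S \<ge> 0" unfolding S_def by (intro sum_nonneg B)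
  have m: "0 \<le> norm (x - y) + L1_dist t s" for x y :: "real^'n" and t s
    using L1_dist_nonneg by (simp add: add_nonneg_nonneg)
  show ?thesis
  proof (intro exI[of _ "S + Bd"], unfold_locales)
    show "characteristics UNIV (velocity i) X" "0 \<le> T" by fact+
    show "0 \<le> S + Bd" using S Bd by simp
    show "(velocity i t has_derivative velocity_deriv i t x) (at x)" for t x
      by (rule velocity_has_derivative)
    show "L1_dist t t = 0" for t by (rule L1_dist_refl)
    show "\<exists>\<delta>>0. \<forall>t\<in>{-T..T}. \<forall>s\<in>{-T..T}. \<bar>t - s\<bar> < \<delta> \<longrightarrow> L1_dist t s < e" if "e > 0" for e
      by (rule L1_dist_uniform[OF that])
    fix t x assume t: "t \<in> {-T..T}"
    have "norm (velocity i t x) \<le> S"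
      unfolding S_def by (rule order_trans[OF norm_le_l1_cart]) (intro sum_mono B(2)[OF t t, THEN conjunct1])
    then show "norm (velocity i t x) \<le> S + Bd" using Bd by simp
    show "\<bar>divergence (velocity i t) x\<bar> \<le> S + Bd" using Bd(2)[OF t t, THEN conjunct1, of x] S by linarith
    fix s y assume s: "s \<in> {-T..T}"
    have "norm (velocity i t x - velocity i s y) \<le> (\<Sum>j\<in>UNIV. B j * (norm (x - y) + L1_dist t s))"
      by (rule order_trans[OF norm_le_l1_cart], rule sum_mono) (use B(2)[OF t s] in simp)
    also have "\<dots> \<le> (S + Bd) * (norm (x - y) + L1_dist t s)"
      unfolding sum_distrib_right[symmetric] S_def[symmetric] using Bd m by (intro mult_right_mono) auto
    finally show "norm (velocity i t x - velocity i s y) \<le> (S + Bd) * (norm (x - y) + L1_dist t s)" .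
    have "Bd * (norm (x - y) + L1_dist t s) \<le> (S + Bd) * (norm (x - y) + L1_dist t s)"
      using S m by (intro mult_right_mono) auto
    then show "\<bar>divergence (velocity i t) x - divergence (velocity i s) y\<bar> \<le> (S + Bd) * (norm (x - y) + L1_dist t s)"
      using Bd(2)[OF t s, THEN conjunct2, of x y] by linarith
  qed
qed

end

section \<open>Speed of propagation\<close>

lemma norm_eq_L2_columns: "norm (M :: real^'m^'n) = L2_set (\<lambda>l. norm (column l M)) UNIV"
proof -
  have "(\<Sum>k\<in>UNIV. \<Sum>l\<in>UNIV. (M $ k $ l)\<^sup>2) = (\<Sum>l\<in>UNIV. \<Sum>k\<in>UNIV. (M $ k $ l)\<^sup>2)"
    by (rule sum.swap)
  then show ?thesis by (simp add: norm_vec_def L2_set_def column_def sum_nonneg)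
qed

lemma norm_column_le: "norm (column l M) \<le> norm (M :: real^'m^'n)"
  unfolding norm_eq_L2_columns[of M] by (rule member_le_L2_set) auto

text \<open>The triangle inequality for the integral of the vector with entries \<open>\<bar>f x $ l\<bar>\<close>. It is
  obtained by pairing the vector \<open>w\<close> of the component norms with itself and using the
  Cauchy-Schwarz inequality under the integral.\<close>

lemma L2_set_component_L1_norms_le:
  fixes f :: "'a::euclidean_space \<Rightarrow> real^'m"
  assumes f: "integrable lebesgue f"
  shows "L2_set (\<lambda>l. L1_norm (\<lambda>x. f x $ l)) UNIV \<le> L1_norm f"
proof -
  define w where "w = (\<lambda>l. L1_norm (\<lambda>x. f x $ l))"
  let ?N = "L2_set w UNIV"
  have int: "integrable lebesgue (\<lambda>x. w l * \<bar>f x $ l\<bar>)" for l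
    by (intro integrable_mult_right integrable_abs integrable_component_L1 f)
  have "?N * ?N = (\<Sum>l\<in>UNIV. w l * w l)"
    by (simp add: L2_set_def sum_nonneg power2_eq_square[symmetric])
  also have "\<dots> = (\<Sum>l\<in>UNIV. (LINT x|lebesgue. w l * \<bar>f x $ l\<bar>))"
    by (simp add: w_def L1_norm_def)
  also have "\<dots> = (LINT x|lebesgue. (\<Sum>l\<in>UNIV. w l * \<bar>f x $ l\<bar>))"
    by (rule Bochner_Integration.integral_sum[symmetric]) (rule int)
  also have "\<dots> \<le> (LINT x|lebesgue. ?N * norm (f x))"
  proof (rule integral_mono)
    show "integrable lebesgue (\<lambda>x. \<Sum>l\<in>UNIV. w l * \<bar>f x $ l\<bar>)"
      by (intro Bochner_Integration.integrable_sum int)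
    show "integrable lebesgue (\<lambda>x. ?N * norm (f x))" using f by simp
    fix x
    have "(\<Sum>l\<in>UNIV. w l * \<bar>f x $ l\<bar>) \<le> (\<Sum>l\<in>UNIV. \<bar>w l\<bar> * \<bar>f x $ l\<bar>)"
      by (intro sum_mono mult_right_mono) auto
    also have "\<dots> \<le> ?N * L2_set (\<lambda>l. f x $ l) UNIV" by (rule L2_set_mult_ineq)
    also have "L2_set (\<lambda>l. f x $ l) UNIV = norm (f x)" by (simp add: norm_vec_def L2_set_def)
    finally show "(\<Sum>l\<in>UNIV. w l * \<bar>f x $ l\<bar>) \<le> ?N * norm (f x)" .
  qed
  also have "\<dots> = ?N * L1_norm f" by (simp add: L1_norm_def)
  finally have "?N * ?N \<le> ?N * L1_norm f" .
  then show ?thesis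
    unfolding w_def[symmetric] using L1_norm_nonneg[of f] L2_set_nonneg[of w UNIV]
    by (cases "?N = 0") auto
qed

text \<open>The union that defines the complement of the support is a union of countably many of its
  members, by the Lindelof property.\<close>

lemma AE_zero_off_spt: "AE x in lebesgue. x \<notin> spt f \<longrightarrow> f x = 0"
proof -
  define F where "F = {U. open U \<and> (AE x in lebesgue. x \<in> U \<longrightarrow> f x = 0)}"
  obtain F' where F': "F' \<subseteq> F" "countable F'" "\<Union>F' = \<Union>F"
    using Lindelof[of F] by (auto simp: F_def)
  have "\<forall>U\<in>F'. AE x in lebesgue. x \<in> U \<longrightarrow> f x = 0" using F'(1) by (auto simp: F_def)
  then have "AE x in lebesgue. \<forall>U\<in>F'. x \<in> U \<longrightarrow> f x = 0" by (rule AE_ball_countable[OF F'(2), THEN iffD2])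
  then show ?thesis
  proof eventually_elim
    case (elim x)
    show ?case
    proof
      assume "x \<notin> spt f"
      then have "x \<in> \<Union>F'" unfolding F'(3) by (auto simp: spt_def F_def)
      then show "f x = 0" using elim by blast
    qed
  qed
qed

lemma closed_spt: "closed (spt f)"
  unfolding spt_def by (intro closed_Compl open_Union) auto

lemma spt_subset_closed:
  assumes "closed S" "AE x in lebesgue. x \<notin> S \<longrightarrow> f x = 0"
  shows "spt f \<subseteq> S"
proof -
  have "- S \<in> {U. open U \<and> (AE x in lebesgue. x \<in> U \<longrightarrow> f x = 0)}"
    using assms by (simp add: open_Compl)
  then show ?thesis unfolding spt_def by blast
qed

text \<open>The slack \<open>r - r'\<close> absorbs the closure at the end: a closed ball of slightly smaller radius is
  transported, and the result lies in an open ball.\<close>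

lemma closed_subset_ball_imp_subset_smaller_cball:
  fixes S :: "'a::euclidean_space set"
  assumes "closed S" "S \<subseteq> ball a r" "0 < r"
  obtains r' where "r' < r" "S \<subseteq> cball a r'"
proof (cases "S = {}")
  case True
  then show thesis using that[of "r / 2"] assms by simp
next
  case False
  have "compact S"
    using assms(1,2) bounded_subset[OF bounded_ball] by (simp add: compact_eq_bounded_closed)
  obtain y where y: "y \<in> S" "\<And>z. z \<in> S \<Longrightarrow> dist a z \<le> dist a y"
    using continuous_attains_sup[OF \<open>compact S\<close>, of "dist a"] False continuous_on_dist[OF continuous_on_const continuous_on_id]
    by metis
  have "dist a y < r" using y(1) assms(2) by auto
  moreover have "S \<subseteq> cball a (dist a y)" using y(2) by auto
  ultimately show thesis by (rule that)
qed

context nonlocal_system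
begin

lemma characteristics_exist:
  obtains X where "characteristics UNIV (velocity i) X"
    "\<And>t. AE x in lebesgue. \<rho> t x $ i = \<rho>\<^sub>0 (X 0 t x) $ i *
       exp (- (LBINT \<tau>=ereal 0..ereal t. divergence (velocity i \<tau>) (X \<tau> t x)))"
proof -
  have "lagrangian_solution UNIV (velocity i) (\<lambda>x. \<rho>\<^sub>0 x $ i) (\<lambda>t x. \<rho> t x $ i)"
    using sol by (simp add: system_solution_def velocity_def[abs_def])
  then show thesis using that by (auto simp: lagrangian_solution_def)
qed

text \<open>The Lagrangian formula transports each component along its own regular flow.\<close>

lemma component_L1_norm_le: "L1_norm (\<lambda>x. \<rho> t x $ i) \<le> L1_norm (\<lambda>x. \<rho>\<^sub>0 x $ i)"
proof -
  obtain X where X: "characteristics UNIV (velocity i) X"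
    "\<And>t. AE x in lebesgue. \<rho> t x $ i = \<rho>\<^sub>0 (X 0 t x) $ i *
       exp (- (LBINT \<tau>=ereal 0..ereal t. divergence (velocity i \<tau>) (X \<tau> t x)))"
    using characteristics_exist[of i] by blast
  obtain K where K: "regular_flow (velocity i) (velocity_deriv i) X L1_dist \<bar>t\<bar> K"
    using regular_flow_velocity[OF X(1), of "\<bar>t\<bar>"] by auto
  interpret regular_flow "velocity i" "velocity_deriv i" X L1_dist "\<bar>t\<bar>" K by (rule K)
  show ?thesis
  proof (rule L1_norm_transported_le)
    show "t \<in> {- \<bar>t\<bar>..\<bar>t\<bar>}" by auto
    show "integrable lebesgue (\<lambda>x. \<rho>\<^sub>0 x $ i)"
      using L1_datum by (intro integrable_component_L1) (simp add: in_L1_def)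
    show "integrable lebesgue (\<lambda>x. \<rho> t x $ i)" by (rule integrable_solution_component)
    show "AE x in lebesgue. \<rho> t x $ i = transported (\<lambda>x. \<rho>\<^sub>0 x $ i) t x"
      using X(2)[of t] by (simp add: transported_def expansion_def)
  qed
qed

definition gradient_bound :: real where
  "gradient_bound = real_of_ereal (Linf_norm (gradient \<eta>))"

lemma continuous_gradient: "continuous_on UNIV (gradient \<eta>)"
proof -
  have "C_k (Suc (Suc (Suc 0))) \<eta>" using eta by (simp add: assumption_eta_def numeral_3_eq_3)
  then show ?thesis
    unfolding gradient_def[abs_def]
    by (intro continuous_on_vec_lambda) (simp add: axis_in_Basis)
qed

lemma norm_gradient_le: "norm (gradient \<eta> x) \<le> gradient_bound"
proof -
  obtain C where "\<And>k. C_k_bounded C (Suc (Suc 0)) (partial (axis k 1) \<eta>)"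
    using eta_partial_bounded by blast
  then have "\<bar>partial (axis k 1) \<eta> x\<bar> \<le> C" for k x by simp
  then have "norm (gradient \<eta> x) \<le> (\<Sum>k\<in>(UNIV::'n set). C)" for x
    by (intro order_trans[OF norm_le_l1_cart] sum_mono) (simp add: gradient_def)
  then have "Linf_norm (gradient \<eta>) \<le> ereal (\<Sum>k\<in>(UNIV::'n set). C)"
    unfolding Linf_norm_def
    using continuous_imp_measurable_lebesgue[OF continuous_on_norm[OF continuous_gradient]]
    by (intro esssup_I) auto
  then have "Linf_norm (gradient \<eta>) = ereal gradient_bound"
    using Linf_norm_nonneg[of "gradient \<eta>"] unfolding gradient_bound_def
    by (cases "Linf_norm (gradient \<eta>)") auto
  then show ?thesis using Linf_norm_le_imp_bound[OF continuous_gradient] by simp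
qed

lemma gradient_bound_nonneg: "0 \<le> gradient_bound"
  using norm_gradient_le[of 0] norm_ge_zero order_trans by blast

text \<open>The column \<open>z\<close> is the convolution of the scalar density with the vector field \<open>gradient \<eta>\<close>. Pairing
  it with itself reduces the bound to a scalar convolution with kernel \<open>z \<bullet> gradient \<eta>\<close>.\<close>

lemma norm_column_grad_conv_le:
  "norm (column l (grad_conv (\<rho> t) \<eta> x)) \<le> gradient_bound * L1_norm (\<lambda>\<xi>. \<rho> t \<xi> $ l)"
proof -
  define f where "f = (\<lambda>\<xi>. \<rho> t \<xi> $ l)"
  define z where "z = column l (grad_conv (\<rho> t) \<eta> x)"
  have f: "integrable lebesgue f" unfolding f_def by (rule integrable_solution_component)
  obtain C where C2: "\<And>k. C_k_bounded C (Suc (Suc 0)) (partial (axis k 1) \<eta>)"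
    using eta_partial_bounded by blast
  have C0: "C_k_bounded C 0 (partial (axis k 1) \<eta>)" for k
    by (rule C_k_bounded_mono_order[OF C2]) simp
  have zk: "z $ k = convol f (partial (axis k 1) \<eta>) x" for k
    by (simp add: z_def column_def grad_conv_component f_def)
  have "norm z * norm z = (\<Sum>k\<in>UNIV. z $ k * convol f (partial (axis k 1) \<eta>) x)"
    unfolding power2_eq_square[symmetric] power2_norm_eq_inner inner_vec_def
    by (simp add: zk[symmetric])
  also have "\<dots> = (LINT \<xi>|lebesgue. (\<Sum>k\<in>UNIV. z $ k * (f \<xi> * partial (axis k 1) \<eta> (x - \<xi>))))"
    unfolding convol_def
    by (subst Bochner_Integration.integral_sum) (auto intro!: integrable_mult_right integrable_convol[OF f C0])
  also have "\<dots> = convol f (\<lambda>y. z \<bullet> gradient \<eta> y) x"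
    unfolding convol_def by (simp add: gradient_def inner_vec_def sum_distrib_left mult_ac)
  also have "\<dots> \<le> (norm z * gradient_bound) * L1_norm f"
  proof -
    have "C_k_bounded (norm z * gradient_bound) 0 (\<lambda>y. z \<bullet> gradient \<eta> y)"
    proof (simp, intro conjI allI)
      show "continuous_on UNIV (\<lambda>y. z \<bullet> gradient \<eta> y)" by (intro continuous_intros continuous_gradient)
      show "\<bar>z \<bullet> gradient \<eta> y\<bar> \<le> norm z * gradient_bound" for y
        using Cauchy_Schwarz_ineq2[of z "gradient \<eta> y"] mult_left_mono[OF norm_gradient_le[of y] norm_ge_zero[of z]]
        by linarith
    qed
    from abs_convol_le[OF f this, of x] show ?thesis by simp
  qed
  finally have le: "norm z * norm z \<le> norm z * (gradient_bound * L1_norm f)" by (simp add: mult.assoc)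
  have "0 \<le> gradient_bound * L1_norm f" by (simp add: gradient_bound_nonneg L1_norm_nonneg)
  then show ?thesis
    using le unfolding z_def[symmetric] f_def[symmetric] by (cases "norm z = 0") auto
qed

definition speed :: real where
  "speed = L * gradient_bound * L1_norm \<rho>\<^sub>0"

text \<open>The norms of the single components are controlled by those of the datum, while the \<open>L\<^sup>1\<close> norm of
  the vector \<open>\<rho> t\<close> may grow, for instance when two components that coincide at time \<open>0\<close> move
  apart. The columns of the convolution are therefore estimated one by one, and only the
  Euclidean combination of the norms of the components of the datum is compared with
  \<open>L1_norm \<rho>\<^sub>0\<close>.\<close>

lemma norm_velocity_le: "norm (velocity i t x) \<le> speed"
proof -
  let ?A = "grad_conv (\<rho> t) \<eta> x"
  have "norm ?A = L2_set (\<lambda>l. norm (column l ?A)) UNIV" by (rule norm_eq_L2_columns)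
  also have "\<dots> \<le> L2_set (\<lambda>l. gradient_bound * L1_norm (\<lambda>\<xi>. \<rho>\<^sub>0 \<xi> $ l)) UNIV"
  proof (rule L2_set_mono)
    fix l
    show "norm (column l ?A) \<le> gradient_bound * L1_norm (\<lambda>\<xi>. \<rho>\<^sub>0 \<xi> $ l)"
      using norm_column_grad_conv_le[of l t x] mult_left_mono[OF component_L1_norm_le[of t l] gradient_bound_nonneg]
      by linarith
  qed simp
  also have "\<dots> = gradient_bound * L2_set (\<lambda>l. L1_norm (\<lambda>\<xi>. \<rho>\<^sub>0 \<xi> $ l)) UNIV"
    by (rule L2_set_right_distrib[OF gradient_bound_nonneg, symmetric])
  also have "\<dots> \<le> gradient_bound * L1_norm \<rho>\<^sub>0"
    using L1_datum gradient_bound_nonneg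
    by (intro mult_left_mono L2_set_component_L1_norms_le) (auto simp: in_L1_def)
  finally have A: "norm ?A \<le> gradient_bound * L1_norm \<rho>\<^sub>0" .
  have "norm (velocity i t x) \<le> norm (V ?A)" unfolding velocity_def by (rule norm_column_le)
  also have "\<dots> \<le> L * norm ?A"
    using assumption_V_Lipschitz[OF V, of ?A 0] assumption_V_bounds(3)[OF V] by simp
  also have "\<dots> \<le> L * (gradient_bound * L1_norm \<rho>\<^sub>0)"
    using A assumption_V_bounds(1)[OF V] by (rule mult_left_mono)
  finally show ?thesis by (simp add: speed_def mult.assoc)
qed

text \<open>A characteristic through a point outside the enlarged ball has moved by at most
  \<open>speed * \<bar>t\<bar>\<close> since time \<open>0\<close>; it started outside the support of the datum, where the
  Lagrangian formula gives the value \<open>0\<close>.\<close>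

lemma AE_zero_off_enlarged_cball:
  assumes "spt \<rho>\<^sub>0 \<subseteq> cball x\<^sub>0 r"
  shows "AE x in lebesgue. x \<notin> cball x\<^sub>0 (r + speed * \<bar>t\<bar>) \<longrightarrow> \<rho> t x = 0"
proof -
  have "AE x in lebesgue. x \<notin> cball x\<^sub>0 (r + speed * \<bar>t\<bar>) \<longrightarrow> \<rho> t x $ i = 0" for i
  proof -
    obtain X where X: "characteristics UNIV (velocity i) X"
      "\<And>t. AE x in lebesgue. \<rho> t x $ i = \<rho>\<^sub>0 (X 0 t x) $ i *
         exp (- (LBINT \<tau>=ereal 0..ereal t. divergence (velocity i \<tau>) (X \<tau> t x)))"
      using characteristics_exist[of i] by blast
    obtain K where K: "regular_flow (velocity i) (velocity_deriv i) X L1_dist \<bar>t\<bar> K"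
      using regular_flow_velocity[OF X(1), of "\<bar>t\<bar>"] by auto
    interpret regular_flow "velocity i" "velocity_deriv i" X L1_dist "\<bar>t\<bar>" K by (rule K)
    have "AE x in lebesgue. X 0 t x \<notin> spt \<rho>\<^sub>0 \<longrightarrow> \<rho>\<^sub>0 (X 0 t x) = 0"
      by (rule AE_compose_X0[OF _ AE_zero_off_spt]) auto
    with X(2)[of t] show ?thesis
    proof eventually_elim
      case (elim x)
      show ?case
      proof
        assume "x \<notin> cball x\<^sub>0 (r + speed * \<bar>t\<bar>)"
        have "norm (X 0 t x - X t t x) \<le> speed * \<bar>0 - t\<bar>"
          by (rule vector_derivative_bound[of 0 t "\<lambda>s. X s t x" "\<lambda>s. velocity i s (X s t x)",
                OF has_vector_derivative_at_within[OF X_der] norm_velocity_le])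
        then have "dist (X 0 t x) x \<le> speed * \<bar>t\<bar>" by (simp add: X_init dist_norm)
        then have "X 0 t x \<notin> cball x\<^sub>0 r"
          using \<open>x \<notin> _\<close> dist_triangle[of x\<^sub>0 x "X 0 t x"] by simp
        then show "\<rho> t x $ i = 0" using elim assms by auto
      qed
    qed
  qed
  then have "AE x in lebesgue. \<forall>i. x \<notin> cball x\<^sub>0 (r + speed * \<bar>t\<bar>) \<longrightarrow> \<rho> t x $ i = 0"
    by (rule eventually_all_finite)
  then show ?thesis by eventually_elim (simp add: vec_eq_iff)
qed

end

theorem lemma2p4:
  fixes \<eta> :: "real^'n \<Rightarrow> real"
    and V :: "real^'m^'n \<Rightarrow> real^'m^'n"
    and L\<^sub>V r :: real
    and \<rho>\<^sub>o :: "real^'n \<Rightarrow> real^'m"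
    and \<rho> :: "real \<Rightarrow> real^'n \<Rightarrow> real^'m"
    and x\<^sub>o :: "real^'n"
  assumes "assumption_eta \<eta>"
    and "assumption_V L\<^sub>V V"
    and "in_L1 \<rho>\<^sub>o" and "in_Linf \<rho>\<^sub>o" and "in_BV \<rho>\<^sub>o"
    and "0 < r"
    and "system_solution UNIV \<eta> V \<rho>\<^sub>o \<rho>"
    and "spt \<rho>\<^sub>o \<subseteq> ball x\<^sub>o r"
  shows "let W = L\<^sub>V * real_of_ereal (Linf_norm (gradient \<eta>)) * L1_norm \<rho>\<^sub>o
         in \<forall>t. spt (\<rho> t) \<subseteq> ball x\<^sub>o (r + W * \<bar>t\<bar>)"
proof -
  interpret nonlocal_system \<eta> V L\<^sub>V \<rho>\<^sub>o \<rho> by unfold_locales fact+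
  obtain r' where r': "r' < r" "spt \<rho>\<^sub>o \<subseteq> cball x\<^sub>o r'"
    using closed_subset_ball_imp_subset_smaller_cball[OF closed_spt assms(8,6)] by blast
  have "spt (\<rho> t) \<subseteq> ball x\<^sub>o (r + speed * \<bar>t\<bar>)" for t
  proof -
    have "spt (\<rho> t) \<subseteq> cball x\<^sub>o (r' + speed * \<bar>t\<bar>)"
      by (rule spt_subset_closed[OF closed_cball AE_zero_off_enlarged_cball[OF r'(2)]])
    also have "\<dots> \<subseteq> ball x\<^sub>o (r + speed * \<bar>t\<bar>)" using r'(1) by auto
    finally show ?thesis .
  qed
  then show ?thesis by (simp add: Let_def speed_def gradient_bound_def)
qed

end
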